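(* Let $d=1$, fix $0<\lambda\le1$, and assume A1 and A2 at $\theta_0\in\Theta$. Let $u_\epsilon>0$ with $\epsilon^{-1}u_\epsilon\to\infty$ and $\epsilon^{-2}u_\epsilon^{2+\lambda}\to0$ as $\epsilon\to0$. Consider testing $H_0:\theta=\theta_0$ versus $H_\epsilon:\theta=\theta_\epsilon:=\theta_0+u_\epsilon$. Then for any family of tests $K_\epsilon$ with $\alpha_\epsilon:=\alpha(K_\epsilon)<c<1$ ($c$ a constant), $$\beta(K_\epsilon)\ge\Phi\left(x_{\alpha_\epsilon}-\epsilon^{-1}u_\epsilon I^{1/2}(\theta_0)\right)(1+o(1)),\qquad( * )$$ where $x_{\alpha_\epsilon}$ is defined by $\alpha_\epsilon=1-\Phi(x_{\alpha_\epsilon})$. The lower bound $( * )$ is attained (with equality) on the tests $L_\epsilon$, $\alpha(L_\epsilon)=\alpha_\epsilon$, generated by the test statistic $T=I^{-1/2}(\theta_0)\int_0^1S_\theta(t,\theta_0)\,dY_\epsilon(t)$. If equality is attained in $( * )$ for the family $K_\epsilon$, then for the family of tests $L_\epsilon$ with $\alpha_\epsilon=\alpha(L_\epsilon)$, $$\lim_{\epsilon\to0}\alpha_\epsilon^{-1}\mathbf E_{\theta_0}\left[|K_\epsilon-L_\epsilon|\right]=0$$ and $$\lim_{\epsilon\to0}\left(\Phi\left(x_{\alpha_\epsilon}-\epsilon^{-1}u_\epsilon I^{1/2}(\theta_0)\right)\right)^{-1}\mathbf E_{\theta_\epsilon}\left[|K_\epsilon-L_\epsilon|\right]=0 .$$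
   Context: Model: for $\epsilon>0$ one observes $Y_\epsilon(t)$, $t\in(0,1)$, with $dY_\epsilon(t)=S(t,\theta)\,dt+\epsilon\,dw(t)$, where $w$ is a standard Wiener process, $S(\cdot,\theta)\in L_2(0,1)$ is a signal, and the unknown parameter $\theta$ belongs to an open set $\Theta\subset\mathbb R^d$ (here $d=1$). $\mathbf P_\theta,\mathbf E_\theta$ denote probability and expectation when the parameter value is $\theta$. $\Phi$ is the standard normal distribution function. A1 (at $\theta_0$): there is a function $S_\theta(\cdot,\theta_0)$ in $L_2(0,1)$ with $\int_0^1\big(S(t,\theta)-S(t,\theta_0)-(\theta-\theta_0)S_\theta(t,\theta_0)\big)^2dt=o(|\theta-\theta_0|^2)$ as $\theta\to\theta_0$, and the Fisher information $I(\theta_0)=\int_0^1S_\theta(t,\theta_0)^2\,dt$ is positive. A2 (at $\theta_0$, with exponent $\lambda$): as $\theta\to\theta_0$, $\int_0^1\big(S(t,\theta)-S(t,\theta_0)-(\theta-\theta_0)S_\theta(t,\theta_0)\big)^2dt=O(|\theta-\theta_0|^{2+\lambda})$ and $\int_0^1(S(t,\theta)-S(t,\theta_0))^2dt-(\theta-\theta_0)^2I(\theta_0)=O(|\theta-\theta_0|^{2+\lambda})$. A test $K_\epsilon$ is a $[0,1]$-valued measurable function of the observation (the probability of rejecting $H_0$); $\alpha(K_\epsilon)=\mathbf E_{\theta_0}[K_\epsilon]$ and $\beta(K_\epsilon)=\mathbf E_{\theta_\epsilon}[1-K_\epsilon]$ are its type I and type II error probabilities. Tests generated by a statistic $T$ are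 tests that reject $H_0$ when $T$ exceeds a threshold (depending on $\epsilon$). "Equality is attained in $( * )$" means $\beta(K_\epsilon)=\Phi(x_{\alpha_\epsilon}-\epsilon^{-1}u_\epsilon I^{1/2}(\theta_0))(1+o(1))$ as $\epsilon\to0$.
   Formalization: The first limit (under θ_0, relative to α_ε) is false for very small levels; it is proved under the extra condition that for some δ>0, x_{α_ε} ≤ (1−δ)ε^{-1}u_ε I^{1/2}(θ_0) for all small ε. All other claims are proved without it. *)

theory Defs
  imports "HOL-Probability.Probability" "HOL-Library.Landau_Symbols"
begin

abbreviation unit_interval_measure :: "real measure" where
  "unit_interval_measure \<equiv> lebesgue_on {0<..<1}"

definition L2_unit :: "(real \<Rightarrow> real) \<Rightarrow> bool" where
  "L2_unit f \<longleftrightarrow> f \<in> borel_measurable unit_interval_measure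
     \<and> integrable unit_interval_measure (\<lambda>t. (f t)\<^sup>2)"

locale wiener_process = prob_space M for M :: "'a measure" +
  fixes w :: "real \<Rightarrow> 'a \<Rightarrow> real"
  assumes measurable_w: "\<And>t. t \<in> {0..1} \<Longrightarrow> w t \<in> borel_measurable M"
    and start_zero: "AE \<omega> in M. w 0 \<omega> = 0"
    and indep_increments:
      "\<And>(n::nat) (\<tau>::nat \<Rightarrow> real).
        0 \<le> \<tau> 0 \<Longrightarrow> (\<And>i. i < n \<Longrightarrow> \<tau> i \<le> \<tau> (Suc i)) \<Longrightarrow> \<tau> n \<le> 1 \<Longrightarrow>
        indep_vars (\<lambda>_. borel) (\<lambda>i \<omega>. w (\<tau> (Suc i)) \<omega> - w (\<tau> i) \<omega>) {..<n}"
    and gaussian_increments: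
      "\<And>s t. 0 \<le> s \<Longrightarrow> s < t \<Longrightarrow> t \<le> 1 \<Longrightarrow>
        distributed M lborel (\<lambda>\<omega>. w t \<omega> - w s \<omega>) (normal_density 0 (sqrt (t - s)))"
    and continuous_paths: "AE \<omega> in M. continuous_on {0..1} (\<lambda>t. w t \<omega>)"

text \<open>
  The observation is the whole path of Y on the unit interval. Sample paths live in the product
  space with its product sigma-algebra; its trace on the continuous paths is the Borel
  sigma-algebra of the space of continuous functions, and every measurable function on that trace
  extends to the product space, so tests on this space are the measurable functions of the
  observed path.
\<close>

definition path_space :: "(real \<Rightarrow> real) measure" where
  "path_space = PiM {0..1} (\<lambda>_. borel)"

text \<open>The equation dY = S dt + eps dw, read in integrated form with Y(0) = 0.\<close>

definition observed_path ::
  "(real \<Rightarrow> 'a \<Rightarrow> real) \<Rightarrow> (real \<Rightarrow> real \<Rightarrow> real) \<Rightarrow> real \<Rightarrow> real \<Rightarrow> 'a \<Rightarrow> real \<Rightarrow> real" where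
  "observed_path w S \<epsilon> \<theta> \<omega> =
     (\<lambda>t\<in>{0..1}. (LINT s|lebesgue_on {0<..<t}. S s \<theta>) + \<epsilon> * w t \<omega>)"

definition obs_law ::
  "'a measure \<Rightarrow> (real \<Rightarrow> 'a \<Rightarrow> real) \<Rightarrow> (real \<Rightarrow> real \<Rightarrow> real) \<Rightarrow> real \<Rightarrow> real
    \<Rightarrow> (real \<Rightarrow> real) measure" where
  "obs_law M w S \<epsilon> \<theta> = distr M path_space (observed_path w S \<epsilon> \<theta>)"

definition fisher_info :: "(real \<Rightarrow> real) \<Rightarrow> real" where
  "fisher_info S\<^sub>\<theta> = (LINT t|unit_interval_measure. (S\<^sub>\<theta> t)\<^sup>2)"

definition cond_A1 ::
  "(real \<Rightarrow> real \<Rightarrow> real) \<Rightarrow> (real \<Rightarrow> real) \<Rightarrow> real \<Rightarrow> bool" where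
  "cond_A1 S S\<^sub>\<theta> \<theta>\<^sub>0 \<longleftrightarrow> L2_unit S\<^sub>\<theta>
     \<and> (\<lambda>\<theta>. LINT t|unit_interval_measure. (S t \<theta> - S t \<theta>\<^sub>0 - (\<theta> - \<theta>\<^sub>0) * S\<^sub>\<theta> t)\<^sup>2)
         \<in> o[at \<theta>\<^sub>0](\<lambda>\<theta>. \<bar>\<theta> - \<theta>\<^sub>0\<bar>\<^sup>2)
     \<and> fisher_info S\<^sub>\<theta> > 0"

definition cond_A2 ::
  "real \<Rightarrow> (real \<Rightarrow> real \<Rightarrow> real) \<Rightarrow> (real \<Rightarrow> real) \<Rightarrow> real \<Rightarrow> bool" where
  "cond_A2 lam S S\<^sub>\<theta> \<theta>\<^sub>0 \<longleftrightarrow>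
     (\<lambda>\<theta>. LINT t|unit_interval_measure. (S t \<theta> - S t \<theta>\<^sub>0 - (\<theta> - \<theta>\<^sub>0) * S\<^sub>\<theta> t)\<^sup>2)
       \<in> O[at \<theta>\<^sub>0](\<lambda>\<theta>. \<bar>\<theta> - \<theta>\<^sub>0\<bar> powr (2 + lam))
     \<and> (\<lambda>\<theta>. (LINT t|unit_interval_measure. (S t \<theta> - S t \<theta>\<^sub>0)\<^sup>2)
              - (\<theta> - \<theta>\<^sub>0)\<^sup>2 * fisher_info S\<^sub>\<theta>)
       \<in> O[at \<theta>\<^sub>0](\<lambda>\<theta>. \<bar>\<theta> - \<theta>\<^sub>0\<bar> powr (2 + lam))"

text \<open>
  A list of triples (c, a, b) encodes the step function that is the sum of the functions
  c times the indicator of the interval from a (excluded) to b (included).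
\<close>

type_synonym step = "(real \<times> real \<times> real) list"

definition valid_step :: "step \<Rightarrow> bool" where
  "valid_step \<phi> \<longleftrightarrow> (\<forall>(c, a, b) \<in> set \<phi>. 0 \<le> a \<and> a \<le> b \<and> b \<le> 1)"

definition step_fun :: "step \<Rightarrow> real \<Rightarrow> real" where
  "step_fun \<phi> s = (\<Sum>(c, a, b)\<leftarrow>\<phi>. c * indicator {a<..b} s)"

definition step_integral :: "step \<Rightarrow> (real \<Rightarrow> real) \<Rightarrow> real" where
  "step_integral \<phi> y = (\<Sum>(c, a, b)\<leftarrow>\<phi>. c * (y b - y a))"

text \<open>
  The functional J of the path is a version, under the path law P, of the stochastic integral of f
  against dY: the mean-square limit of the integrals of step functions converging to f in the
  space of square-integrable functions. The mean square is a nonnegative integral, because the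
  Bochner integral of a non-integrable function is 0.
\<close>

definition stoch_integral ::
  "(real \<Rightarrow> real) measure \<Rightarrow> (real \<Rightarrow> real) \<Rightarrow> ((real \<Rightarrow> real) \<Rightarrow> real) \<Rightarrow> bool" where
  "stoch_integral P f J \<longleftrightarrow> J \<in> borel_measurable path_space
     \<and> (\<exists>\<phi>. (\<forall>n. valid_step (\<phi> n))
          \<and> (\<lambda>n. LINT s|unit_interval_measure. (step_fun (\<phi> n) s - f s)\<^sup>2) \<longlonglongrightarrow> 0
          \<and> (\<lambda>n. \<integral>\<^sup>+ y. ennreal ((step_integral (\<phi> n) y - J y)\<^sup>2) \<partial>P) \<longlonglongrightarrow> 0)"

text \<open>
  The statistic is the stochastic integral of the derivative of the signal against dY, divided by
  the square root of the Fisher information: one functional of the observation which is a version of the stochastic integral under every parameter value.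
\<close>

definition efficient_statistic ::
  "(real \<Rightarrow> (real \<Rightarrow> real) measure) \<Rightarrow> real set \<Rightarrow> (real \<Rightarrow> real) \<Rightarrow> ((real \<Rightarrow> real) \<Rightarrow> real) \<Rightarrow> bool" where
  "efficient_statistic P \<Theta> S\<^sub>\<theta> T \<longleftrightarrow>
     (\<exists>J. (\<forall>\<theta>\<in>\<Theta>. stoch_integral (P \<theta>) S\<^sub>\<theta> J) \<and> T = (\<lambda>y. J y / sqrt (fisher_info S\<^sub>\<theta>)))"

definition is_test :: "((real \<Rightarrow> real) \<Rightarrow> real) \<Rightarrow> bool" where
  "is_test K \<longleftrightarrow> K \<in> borel_measurable path_space \<and> (\<forall>y\<in>space path_space. 0 \<le> K y \<and> K y \<le> 1)"

definition threshold_test :: "((real \<Rightarrow> real) \<Rightarrow> real) \<Rightarrow> real \<Rightarrow> (real \<Rightarrow> real) \<Rightarrow> real" where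
  "threshold_test T h y = (if h < T y then 1 else 0)"

definition type1_error :: "(real \<Rightarrow> real) measure \<Rightarrow> ((real \<Rightarrow> real) \<Rightarrow> real) \<Rightarrow> real" where
  "type1_error P K = (LINT y|P. K y)"

definition type2_error :: "(real \<Rightarrow> real) measure \<Rightarrow> ((real \<Rightarrow> real) \<Rightarrow> real) \<Rightarrow> real" where
  "type2_error P K = (LINT y|P. 1 - K y)"

abbreviation std_normal_cdf :: "real \<Rightarrow> real" ("\<Phi>") where
  "\<Phi> \<equiv> cdf std_normal_distribution"

text \<open>\<open>f \<ge> g (1 + o(1))\<close> and \<open>f = g (1 + o(1))\<close> as the noise level tends to zero.\<close>

definition asymp_ge :: "(real \<Rightarrow> real) \<Rightarrow> (real \<Rightarrow> real) \<Rightarrow> bool" where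
  "asymp_ge f g \<longleftrightarrow>
     (\<exists>r\<in>o[at_right 0](\<lambda>_. 1). \<forall>\<^sub>F \<epsilon> in at_right 0. f \<epsilon> \<ge> g \<epsilon> * (1 + r \<epsilon>))"

definition asymp_eq :: "(real \<Rightarrow> real) \<Rightarrow> (real \<Rightarrow> real) \<Rightarrow> bool" where
  "asymp_eq f g \<longleftrightarrow>
     (\<exists>r\<in>o[at_right 0](\<lambda>_. 1). \<forall>\<^sub>F \<epsilon> in at_right 0. f \<epsilon> = g \<epsilon> * (1 + r \<epsilon>))"

text \<open>
  Side condition under which closeness of the tests relative to the type I error probability is
  claimed. It cannot be dropped: for \<open>S t \<theta> = \<theta>\<close>, \<open>\<theta>\<^sub>0 = 0\<close>, levels with \<open>x \<epsilon> = 2 * \<rho> \<epsilon>\<close>, and K rejecting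
  when the statistic is below \<open>- \<epsilon> * x \<epsilon>\<close>, both type II error probabilities tend to 1, so K attains the
  bound, although K and L have disjoint rejection regions.
\<close>

definition level_not_too_small :: "(real \<Rightarrow> real) \<Rightarrow> (real \<Rightarrow> real) \<Rightarrow> bool" where
  "level_not_too_small x \<rho> \<longleftrightarrow> (\<exists>\<delta>>0. \<forall>\<^sub>F \<epsilon> in at_right 0. x \<epsilon> \<le> (1 - \<delta>) * \<rho> \<epsilon>)"

end

theory Submission
  imports Defs
begin

text \<open>
  By the Cameron-Martin-Girsanov formula the laws of the observation under two parameter values form
  a Gaussian shift experiment: the log likelihood ratio is \<open>r * Z - r\<^sup>2 / 2\<close>, where \<open>Z\<close> is standard
  normal under the hypothesis and \<open>\<epsilon> * r\<close> is the distance of the two signals. The Neyman-Pearson lemma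
  gives the exact bound \<open>\<Phi> (x - r)\<close>, and A2 makes \<open>r\<close> so close to \<open>\<rho> = u * sqrt I / \<epsilon>\<close> that
  \<open>(r - \<rho>) * \<rho>\<close> tends to 0. Since the logarithm of \<open>\<Phi>\<close> has a derivative of at most linear growth in the
  left tail, replacing \<open>r\<close> by \<open>\<rho>\<close> changes the bound by a factor tending to 1 only. The same estimate
  applies to the error of the test based on the efficient statistic, which is Gaussian under both
  parameter values.

  For the closeness of tests, the excess of the type II error over the optimum is the integral of
  \<open>\<bar>K - K\<^sub>0\<bar> * \<bar>lr - k\<bar>\<close>, where \<open>K\<^sub>0\<close> is the optimal test of the same level and \<open>k\<close> its critical value.
  Outside the strip \<open>\<bar>Z - x\<bar> < \<eta> / r\<close> the second factor is bounded below by a fixed proportion of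
  \<open>lr\<close> and of \<open>k\<close>, and the strip itself has a relative probability that is small with \<open>\<eta>\<close>.
\<close>

subsection \<open>Tail estimates for the normal distribution\<close>

text \<open>The levels are only kept away from one, so \<open>x\<close> has no upper bound and both
  error probabilities may tend to zero at any speed. Additive estimates are therefore of no use:
  every comparison is relative to the tail it concerns and uniform in \<open>x\<close>. The growth
  of the logarithmic derivative of \<Phi> dictates the two scales of the proof: two separations may
  be exchanged when their difference times \<rho> vanishes, and a strip has small relative mass when
  its half-width is a small multiple of \<open>1 / r\<close>.

  The two closeness claims are not symmetric. The regret is small relative to
  \<open>\<Phi> (x - r)\<close>, and under the null law it has to be converted to the scale of the
  type I error. The conversion factor is a quotient of two Mills ratios, kept bounded by a gap
  between \<open>x\<close> and \<open>r\<close> that is proportional to \<open>r\<close>; this is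
  the purpose of \<open>level_not_too_small\<close>.

  Stochastic integrals are realised as pointwise limits of step integrals along one fast
  approximating sequence, so that the same functional of the path serves under every parameter
  value.\<close>

interpretation std_normal: real_distribution std_normal_distribution
  by (rule real_dist_normal_dist)

lemma std_normal_density_continuous: "continuous_on A std_normal_density"
  by (auto simp: std_normal_density_def intro!: continuous_intros)

lemma std_normal_density_DERIV:
  "(std_normal_density has_real_derivative - z * std_normal_density z) (at z)"
  unfolding std_normal_density_def[abs_def]
  by (auto intro!: derivative_eq_intros simp: field_simps)

lemma std_normal_cdf_diff:
  assumes "a \<le> b" shows "\<Phi> b - \<Phi> a = (LBINT t=a..b. std_normal_density t)"
proof (cases "a = b")
  case False
  then have ab: "a < b" using assms by simp
  have "\<Phi> b - \<Phi> a = measure std_normal_distribution {a<..b}"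
    using std_normal.cdf_diff_eq[OF ab] .
  also have "\<dots> = (LBINT t:{a<..b}. std_normal_density t)"
  proof -
    have "measure std_normal_distribution {a<..b} = (LINT t|std_normal_distribution. indicator {a<..b} t)"
      by simp
    also have "\<dots> = (LBINT t. std_normal_density t *\<^sub>R indicator {a<..b} t)"
      by (rule integral_density) auto
    finally show ?thesis
      by (simp add: set_lebesgue_integral_def mult.commute)
  qed
  also have "\<dots> = (LBINT t=a..b. std_normal_density t)"
    using ab by (simp add: interval_integral_Ioc)
  finally show ?thesis .
qed simp

lemma std_normal_cdf_DERIV: "(\<Phi> has_real_derivative std_normal_density z) (at z)"
proof -
  \<comment> \<open>The fundamental theorem is applied on a bounded window around \<open>z\<close>;
    the mass to the left of the window is the constant \<open>\<Phi> (z - 1)\<close>.\<close>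
  let ?G = "\<lambda>u. LBINT t=(z-1)..u. std_normal_density t"
  have "(?G has_vector_derivative std_normal_density z) (at z within {z-1..z+1})"
    by (rule interval_integral_FTC2[where a="z-1" and b="z+1" and c="z-1"])
       (auto simp: std_normal_density_continuous)
  then have "(?G has_real_derivative std_normal_density z) (at z within {z-1..z+1})"
    by (simp add: has_real_derivative_iff_has_vector_derivative)
  then have "((\<lambda>u. \<Phi> (z - 1) + ?G u) has_real_derivative std_normal_density z) (at z within {z-1..z+1})"
    by (auto intro!: derivative_eq_intros)
  then have "(\<Phi> has_real_derivative std_normal_density z) (at z within {z-1..z+1})"
    by (rule has_field_derivative_transform_within[where d=1])
       (auto simp: std_normal_cdf_diff[symmetric])
  moreover have "at z within {z-1..z+1} = at z"
    by (rule at_within_interior) auto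
  ultimately show ?thesis by simp
qed

lemma std_normal_density_pos: "0 < std_normal_density z"
  by (rule normal_density_pos) simp

lemma std_normal_cdf_strict_mono: "strict_mono \<Phi>"
  by (rule strict_monoI, rule DERIV_pos_imp_increasing)
     (use std_normal_cdf_DERIV std_normal_density_pos in blast)+

lemmas std_normal_cdf_less_iff = strict_mono_less[OF std_normal_cdf_strict_mono]
lemmas std_normal_cdf_le_iff = strict_mono_less_eq[OF std_normal_cdf_strict_mono]
lemmas std_normal_cdf_eq_iff = strict_mono_eq[OF std_normal_cdf_strict_mono]

lemma std_normal_cdf_pos: "0 < \<Phi> z"
  using std_normal_cdf_less_iff[of "z - 1" z] std_normal.cdf_nonneg[of "z - 1"] by simp

lemma std_normal_cdf_less_1: "\<Phi> z < 1"
  using std_normal_cdf_less_iff[of z "z + 1"] std_normal.cdf_bounded_prob[of "z + 1"] by simp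

lemma std_normal_density_minus: "std_normal_density (- z) = std_normal_density z"
  by (simp add: std_normal_density_def)

text \<open>The density is even, so \<open>\<Phi> (- z) + \<Phi> z\<close> has derivative zero; the
  limit at infinity fixes the constant.\<close>

lemma std_normal_cdf_minus: "\<Phi> (- z) = 1 - \<Phi> z"
proof -
  have "((\<lambda>z. \<Phi> (- z) + \<Phi> z) has_real_derivative 0) (at z)" for z
    by (auto intro!: derivative_eq_intros DERIV_chain2[OF std_normal_cdf_DERIV] std_normal_cdf_DERIV
          simp: std_normal_density_minus)
  then have const: "\<Phi> (- z) + \<Phi> z = \<Phi> (- y) + \<Phi> y" for z y
    using DERIV_isconst_all[of "\<lambda>z. \<Phi> (- z) + \<Phi> z" z y] by auto
  have "((\<lambda>z. \<Phi> (- z) + \<Phi> z) \<longlongrightarrow> 0 + 1) at_top"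
    by (intro tendsto_add std_normal.cdf_lim_at_top_prob
          filterlim_compose[OF std_normal.cdf_lim_at_bot] filterlim_uminus_at_bot_at_top)
  moreover have "(\<lambda>y. \<Phi> (- y) + \<Phi> y) = (\<lambda>_. \<Phi> (- z) + \<Phi> z)"
    by (rule ext) (rule const)
  ultimately have "((\<lambda>_. \<Phi> (- z) + \<Phi> z) \<longlongrightarrow> 1) (at_top :: real filter)"
    by simp
  then show ?thesis by (simp add: tendsto_const_iff)
qed

text \<open>Within a distance \<open>1 / (1 + y)\<close> to the left of \<open>- y\<close> the
  density loses at most the factor \<open>exp 2\<close>, because the exponent changes there by at
  most 3/2. The mean value theorem turns this into a lower bound for the tail, a crude converse of
  \<open>std_normal_cdf_minus_le\<close>.\<close>

lemma std_normal_density_le_cdf_minus: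
  assumes "0 \<le> y"
  shows "std_normal_density y \<le> exp 2 * (1 + y) * \<Phi> (- y)"
proof -
  let ?s = "1 / (1 + y)"
  have s: "0 < ?s" "?s \<le> 1" "y * ?s \<le> 1" using assms by (auto simp: field_simps)
  obtain t where t: "- y - ?s < t" "t < - y"
     "\<Phi> (- y) - \<Phi> (- y - ?s) = (- y - (- y - ?s)) * std_normal_density t"
    using MVT2[of "- y - ?s" "- y" \<Phi> std_normal_density] s std_normal_cdf_DERIV by auto
  have "t\<^sup>2 \<le> (y + ?s)\<^sup>2" using t assms s by (intro power2_le_iff_abs_le[THEN iffD2]) auto
  also have "\<dots> = y\<^sup>2 + 2 * (y * ?s) + ?s * ?s" by (simp add: power2_eq_square algebra_simps)
  also have "\<dots> \<le> y\<^sup>2 + 2 * 1 + 1 * 1" using s by (intro add_mono mult_mono order.refl) auto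
  finally have "- y\<^sup>2 / 2 - 2 \<le> - t\<^sup>2 / 2" by simp
  then have "std_normal_density y * exp (- 2) \<le> std_normal_density t"
    unfolding std_normal_density_def by (simp add: exp_add[symmetric] divide_right_mono)
  then have "?s * (std_normal_density y * exp (- 2)) \<le> ?s * std_normal_density t"
    using s by (intro mult_left_mono) auto
  also have "\<dots> \<le> \<Phi> (- y)" using t(3) std_normal_cdf_pos[of "- y - ?s"] by simp
  finally have "exp 2 * (1 + y) * (?s * (std_normal_density y * exp (- 2))) \<le> exp 2 * (1 + y) * \<Phi> (- y)"
    using assms by (intro mult_left_mono) auto
  moreover have "exp 2 * (1 + y) * (?s * (std_normal_density y * exp (- 2))) = std_normal_density y"
    using assms by (simp add: exp_minus)
  ultimately show ?thesis by simp
qed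

text \<open>The form with \<open>max\<close> covers the whole line with one constant, since the
  argument \<open>x - r\<close> of later uses can have either sign. For positive \<open>z\<close>
  both sides are compared with their values at zero.\<close>

lemma std_normal_density_le_cdf:
  "std_normal_density z \<le> exp 2 * (1 + max 0 (- z)) * \<Phi> z"
proof (cases "z \<le> 0")
  case True
  then show ?thesis
    using std_normal_density_le_cdf_minus[of "- z"] by (simp add: std_normal_density_minus max_def)
next
  case False
  have "std_normal_density z \<le> std_normal_density 0"
    unfolding std_normal_density_def by (simp add: divide_right_mono)
  also have "\<dots> \<le> exp 2 * \<Phi> 0" using std_normal_density_le_cdf_minus[of 0] by simp
  also have "\<dots> \<le> exp 2 * \<Phi> z" using False by (simp add: std_normal_cdf_le_iff)
  finally show ?thesis using False by (simp add: max_def)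
qed

text \<open>The logarithmic derivative of \<open>\<Phi>\<close> grows at most linearly in the left tail.\<close>

lemma std_normal_cdf_increment:
  assumes "0 \<le> s"
  shows "\<Phi> (z + s) \<le> \<Phi> z * exp (exp 2 * (1 + max 0 (- z)) * s)"
proof -
  define k where "k = exp 2 * (1 + max 0 (- z))"
  \<comment> \<open>Gronwall's argument with an integrating factor: \<open>k\<close> dominates the
    logarithmic derivative everywhere to the right of \<open>z\<close>, because
    \<open>max 0 (- t)\<close> decreases in \<open>t\<close>.\<close>
  let ?F = "\<lambda>t. \<Phi> t * exp (- k * t)"
  have "?F (z + s) \<le> ?F z"
  proof (rule DERIV_nonpos_imp_nonincreasing[where f="?F"])
    fix t assume t: "z \<le> t"
    have "std_normal_density t \<le> exp 2 * (1 + max 0 (- t)) * \<Phi> t"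
      by (rule std_normal_density_le_cdf)
    also have "\<dots> \<le> k * \<Phi> t"
      unfolding k_def using t std_normal_cdf_pos[of t] by (intro mult_right_mono mult_left_mono) auto
    finally have "(std_normal_density t - k * \<Phi> t) * exp (- k * t) \<le> 0"
      by (simp add: mult_nonpos_nonneg)
    moreover have "(?F has_real_derivative (std_normal_density t - k * \<Phi> t) * exp (- k * t)) (at t)"
    proof (rule DERIV_cong[OF DERIV_mult[OF std_normal_cdf_DERIV]])
      show "((\<lambda>t. exp (- k * t)) has_real_derivative (- k) * exp (- k * t)) (at t)"
        by (rule DERIV_cong[OF DERIV_chain2[OF DERIV_exp DERIV_cmult_Id]]) simp
    qed (simp add: algebra_simps)
    ultimately show "\<exists>y. (?F has_real_derivative y) (at t) \<and> y \<le> 0" by blast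
  qed (use assms in simp)
  then have "?F (z + s) * exp (k * (z + s)) \<le> ?F z * exp (k * (z + s))"
    by (rule mult_right_mono) simp
  then show ?thesis
    unfolding k_def[symmetric]
    by (simp add: mult.assoc flip: exp_add) (simp add: ring_distribs)
qed

text \<open>The 2 in \<open>q\<close> is 1 + 1: the lower estimate runs the increment bound from
  \<open>z - \<bar>s\<bar>\<close>, at most one unit to the left of \<open>z\<close>, where the
  linear factor is larger by at most one.\<close>

lemma std_normal_cdf_shift:
  fixes z s :: real
  assumes "\<bar>s\<bar> \<le> 1"
  defines "q \<equiv> exp 2 * (2 + max 0 (- z)) * \<bar>s\<bar>"
  shows "\<Phi> (z + s) \<le> \<Phi> z * exp q" and "\<Phi> z * exp (- q) \<le> \<Phi> (z + s)"
proof -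
  have q0: "0 \<le> q" by (simp add: q_def)
  have a: "\<Phi> (y + \<bar>s\<bar>) \<le> \<Phi> y * exp q" if "z - 1 \<le> y" for y
  proof -
    have "\<Phi> (y + \<bar>s\<bar>) \<le> \<Phi> y * exp (exp 2 * (1 + max 0 (- y)) * \<bar>s\<bar>)"
      by (rule std_normal_cdf_increment) simp
    also have "\<dots> \<le> \<Phi> y * exp q"
      unfolding q_def using that std_normal_cdf_pos[of y]
      by (intro mult_left_mono iffD2[OF exp_le_cancel_iff] mult_right_mono) auto
    finally show ?thesis .
  qed
  have "\<Phi> (z + s) \<le> \<Phi> (z + \<bar>s\<bar>)" by (simp add: std_normal_cdf_le_iff)
  also have "\<dots> \<le> \<Phi> z * exp q" by (rule a) simp
  finally show "\<Phi> (z + s) \<le> \<Phi> z * exp q" .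
  have "\<Phi> z \<le> \<Phi> ((z - \<bar>s\<bar>) + \<bar>s\<bar>)" by simp
  also have "\<dots> \<le> \<Phi> (z - \<bar>s\<bar>) * exp q" by (rule a) (use assms in simp)
  also have "\<dots> \<le> \<Phi> (z + s) * exp q" by (simp add: std_normal_cdf_le_iff)
  finally show "\<Phi> z * exp (- q) \<le> \<Phi> (z + s)" by (simp add: exp_minus field_simps)
qed

text \<open>Upper Mills bound: the difference of \<open>std_normal_density z / (- z)\<close> and
  \<open>\<Phi> z\<close> vanishes at minus infinity and has the nonnegative derivative
  \<open>std_normal_density z / z\<^sup>2\<close> on the negative half-line.\<close>

lemma std_normal_cdf_minus_le:
  assumes "0 < y" shows "\<Phi> (- y) \<le> std_normal_density y / y"
proof -
  let ?F = "\<lambda>z. std_normal_density z / (- z) - \<Phi> z"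
  have mono: "?F a \<le> ?F (- y)" if "a \<le> - y" for a
  proof (rule DERIV_nonneg_imp_nondecreasing[where f="?F", OF that])
    fix t assume t: "t \<le> - y"
    have "(?F has_real_derivative std_normal_density t / t\<^sup>2) (at t)"
      using t assms
      by (intro DERIV_cong[OF DERIV_diff[OF DERIV_divide[OF std_normal_density_DERIV
              DERIV_minus[OF DERIV_ident]] std_normal_cdf_DERIV]])
         (auto simp: field_simps power2_eq_square)
    then show "\<exists>y. (?F has_real_derivative y) (at t) \<and> 0 \<le> y"
      by (intro exI conjI) auto
  qed
  have "(?F \<longlongrightarrow> 0 - 0) at_bot"
  proof (intro tendsto_diff std_normal.cdf_lim_at_bot)
    have b: "0 \<le> std_normal_density a \<and> std_normal_density a \<le> 1" for a
    proof -
      have e: "exp (- a\<^sup>2 / 2) \<le> 1" by simp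
      have s: "1 \<le> sqrt (2 * pi)" using pi_ge_two by simp
      have "1 / sqrt (2 * pi) * exp (- a\<^sup>2 / 2) \<le> 1 * 1"
        by (rule mult_mono[OF _ e]) (use s in simp_all)
      then show ?thesis unfolding std_normal_density_def by simp
    qed
    have "((\<lambda>z::real. - inverse z) \<longlongrightarrow> - 0) at_bot"
      by (rule tendsto_minus[OF tendsto_mono[OF at_bot_le_at_infinity tendsto_inverse_0]])
    then have lim: "((\<lambda>z::real. - inverse z) \<longlongrightarrow> 0) at_bot" by simp
    have "norm (std_normal_density z / - z) \<le> - inverse z" if "z \<le> - 1" for z
    proof -
      have "std_normal_density z / (- z) \<le> 1 / (- z)"
        using b[of z] that by (intro divide_right_mono) auto
      then show ?thesis using b[of z] that by (simp add: inverse_eq_divide)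
    qed
    then have "\<forall>\<^sub>F z in at_bot. norm (std_normal_density z / - z) \<le> - inverse z"
      using eventually_at_bot_linorder by blast
    from this lim show "((\<lambda>z. std_normal_density z / - z) \<longlongrightarrow> 0) at_bot"
      by (rule Lim_null_comparison)
  qed
  then have "0 - 0 \<le> ?F (- y)"
    by (rule tendsto_upperbound)
       (use mono in \<open>auto simp: eventually_at_bot_linorder simp del: divide_minus_right intro!: exI[of _ "- y"]\<close>)
  then show ?thesis by (simp add: std_normal_density_minus)
qed

subsection \<open>Testing in a Gaussian shift experiment\<close>

lemma exp_shift_std_normal_density:
  "exp (r * z - r\<^sup>2 / 2) * std_normal_density z = std_normal_density (z - r)"
  unfolding std_normal_density_def
  by (simp add: exp_add[symmetric] power2_eq_square algebra_simps diff_divide_distrib add_divide_distrib)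

text \<open>One-dimensional Cameron-Martin formula: by completing the square, the exponential tilt
  moves the mean to \<open>r\<close> and leaves the variance at one.\<close>

lemma std_normal_shift:
  "density std_normal_distribution (\<lambda>z. ennreal (exp (r * z - r\<^sup>2 / 2))) = density lborel (normal_density r 1)"
proof -
  have "normal_density r 1 z = std_normal_density (z - r)" for z
    by (simp add: normal_density_def)
  then show ?thesis
    by (subst density_density_eq) (auto simp: exp_shift_std_normal_density[symmetric] ennreal_mult mult.commute)
qed

lemma normal_density_unit_variance_cdf: "emeasure (density lborel (normal_density r 1)) {..x} = ennreal (\<Phi> (x - r))"
proof -
  have "emeasure (density lborel (normal_density r 1)) {..x} =
      (\<integral>\<^sup>+ z. ennreal (normal_density r 1 z) * indicator {..x} z \<partial>lborel)"
    by (rule emeasure_density) auto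
  also have "\<dots> = ennreal \<bar>1\<bar> * (\<integral>\<^sup>+ z. ennreal (normal_density r 1 (r + 1 * z)) * indicator {..x} (r + 1 * z) \<partial>lborel)"
    by (rule nn_integral_real_affine) auto
  also have "\<dots> = (\<integral>\<^sup>+ z. ennreal (std_normal_density z) * indicator {..x - r} z \<partial>lborel)"
    by (simp, rule nn_integral_cong) (auto simp: normal_density_def split: split_indicator)
  also have "\<dots> = emeasure std_normal_distribution {..x - r}"
    by (simp add: emeasure_density)
  finally show ?thesis
    by (simp add: cdf_def std_normal.emeasure_eq_measure)
qed

text \<open>
  \<open>P\<close> is the null law, \<open>exp (r * Z - r\<^sup>2 / 2)\<close> the likelihood ratio of the alternative.
\<close>

locale gaussian_shift = prob_space P for P :: "'b measure" +
  fixes Z :: "'b \<Rightarrow> real" and r :: real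
  assumes Z_measurable [measurable]: "Z \<in> borel_measurable P"
    and Z_distr: "distr P borel Z = std_normal_distribution"
    and r_pos: "0 < r"
begin

definition lr :: "'b \<Rightarrow> real" where "lr y = exp (r * Z y - r\<^sup>2 / 2)"

definition P\<^sub>1 :: "'b measure" where "P\<^sub>1 = density P (\<lambda>y. ennreal (lr y))"

lemma lr_measurable [measurable]: "lr \<in> borel_measurable P"
  unfolding lr_def[abs_def] by measurable

lemma lr_pos: "0 < lr y" by (simp add: lr_def)

lemma sets_P1 [measurable_cong, simp]: "sets P\<^sub>1 = sets P"
  by (simp add: P\<^sub>1_def)

lemma distr_P1: "distr P\<^sub>1 borel Z = density lborel (normal_density r 1)"
proof -
  have "P\<^sub>1 = density P ((\<lambda>z. ennreal (exp (r * z - r\<^sup>2 / 2))) \<circ> Z)"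
    by (simp add: P\<^sub>1_def lr_def[abs_def] comp_def)
  then show ?thesis
    unfolding std_normal_shift[of r, symmetric] Z_distr[symmetric] by (simp add: density_distr comp_def)
qed

lemma emeasure_P1_le: "emeasure P\<^sub>1 {y\<in>space P. Z y \<le> x} = ennreal (\<Phi> (x - r))"
proof -
  have "emeasure P\<^sub>1 {y\<in>space P. Z y \<le> x} = emeasure (distr P\<^sub>1 borel Z) {..x}"
    by (subst emeasure_distr) (auto intro!: arg_cong2[where f=emeasure] simp: P\<^sub>1_def)
  then show ?thesis by (simp add: distr_P1 normal_density_unit_variance_cdf)
qed

lemma measure_P1_le: "measure P\<^sub>1 {y\<in>space P. Z y \<le> x} = \<Phi> (x - r)"
  using emeasure_P1_le[of x] by (simp add: measure_def std_normal.cdf_nonneg)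

lemma prob_Z_le: "prob {y\<in>space P. Z y \<le> x} = \<Phi> x"
proof -
  have "prob {y\<in>space P. Z y \<le> x} = measure (distr P borel Z) {..x}"
    by (subst measure_distr) (auto intro!: arg_cong2[where f=measure])
  then show ?thesis by (simp add: Z_distr cdf_def)
qed

text \<open>The total mass is read off the image under \<open>Z\<close>, which is a normal law; no
  integral of the likelihood ratio is computed.\<close>

lemma prob_space_P1: "prob_space P\<^sub>1"
proof (rule prob_space_distrD)
  show "Z \<in> borel_measurable P\<^sub>1" unfolding P\<^sub>1_def by measurable
  show "prob_space (distr P\<^sub>1 borel Z)"
    unfolding distr_P1 by (rule prob_space_normal_density) simp
qed

sublocale P1: prob_space P\<^sub>1 by (rule prob_space_P1)

lemma integral_P1: "f \<in> borel_measurable P \<Longrightarrow> (LINT y|P\<^sub>1. f y) = (LINT y|P. lr y * f y)"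
  unfolding P\<^sub>1_def by (subst integral_density) (auto simp: lr_pos less_imp_le)

lemma integrable_lr_mult:
  assumes [measurable]: "f \<in> borel_measurable P" and "\<And>y. y \<in> space P \<Longrightarrow> \<bar>f y\<bar> \<le> B"
  shows "integrable P (\<lambda>y. lr y * f y)"
proof -
  have "integrable P\<^sub>1 f"
    by (rule P1.integrable_const_bound[of _ B]) (use assms in \<open>auto simp: P\<^sub>1_def\<close>)
  then show ?thesis
    unfolding P\<^sub>1_def by (subst (asm) integrable_density) (auto simp: lr_pos less_imp_le)
qed

lemma prob_strip: "0 < s \<Longrightarrow> prob {y\<in>space P. \<bar>Z y - x\<bar> < s} \<le> \<Phi> (x + s) - \<Phi> (x - s)"
proof -
  assume "0 < s"
  have "prob {y\<in>space P. \<bar>Z y - x\<bar> < s} \<le> prob ({y\<in>space P. Z y \<le> x + s} - {y\<in>space P. Z y \<le> x - s})"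
    by (intro finite_measure_mono) auto
  also have "\<dots> = \<Phi> (x + s) - \<Phi> (x - s)"
    using \<open>0 < s\<close> by (subst finite_measure_Diff) (auto simp: prob_Z_le)
  finally show ?thesis .
qed

lemma P1_strip: "0 < s \<Longrightarrow> measure P\<^sub>1 {y\<in>space P. \<bar>Z y - x\<bar> < s} \<le> \<Phi> (x - r + s) - \<Phi> (x - r - s)"
proof -
  assume "0 < s"
  have "measure P\<^sub>1 {y\<in>space P. \<bar>Z y - x\<bar> < s} \<le> measure P\<^sub>1 ({y\<in>space P. Z y \<le> x + s} - {y\<in>space P. Z y \<le> x - s})"
    by (intro P1.finite_measure_mono) auto
  also have "\<dots> = \<Phi> (x + s - r) - \<Phi> (x - s - r)"
    using \<open>0 < s\<close> by (subst P1.finite_measure_Diff) (auto simp: measure_P1_le)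
  finally show ?thesis by (simp add: algebra_simps)
qed

text \<open>Regret identity of Neyman and Pearson: every summand of the difference has the same sign.\<close>

lemma neyman_pearson_identity:
  assumes K [measurable]: "K \<in> borel_measurable P" and K01: "\<And>y. y \<in> space P \<Longrightarrow> 0 \<le> K y \<and> K y \<le> 1"
    and level: "(LINT y|P. K y) = 1 - \<Phi> x"
  defines "k \<equiv> exp (r * x - r\<^sup>2 / 2)"
  defines "K\<^sub>0 \<equiv> (\<lambda>y. if x < Z y then 1 else 0 :: real)"
  shows "(LINT y|P\<^sub>1. 1 - K y) - \<Phi> (x - r) = (LINT y|P. \<bar>K y - K\<^sub>0 y\<bar> * \<bar>lr y - k\<bar>)"
    and "integrable P (\<lambda>y. \<bar>K y - K\<^sub>0 y\<bar> * \<bar>lr y - k\<bar>)"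
proof -
  have K\<^sub>0 [measurable]: "K\<^sub>0 \<in> borel_measurable P" unfolding K\<^sub>0_def by measurable
  have iK: "integrable P K" "integrable P K\<^sub>0"
    by (rule integrable_const_bound[of _ 1]; use K01 in \<open>auto simp: K\<^sub>0_def\<close>)+
  have iL: "integrable P (\<lambda>y. lr y * (1 - K y))" "integrable P (\<lambda>y. lr y * (1 - K\<^sub>0 y))"
    by (rule integrable_lr_mult[of _ 1]; use K01 in \<open>auto simp: K\<^sub>0_def\<close>)+
  have "1 - K\<^sub>0 y = indicator {y\<in>space P. Z y \<le> x} y" if "y \<in> space P" for y
    using that by (auto simp: K\<^sub>0_def)
  then have "(LINT y|P\<^sub>1. 1 - K\<^sub>0 y) = (LINT y|P\<^sub>1. indicator {y\<in>space P. Z y \<le> x} y)"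
    by (intro Bochner_Integration.integral_cong) (auto simp: P\<^sub>1_def)
  then have b0: "(LINT y|P\<^sub>1. 1 - K\<^sub>0 y) = \<Phi> (x - r)"
    by (simp add: measure_P1_le)
  have "(LINT y|P. 1 - K\<^sub>0 y) = (LINT y|P. indicator {y\<in>space P. Z y \<le> x} y)"
    by (intro Bochner_Integration.integral_cong) (auto simp: K\<^sub>0_def)
  then have a0: "(LINT y|P. K\<^sub>0 y) = 1 - \<Phi> x"
    using iK by (simp add: prob_Z_le prob_space)
  \<comment> \<open>The term with \<open>k\<close> integrates to zero because both tests have the
    same level; it is what turns the integrand into a product of absolute values.\<close>
  have eq: "\<bar>K y - K\<^sub>0 y\<bar> * \<bar>lr y - k\<bar> = (lr y * (1 - K y) - lr y * (1 - K\<^sub>0 y)) - k * (K\<^sub>0 y - K y)"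
    if "y \<in> space P" for y
  proof (cases "x < Z y")
    case True
    then have "k \<le> lr y" using r_pos by (simp add: k_def lr_def)
    then have "\<bar>lr y - k\<bar> = lr y - k" "\<bar>K y - K\<^sub>0 y\<bar> = 1 - K y" "K\<^sub>0 y = 1"
      using K01[OF that] True by (auto simp: K\<^sub>0_def)
    then show ?thesis by (simp add: algebra_simps)
  next
    case False
    then have "lr y \<le> k" using r_pos by (simp add: k_def lr_def)
    then have "\<bar>lr y - k\<bar> = k - lr y" "\<bar>K y - K\<^sub>0 y\<bar> = K y" "K\<^sub>0 y = 0"
      using K01[OF that] False by (auto simp: K\<^sub>0_def)
    then show ?thesis by (simp add: algebra_simps)
  qed
  have "integrable P (\<lambda>y. (lr y * (1 - K y) - lr y * (1 - K\<^sub>0 y)) - k * (K\<^sub>0 y - K y))"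
    using iK iL by auto
  then show "integrable P (\<lambda>y. \<bar>K y - K\<^sub>0 y\<bar> * \<bar>lr y - k\<bar>)"
    by (subst Bochner_Integration.integrable_cong[OF refl eq]) auto
  have "(LINT y|P. \<bar>K y - K\<^sub>0 y\<bar> * \<bar>lr y - k\<bar>) =
     (LINT y|P. (lr y * (1 - K y) - lr y * (1 - K\<^sub>0 y)) - k * (K\<^sub>0 y - K y))"
    by (intro Bochner_Integration.integral_cong eq refl)
  also have "\<dots> = (LINT y|P\<^sub>1. 1 - K y) - (LINT y|P\<^sub>1. 1 - K\<^sub>0 y) - k * ((LINT y|P. K\<^sub>0 y) - (LINT y|P. K y))"
    using iK iL by (simp add: integral_P1)
  finally show "(LINT y|P\<^sub>1. 1 - K y) - \<Phi> (x - r) = (LINT y|P. \<bar>K y - K\<^sub>0 y\<bar> * \<bar>lr y - k\<bar>)"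
    by (simp add: a0 b0 level)
qed

lemma neyman_pearson:
  assumes "K \<in> borel_measurable P" "\<And>y. y \<in> space P \<Longrightarrow> 0 \<le> K y \<and> K y \<le> 1" "(LINT y|P. K y) = 1 - \<Phi> x"
  shows "\<Phi> (x - r) \<le> (LINT y|P\<^sub>1. 1 - K y)"
proof -
  have "0 \<le> (LINT y|P. \<bar>K y - (if x < Z y then 1 else 0)\<bar> * \<bar>lr y - exp (r * x - r\<^sup>2 / 2)\<bar>)"
    by (rule integral_nonneg_AE) auto
  then show ?thesis using neyman_pearson_identity(1)[OF assms] by linarith
qed

text \<open>
  Outside the strip \<open>\<bar>Z - x\<bar> < \<eta> / r\<close> the likelihood ratio differs from its critical value by a
  fixed proportion, so the regret controls the distance to the optimal test there.
\<close>

lemma lr_separation: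
  assumes "0 < \<eta>" "\<eta> / r \<le> \<bar>Z y - x\<bar>"
  defines "k \<equiv> exp (r * x - r\<^sup>2 / 2)"
  shows "(1 - exp (- \<eta>)) * k \<le> \<bar>lr y - k\<bar>" and "(1 - exp (- \<eta>)) * lr y \<le> \<bar>lr y - k\<bar>"
proof -
  have rz: "\<eta> \<le> \<bar>r * Z y - r * x\<bar>"
  proof -
    have "\<eta> \<le> r * \<bar>Z y - x\<bar>" using assms r_pos by (simp add: pos_divide_le_eq mult.commute)
    also have "\<dots> = \<bar>r * (Z y - x)\<bar>" using r_pos by (simp add: abs_mult)
    finally show ?thesis by (simp add: right_diff_distrib)
  qed
  have k0: "0 < k" by (simp add: k_def)
  have "(1 - exp (- \<eta>)) * k \<le> \<bar>lr y - k\<bar> \<and> (1 - exp (- \<eta>)) * lr y \<le> \<bar>lr y - k\<bar>"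
  proof (cases "x \<le> Z y")
    case True
    then have "\<eta> + (r * x - r\<^sup>2 / 2) \<le> r * Z y - r\<^sup>2 / 2"
      using rz mult_left_mono[OF True less_imp_le[OF r_pos]] by linarith
    then have *: "exp \<eta> * k \<le> lr y" unfolding k_def lr_def by (simp flip: exp_add)
    have "1 * k \<le> exp \<eta> * k" using assms k0 by (intro mult_right_mono) auto
    then have kl: "k \<le> lr y" using * by simp
    have "k \<le> exp (- \<eta>) * lr y" using * by (simp add: exp_minus field_simps)
    moreover have "exp (- \<eta>) * k \<le> exp (- \<eta>) * lr y" using kl by simp
    moreover have "exp (- \<eta>) * (lr y - k) \<le> 1 * (lr y - k)" using kl assms by (intro mult_right_mono) auto
    ultimately show ?thesis using kl by (auto simp: algebra_simps)
  next
    case False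
    then have "r * Z y \<le> r * x" using r_pos by simp
    then have "\<eta> + (r * Z y - r\<^sup>2 / 2) \<le> r * x - r\<^sup>2 / 2"
      using rz by linarith
    then have *: "exp \<eta> * lr y \<le> k" unfolding k_def lr_def by (simp flip: exp_add)
    have "1 * lr y \<le> exp \<eta> * lr y" using assms lr_pos[of y] by (intro mult_right_mono) auto
    then have kl: "lr y \<le> k" using * by simp
    have "lr y \<le> exp (- \<eta>) * k" using * by (simp add: exp_minus field_simps)
    moreover have "exp (- \<eta>) * (k - lr y) \<le> 1 * (k - lr y)" using kl assms by (intro mult_right_mono) auto
    ultimately show ?thesis using kl by (auto simp: algebra_simps)
  qed
  then show "(1 - exp (- \<eta>)) * k \<le> \<bar>lr y - k\<bar>" "(1 - exp (- \<eta>)) * lr y \<le> \<bar>lr y - k\<bar>" by auto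
qed

text \<open>On the strip the tests differ by at most one, so the strip contributes its own
  probability. Off the strip the regret integrand is bounded below by a multiple of \<open>k\<close>
  or of \<open>lr\<close>: the constant serves under the null law, and \<open>lr\<close> under the
  alternative, where it is the density of integration.\<close>

lemma
  assumes K [measurable]: "K \<in> borel_measurable P" and K01: "\<And>y. y \<in> space P \<Longrightarrow> 0 \<le> K y \<and> K y \<le> 1"
    and level: "(LINT y|P. K y) = 1 - \<Phi> x" and \<eta>: "0 < \<eta>"
  defines "k \<equiv> exp (r * x - r\<^sup>2 / 2)"
  defines "K\<^sub>0 \<equiv> (\<lambda>y. if x < Z y then 1 else 0 :: real)"
  defines "R \<equiv> (LINT y|P\<^sub>1. 1 - K y) - \<Phi> (x - r)"
  shows dist_optimal_test_null:
      "(LINT y|P. \<bar>K y - K\<^sub>0 y\<bar>) \<le> R / ((1 - exp (- \<eta>)) * k) + (\<Phi> (x + \<eta> / r) - \<Phi> (x - \<eta> / r))"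
    and dist_optimal_test_alt:
      "(LINT y|P\<^sub>1. \<bar>K y - K\<^sub>0 y\<bar>) \<le> R / (1 - exp (- \<eta>)) + (\<Phi> (x - r + \<eta> / r) - \<Phi> (x - r - \<eta> / r))"
proof -
  let ?A = "{y\<in>space P. \<bar>Z y - x\<bar> < \<eta> / r}"
  let ?D = "\<lambda>y. \<bar>K y - K\<^sub>0 y\<bar> * \<bar>lr y - k\<bar>"
  have K\<^sub>0 [measurable]: "K\<^sub>0 \<in> borel_measurable P" unfolding K\<^sub>0_def by measurable
  have D: "integrable P ?D" and R: "R = (LINT y|P. ?D y)"
    using neyman_pearson_identity[OF K K01 level] by (simp_all add: K\<^sub>0_def k_def R_def)
  have e: "0 < 1 - exp (- \<eta>)" and k: "0 < k" and s: "0 < \<eta> / r"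
    using \<eta> r_pos by (auto simp: k_def)
  have KK: "\<bar>K y - K\<^sub>0 y\<bar> \<le> 1" if "y \<in> space P" for y
    using K01[OF that] by (auto simp: K\<^sub>0_def)
  have off: "\<bar>K y - K\<^sub>0 y\<bar> * ((1 - exp (- \<eta>)) * k) \<le> ?D y"
       "\<bar>K y - K\<^sub>0 y\<bar> * ((1 - exp (- \<eta>)) * lr y) \<le> ?D y" if "y \<in> space P" "y \<notin> ?A" for y
    using that lr_separation[of \<eta> y x] \<eta> by (auto simp: k_def not_less intro!: mult_left_mono)
  have "(LINT y|P. \<bar>K y - K\<^sub>0 y\<bar>) \<le> (LINT y|P. ?D y / ((1 - exp (- \<eta>)) * k) + indicator ?A y)"
  proof (rule integral_mono)
    show "integrable P (\<lambda>y. \<bar>K y - K\<^sub>0 y\<bar>)"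
      by (rule integrable_const_bound[of _ 1]) (use KK in auto)
    show "integrable P (\<lambda>y. ?D y / ((1 - exp (- \<eta>)) * k) + indicator ?A y)"
      using D by (auto simp: fmeasurable_def less_top[symmetric])
    fix y assume y: "y \<in> space P"
    show "\<bar>K y - K\<^sub>0 y\<bar> \<le> ?D y / ((1 - exp (- \<eta>)) * k) + indicator ?A y"
    proof (cases "y \<in> ?A")
      case True
      have "0 \<le> ?D y / ((1 - exp (- \<eta>)) * k)" using e k by simp
      then show ?thesis using KK[OF y] True by simp
    next
      case False
      then show ?thesis using off(1)[OF y False] e k by (simp add: pos_le_divide_eq)
    qed
  qed
  also have "\<dots> = R / ((1 - exp (- \<eta>)) * k) + prob ?A"
    using D by (subst Bochner_Integration.integral_add) (auto simp: R less_top[symmetric])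
  also have "\<dots> \<le> R / ((1 - exp (- \<eta>)) * k) + (\<Phi> (x + \<eta> / r) - \<Phi> (x - \<eta> / r))"
    using prob_strip[OF s, of x] by simp
  finally show "(LINT y|P. \<bar>K y - K\<^sub>0 y\<bar>) \<le> R / ((1 - exp (- \<eta>)) * k) + (\<Phi> (x + \<eta> / r) - \<Phi> (x - \<eta> / r))" .
  have "(LINT y|P\<^sub>1. \<bar>K y - K\<^sub>0 y\<bar>) = (LINT y|P. lr y * \<bar>K y - K\<^sub>0 y\<bar>)"
    by (rule integral_P1) measurable
  also have "\<dots> \<le> (LINT y|P. ?D y / (1 - exp (- \<eta>)) + lr y * indicator ?A y)"
  proof (rule integral_mono)
    show "integrable P (\<lambda>y. lr y * \<bar>K y - K\<^sub>0 y\<bar>)"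
      by (rule integrable_lr_mult[of _ 1]) (use KK in auto)
    show "integrable P (\<lambda>y. ?D y / (1 - exp (- \<eta>)) + lr y * indicator ?A y)"
      using D by (auto intro!: integrable_lr_mult[of _ 1] simp: indicator_def)
    fix y assume y: "y \<in> space P"
    show "lr y * \<bar>K y - K\<^sub>0 y\<bar> \<le> ?D y / (1 - exp (- \<eta>)) + lr y * indicator ?A y"
    proof (cases "y \<in> ?A")
      case True
      have "0 \<le> ?D y / (1 - exp (- \<eta>))" using e by simp
      moreover have "lr y * \<bar>K y - K\<^sub>0 y\<bar> \<le> lr y * 1"
        using KK[OF y] lr_pos[of y] by (intro mult_left_mono) auto
      ultimately show ?thesis using True by simp
    next
      case False
      then show ?thesis using off(2)[OF y False] e by (simp add: pos_le_divide_eq mult_ac)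
    qed
  qed
  also have "\<dots> = R / (1 - exp (- \<eta>)) + measure P\<^sub>1 ?A"
  proof -
    have "(LINT y|P. lr y * indicator ?A y) = (LINT y|P\<^sub>1. indicator ?A y)"
      by (subst integral_P1) auto
    also have "\<dots> = measure P\<^sub>1 ?A" by (simp add: P\<^sub>1_def)
    moreover have "integrable P (\<lambda>y. lr y * indicator ?A y)"
      by (rule integrable_lr_mult[of _ 1]) (auto simp: indicator_def)
    ultimately show ?thesis
      using D by (subst Bochner_Integration.integral_add) (auto simp: R)
  qed
  also have "\<dots> \<le> R / (1 - exp (- \<eta>)) + (\<Phi> (x - r + \<eta> / r) - \<Phi> (x - r - \<eta> / r))"
    using P1_strip[OF s, of x] by simp
  finally show "(LINT y|P\<^sub>1. \<bar>K y - K\<^sub>0 y\<bar>) \<le> R / (1 - exp (- \<eta>)) + (\<Phi> (x - r + \<eta> / r) - \<Phi> (x - r - \<eta> / r))" .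
qed

end

text \<open>Once \<open>\<rho> e\<close> is at least 1, the logarithmic derivative of \<Phi> near
  \<open>x e - \<rho> e\<close> is at most a constant times \<open>\<rho> e\<close>, uniformly over
  all \<open>x e\<close> above \<open>- C\<close>. This is why the hypothesis concerns the product
  with \<open>\<rho> e\<close> and not the bare difference. The lemma serves both for the exact
  separation and for the mean shift of the efficient statistic.\<close>

lemma std_normal_cdf_ratio_tendsto:
  fixes x \<rho> d :: "'e \<Rightarrow> real"
  assumes \<rho>: "filterlim \<rho> at_top F" and x: "\<forall>\<^sub>F e in F. - C \<le> x e"
    and d: "((\<lambda>e. (d e - \<rho> e) * \<rho> e) \<longlongrightarrow> 0) F"
  shows "((\<lambda>e. \<Phi> (x e - d e) / \<Phi> (x e - \<rho> e)) \<longlongrightarrow> 1) F"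
proof -
  define q where "q = (\<lambda>e. exp 2 * (3 + \<bar>C\<bar>) * \<bar>(d e - \<rho> e) * \<rho> e\<bar>)"
  have q: "(q \<longlongrightarrow> 0) F"
    unfolding q_def by (rule tendsto_mult_right_zero[OF tendsto_rabs_zero[OF d]])
  have small: "\<forall>\<^sub>F e in F. \<bar>(d e - \<rho> e) * \<rho> e\<bar> < 1"
    using order_tendstoD(2)[OF tendsto_rabs_zero[OF d], of 1] by simp
  have "\<forall>\<^sub>F e in F. 1 \<le> \<rho> e" using \<rho> by (simp add: filterlim_at_top)
  with small x have bounds: "\<forall>\<^sub>F e in F. exp (- q e) \<le> \<Phi> (x e - d e) / \<Phi> (x e - \<rho> e) \<and>
      \<Phi> (x e - d e) / \<Phi> (x e - \<rho> e) \<le> exp (q e)"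
  proof eventually_elim
    case (elim e)
    let ?s = "\<rho> e - d e" and ?z = "x e - \<rho> e"
    let ?q = "exp 2 * (2 + max 0 (- ?z)) * \<bar>?s\<bar>"
    have s\<rho>: "\<bar>?s\<bar> * \<rho> e = \<bar>(d e - \<rho> e) * \<rho> e\<bar>" using elim by (simp add: abs_mult abs_minus_commute)
    have "\<bar>?s\<bar> * 1 \<le> \<bar>?s\<bar> * \<rho> e" using elim by (intro mult_left_mono) auto
    also note s\<rho>
    also note elim(1)
    finally have s: "\<bar>?s\<bar> \<le> 1" by simp
    have "2 + max 0 (- ?z) \<le> (3 + \<bar>C\<bar>) * \<rho> e"
    proof -
      have "2 + max 0 (- ?z) \<le> 2 + \<rho> e + \<bar>C\<bar>" using elim by auto
      also have "\<dots> \<le> 2 * \<rho> e + \<rho> e + \<bar>C\<bar> * \<rho> e"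
        using elim mult_left_mono[of 1 "\<rho> e" "\<bar>C\<bar>"] by auto
      finally show ?thesis by (simp add: algebra_simps)
    qed
    then have "?q \<le> exp 2 * ((3 + \<bar>C\<bar>) * \<rho> e) * \<bar>?s\<bar>"
      by (intro mult_right_mono mult_left_mono) auto
    also have "\<dots> = q e" unfolding q_def s\<rho>[symmetric] by (simp add: mult_ac)
    finally have q: "?q \<le> q e" .
    have "\<Phi> (?z + ?s) \<le> \<Phi> ?z * exp ?q" "\<Phi> ?z * exp (- ?q) \<le> \<Phi> (?z + ?s)"
      using std_normal_cdf_shift[OF s, of ?z] by auto
    moreover have "\<Phi> ?z * exp ?q \<le> \<Phi> ?z * exp (q e)" "\<Phi> ?z * exp (- q e) \<le> \<Phi> ?z * exp (- ?q)"
      using q std_normal_cdf_pos[of ?z] by auto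
    ultimately have "\<Phi> ?z * exp (- q e) \<le> \<Phi> (x e - d e)" "\<Phi> (x e - d e) \<le> \<Phi> ?z * exp (q e)"
      by (auto simp: algebra_simps)
    then show ?case using std_normal_cdf_pos[of ?z]
      by (simp add: pos_le_divide_eq pos_divide_le_eq mult.commute)
  qed
  have "((\<lambda>e. exp (- q e)) \<longlongrightarrow> exp (- 0)) F" "((\<lambda>e. exp (q e)) \<longlongrightarrow> exp 0) F"
    using tendsto_exp[OF tendsto_minus[OF q]] tendsto_exp[OF q] by simp_all
  then have lims: "((\<lambda>e. exp (- q e)) \<longlongrightarrow> 1) F" "((\<lambda>e. exp (q e)) \<longlongrightarrow> 1) F" by simp_all
  show ?thesis
    by (rule tendsto_sandwich[OF _ _ lims]) (use bounds in \<open>auto elim: eventually_mono\<close>)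
qed

text \<open>Bound for the relative mass of a strip whose ends change \<Phi> by factors between
  \<open>exp (- q)\<close> and \<open>exp q\<close>; it vanishes with \<open>q\<close>.\<close>

abbreviation exp_gap :: "real \<Rightarrow> real" where
  "exp_gap q \<equiv> exp q - exp (- q)"

lemma std_normal_cdf_strip:
  assumes s: "0 \<le> s" "s \<le> 1" and q: "exp 2 * (2 + max 0 (- z)) * s \<le> q"
  shows "\<Phi> (z + s) - \<Phi> (z - s) \<le> \<Phi> z * exp_gap q"
proof -
  let ?q = "exp 2 * (2 + max 0 (- z)) * s"
  have "\<bar>s\<bar> = s" "\<bar>- s\<bar> = s" using s by auto
  then have "\<Phi> (z + s) \<le> \<Phi> z * exp ?q" "\<Phi> z * exp (- ?q) \<le> \<Phi> (z + - s)"
    using std_normal_cdf_shift(1)[of s z] std_normal_cdf_shift(2)[of "- s" z] s(2) by metis+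
  moreover have "\<Phi> z * exp ?q \<le> \<Phi> z * exp q" "\<Phi> z * exp (- q) \<le> \<Phi> z * exp (- ?q)"
    using q std_normal_cdf_pos[of z] by auto
  ultimately show ?thesis by (simp add: right_diff_distrib)
qed

context gaussian_shift
begin

text \<open>\<open>A\<close> is the regret relative to the optimum. The half-width
  \<open>\<eta> / r\<close> of the strip cancels the linear growth in \<open>r\<close> of the
  logarithmic derivative at \<open>x - r\<close>, so the relative mass of the strip is bounded in
  terms of \<eta> and \<open>C\<close> alone.\<close>

lemma relative_dist_optimal_test_alt:
  assumes K: "K \<in> borel_measurable P" and K01: "\<And>y. y \<in> space P \<Longrightarrow> 0 \<le> K y \<and> K y \<le> 1"
    and level: "(LINT y|P. K y) = 1 - \<Phi> x" and \<eta>: "0 < \<eta>" "\<eta> \<le> 1"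
    and r: "1 \<le> r" and x: "- C \<le> x"
  defines "A \<equiv> (LINT y|P\<^sub>1. 1 - K y) / \<Phi> (x - r) - 1" and "Q \<equiv> exp 2 * (3 + \<bar>C\<bar>)"
  shows "(LINT y|P\<^sub>1. \<bar>K y - (if x < Z y then 1 else 0)\<bar>) / \<Phi> (x - r) \<le>
     A / (1 - exp (- \<eta>)) + exp_gap (Q * \<eta>)"
proof -
  let ?b = "\<Phi> (x - r)" and ?s = "\<eta> / r"
  let ?q = "exp 2 * (2 + max 0 (- (x - r))) * ?s"
  have b: "0 < ?b" by (rule std_normal_cdf_pos)
  have s: "0 \<le> ?s" "?s \<le> 1" using \<eta> r by auto
  have "2 + max 0 (- (x - r)) \<le> 2 * r + r + \<bar>C\<bar> * r"
    using r x mult_left_mono[of 1 r "\<bar>C\<bar>"] by auto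
  then have "?q \<le> exp 2 * (2 * r + r + \<bar>C\<bar> * r) * ?s"
    using s by (intro mult_right_mono mult_left_mono) auto
  also have "\<dots> = Q * \<eta>" unfolding Q_def using r by (simp add: field_simps)
  finally have q: "?q \<le> Q * \<eta>" .
  note strip = std_normal_cdf_strip[OF s q]
  have A: "(LINT y|P\<^sub>1. 1 - K y) - ?b = ?b * A" using b by (simp add: A_def field_simps)
  have "(LINT y|P\<^sub>1. \<bar>K y - (if x < Z y then 1 else 0)\<bar>) \<le>
     ?b * A / (1 - exp (- \<eta>)) + ?b * exp_gap (Q * \<eta>)"
    using dist_optimal_test_alt[OF K K01 level \<eta>(1)] strip A by simp
  also have "\<dots> = (A / (1 - exp (- \<eta>)) + exp_gap (Q * \<eta>)) * ?b"
    by (simp add: algebra_simps)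
  finally show ?thesis using b by (simp add: pos_divide_le_eq)
qed

text \<open>The regret is relative to \<open>\<Phi> (x - r)\<close>, whereas the distance is
  measured relative to \<open>\<Phi> (- x)\<close>. After division by the critical value of the
  likelihood ratio, the gap of size \<open>\<delta> * r\<close> between \<open>x\<close> and
  \<open>r\<close> makes the conversion factor at most \<open>2 * exp 2 / \<delta>\<close>.\<close>

lemma relative_dist_optimal_test_null:
  assumes K: "K \<in> borel_measurable P" and K01: "\<And>y. y \<in> space P \<Longrightarrow> 0 \<le> K y \<and> K y \<le> 1"
    and level: "(LINT y|P. K y) = 1 - \<Phi> x" and \<eta>: "0 < \<eta>" "\<eta> \<le> 1"
    and r: "1 \<le> r" and x: "x \<le> (1 - \<delta>) * r" and \<delta>: "0 < \<delta>"
  defines "A \<equiv> (LINT y|P\<^sub>1. 1 - K y) / \<Phi> (x - r) - 1" and "Q \<equiv> exp 2 * 3"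
  shows "(LINT y|P. \<bar>K y - (if x < Z y then 1 else 0)\<bar>) / (1 - \<Phi> x) \<le>
     2 * exp 2 / \<delta> * A / (1 - exp (- \<eta>)) + exp_gap (Q * \<eta>)"
proof -
  let ?b = "\<Phi> (x - r)" and ?s = "\<eta> / r" and ?a = "\<Phi> (- x)" and ?k = "exp (r * x - r\<^sup>2 / 2)"
  let ?q = "exp 2 * (2 + max 0 x) * ?s"
  have b: "0 < ?b" and a: "0 < ?a" by (rule std_normal_cdf_pos)+
  have s: "0 \<le> ?s" "?s \<le> 1" using \<eta> r by auto
  have rx: "\<delta> * r \<le> r - x" "0 < \<delta> * r" using x r \<delta> by (auto simp: algebra_simps)
  have max: "max 0 x \<le> r" using rx r by auto
  have "?q \<le> exp 2 * (2 * r + r) * ?s"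
    using s r max by (intro mult_right_mono mult_left_mono) auto
  also have "\<dots> = Q * \<eta>" unfolding Q_def using r by (simp add: field_simps)
  finally have q: "?q \<le> Q * \<eta>" .
  moreover have "\<Phi> (- x + ?s) = 1 - \<Phi> (x - ?s)" "\<Phi> (- x - ?s) = 1 - \<Phi> (x + ?s)"
    using std_normal_cdf_minus[of "x - ?s"] std_normal_cdf_minus[of "x + ?s"] by simp_all
  ultimately have strip: "\<Phi> (x + ?s) - \<Phi> (x - ?s) \<le> ?a * exp_gap (Q * \<eta>)"
    using std_normal_cdf_strip[OF s, of "- x" "Q * \<eta>"] by simp
  have A: "(LINT y|P\<^sub>1. 1 - K y) - ?b = ?b * A" using b by (simp add: A_def field_simps)
  have A0: "0 \<le> A" unfolding A_def using neyman_pearson[OF K K01 level] b by (simp add: field_simps)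
  \<comment> \<open>Since \<open>std_normal_density (r - x)\<close> equals
    \<open>?k * std_normal_density (- x)\<close>, an upper Mills bound at \<open>r - x\<close> and a
    lower one at \<open>x\<close> compare the two tails.\<close>
  have "?b \<le> ?k * (2 * exp 2 / \<delta> * ?a)"
  proof -
    have "?b \<le> std_normal_density (r - x) / (r - x)"
      using std_normal_cdf_minus_le[of "r - x"] rx by simp
    also have "std_normal_density (r - x) = ?k * std_normal_density (- x)"
      using std_normal_density_minus[of "x - r"]
      by (simp add: exp_shift_std_normal_density std_normal_density_minus)
    also have "?k * std_normal_density (- x) / (r - x) \<le> ?k * (exp 2 * (1 + max 0 x) * ?a) / (r - x)"
      using std_normal_density_le_cdf[of "- x"] rx by (intro divide_right_mono mult_left_mono) auto
    also have "\<dots> \<le> ?k * (exp 2 * (2 * r) * ?a) / (\<delta> * r)"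
      using rx max r a by (intro frac_le mult_left_mono mult_right_mono) auto
    also have "\<dots> = ?k * (2 * exp 2 / \<delta> * ?a)" using r \<delta> by (simp add: field_simps)
    finally show ?thesis .
  qed
  then have "?b * A / ((1 - exp (- \<eta>)) * ?k) \<le> ?k * (2 * exp 2 / \<delta> * ?a) * A / ((1 - exp (- \<eta>)) * ?k)"
    using A0 \<eta> by (intro divide_right_mono mult_right_mono) auto
  also have "\<dots> = ?a * (2 * exp 2 / \<delta> * A / (1 - exp (- \<eta>)))"
    by (simp add: mult_ac)
  finally have "(LINT y|P. \<bar>K y - (if x < Z y then 1 else 0)\<bar>) \<le>
     ?a * (2 * exp 2 / \<delta> * A / (1 - exp (- \<eta>))) + ?a * exp_gap (Q * \<eta>)"
    using dist_optimal_test_null[OF K K01 level \<eta>(1)] strip A by simp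
  also have "\<dots> = (2 * exp 2 / \<delta> * A / (1 - exp (- \<eta>)) + exp_gap (Q * \<eta>)) * ?a"
    by (simp add: algebra_simps)
  finally show ?thesis
    using a unfolding std_normal_cdf_minus[symmetric] by (simp add: pos_divide_le_eq)
qed

end

text \<open>Two limits in succession: the second term is made small by the choice of \<eta>, and for
  this fixed \<eta> the first term vanishes along \<open>F\<close>. No rate for \<open>A\<close> has
  to be known.\<close>

lemma tendsto_0_of_slack_bound:
  fixes f A :: "'e \<Rightarrow> real"
  assumes A: "(A \<longlongrightarrow> 0) F" and f: "\<forall>\<^sub>F e in F. 0 \<le> f e"
    and bound: "\<And>\<eta>. 0 < \<eta> \<Longrightarrow> \<eta> \<le> 1 \<Longrightarrow>
      \<forall>\<^sub>F e in F. f e \<le> B * A e / (1 - exp (- \<eta>)) + exp_gap (Q * \<eta>)"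
  shows "(f \<longlongrightarrow> 0) F"
proof (rule tendstoI)
  fix \<kappa> :: real assume \<kappa>: "0 < \<kappa>"
  have "((\<lambda>\<eta>. exp_gap (Q * \<eta>)) \<longlongrightarrow> exp (Q * 0) - exp (- (Q * 0))) (at_right 0)"
    by (intro tendsto_intros)
  then have "\<forall>\<^sub>F \<eta> in at_right 0. exp_gap (Q * \<eta>) < \<kappa> / 2"
    using \<kappa> by (auto dest: order_tendstoD(2)[where a="\<kappa> / 2"])
  moreover have "\<forall>\<^sub>F \<eta> in at_right 0. 0 < \<eta> \<and> \<eta> < (1::real)"
    unfolding eventually_at_right_field by (rule exI[of _ 1]) simp
  ultimately have "\<forall>\<^sub>F \<eta> in at_right 0. exp_gap (Q * \<eta>) < \<kappa> / 2 \<and> 0 < \<eta> \<and> \<eta> < (1::real)"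
    by eventually_elim auto
  then obtain \<eta> where \<eta>: "exp_gap (Q * \<eta>) < \<kappa> / 2" "0 < \<eta>" "\<eta> < 1"
    using eventually_happens'[OF trivial_limit_at_right_real] by blast
  have "((\<lambda>e. B * A e / (1 - exp (- \<eta>))) \<longlongrightarrow> B * 0 / (1 - exp (- \<eta>))) F"
    using \<eta> by (intro tendsto_divide tendsto_mult tendsto_const A) auto
  then have "\<forall>\<^sub>F e in F. B * A e / (1 - exp (- \<eta>)) < \<kappa> / 2"
    using \<kappa> by (auto dest: order_tendstoD(2)[where a="\<kappa> / 2"])
  moreover note f bound[OF \<eta>(2) less_imp_le[OF \<eta>(3)]]
  ultimately show "\<forall>\<^sub>F e in F. dist (f e) 0 < \<kappa>"
  proof eventually_elim
    case (elim e)
    then show ?case using \<eta>(1) unfolding dist_real_def by linarith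
  qed
qed

subsection \<open>Step functions in the space of square-integrable functions\<close>

abbreviation U01 :: "real measure" where
  "U01 \<equiv> unit_interval_measure"

interpretation U: prob_space U01
  by (rule prob_space_restrict_space) auto

abbreviation L2sq :: "(real \<Rightarrow> real) \<Rightarrow> real" where
  "L2sq f \<equiv> LINT t|U01. (f t)\<^sup>2"

abbreviation L2ip :: "(real \<Rightarrow> real) \<Rightarrow> (real \<Rightarrow> real) \<Rightarrow> real" where
  "L2ip f g \<equiv> LINT t|U01. f t * g t"

lemma L2_unit_measurable: "L2_unit f \<Longrightarrow> f \<in> borel_measurable U01"
  by (simp add: L2_unit_def)

lemma L2_unit_sq: "L2_unit f \<Longrightarrow> integrable U01 (\<lambda>t. (f t)\<^sup>2)"
  by (simp add: L2_unit_def)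

lemma L2_unit_mult:
  assumes "L2_unit f" "L2_unit g"
  shows "integrable U01 (\<lambda>t. f t * g t)"
proof (rule Bochner_Integration.integrable_bound)
  show "integrable U01 (\<lambda>t. (f t)\<^sup>2 + (g t)\<^sup>2)"
    using assms by (simp add: L2_unit_sq)
  show "(\<lambda>t. f t * g t) \<in> borel_measurable U01"
    using assms by (intro borel_measurable_times L2_unit_measurable)
  have "\<bar>a * b\<bar> \<le> a\<^sup>2 + b\<^sup>2" for a b :: real
    using sum_squares_bound[of "\<bar>a\<bar>" "\<bar>b\<bar>"] abs_ge_zero[of "a * b"]
    unfolding abs_mult power2_abs by linarith
  then show "AE t in U01. norm (f t * g t) \<le> norm ((f t)\<^sup>2 + (g t)\<^sup>2)"
    by auto
qed

lemma L2_unit_add: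
  assumes "L2_unit f" "L2_unit g" shows "L2_unit (\<lambda>t. f t + g t)"
proof -
  have "integrable U01 (\<lambda>t. (f t)\<^sup>2 + (g t)\<^sup>2 + 2 * (f t * g t))"
    using assms by (intro Bochner_Integration.integrable_add integrable_mult_right
        L2_unit_sq L2_unit_mult)
  then show ?thesis
    using assms unfolding L2_unit_def
    by (auto simp: power2_sum mult.assoc intro!: borel_measurable_add)
qed

lemma L2_unit_scale: "L2_unit f \<Longrightarrow> L2_unit (\<lambda>t. c * f t)"
  by (auto simp: L2_unit_def power_mult_distrib)

lemma L2_unit_diff: "L2_unit f \<Longrightarrow> L2_unit g \<Longrightarrow> L2_unit (\<lambda>t. f t - g t)"
  using L2_unit_add[OF _ L2_unit_scale[of g "-1"], of f] by simp

lemma L2_unit_bounded: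
  assumes "f \<in> borel_measurable U01" "\<And>t. t \<in> {0<..<1} \<Longrightarrow> \<bar>f t\<bar> \<le> B"
  shows "L2_unit f"
  unfolding L2_unit_def
proof
  show "integrable U01 (\<lambda>t. (f t)\<^sup>2)"
  proof (rule U.integrable_const_bound[of _ "B\<^sup>2"])
    have "\<bar>f t\<bar>\<^sup>2 \<le> B\<^sup>2" if "t \<in> {0<..<1}" for t
      using assms(2)[OF that] by (intro power_mono) auto
    then show "AE t in U01. norm ((f t)\<^sup>2) \<le> B\<^sup>2"
      by (auto intro!: AE_I2)
    show "(\<lambda>t. (f t)\<^sup>2) \<in> borel_measurable U01"
      using assms(1) by measurable
  qed
qed fact

lemma L2sq_nonneg: "0 \<le> L2sq f"
  by (rule integral_nonneg_AE) auto

lemma L2sq_linear: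
  assumes "L2_unit f" "L2_unit g"
  shows "L2sq (\<lambda>t. a * f t + b * g t) = a\<^sup>2 * L2sq f + 2 * a * b * L2ip f g + b\<^sup>2 * L2sq g"
proof -
  have "L2sq (\<lambda>t. a * f t + b * g t) =
      (LINT t|U01. a\<^sup>2 * (f t)\<^sup>2 + 2 * a * b * (f t * g t) + b\<^sup>2 * (g t)\<^sup>2)"
    by (intro Bochner_Integration.integral_cong) (auto simp: power2_sum power_mult_distrib algebra_simps)
  also have "\<dots> = a\<^sup>2 * L2sq f + 2 * a * b * L2ip f g + b\<^sup>2 * L2sq g"
    using assms L2_unit_mult[OF assms] by (simp add: L2_unit_sq)
  finally show ?thesis .
qed

lemma L2sq_diff:
  "L2_unit f \<Longrightarrow> L2_unit g \<Longrightarrow> L2sq (\<lambda>t. f t - g t) = L2sq f - 2 * L2ip f g + L2sq g"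
  using L2sq_linear[of f g 1 "-1"] by simp

lemma L2sq_scale: "L2sq (\<lambda>t. c * f t) = c\<^sup>2 * L2sq f"
  by (simp add: power_mult_distrib)

text \<open>The nonnegative quadratic form of \<open>L2sq_linear\<close> is evaluated at
  \<open>?C\<close>, \<open>- ?B\<close> or at \<open>- ?B\<close>, \<open>?A\<close>, depending on
  which norm is positive. If both vanish, the pair \<open>1\<close>, \<open>- ?B\<close> forces the
  inner product to be zero.\<close>

lemma L2_cauchy_schwarz:
  assumes "L2_unit f" "L2_unit g"
  shows "(L2ip f g)\<^sup>2 \<le> L2sq f * L2sq g"
proof -
  let ?A = "L2sq f" and ?B = "L2ip f g" and ?C = "L2sq g"
  have q: "0 \<le> a\<^sup>2 * ?A + 2 * a * b * ?B + b\<^sup>2 * ?C" for a b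
    using L2sq_linear[OF assms, of a b] L2sq_nonneg[of "\<lambda>t. a * f t + b * g t"] by simp
  have AC: "0 \<le> ?A" "0 \<le> ?C" by (rule L2sq_nonneg)+
  consider "0 < ?C" | "0 < ?A" | "?A = 0" "?C = 0" using AC by linarith
  then show ?thesis
  proof cases
    case 1
    have "0 \<le> ?C * (?A * ?C - ?B\<^sup>2)"
      using q[of ?C "- ?B"] by (simp add: power2_eq_square algebra_simps)
    then show ?thesis using 1 by (simp add: zero_le_mult_iff)
  next
    case 2
    have "0 \<le> ?A * (?A * ?C - ?B\<^sup>2)"
      using q[of "- ?B" ?A] by (simp add: power2_eq_square algebra_simps)
    then show ?thesis using 2 by (simp add: zero_le_mult_iff)
  next
    case 3
    then show ?thesis using q[of 1 "- ?B"] by (simp add: power2_eq_square)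
  qed
qed

text \<open>The factor 2 stands in for Minkowski's inequality: it is harmless for convergence to
  zero and avoids square roots.\<close>

lemma L2sq_triangle:
  assumes "L2_unit f" "L2_unit g" "L2_unit h"
  shows "L2sq (\<lambda>t. f t - h t) \<le> 2 * L2sq (\<lambda>t. f t - g t) + 2 * L2sq (\<lambda>t. g t - h t)"
proof -
  have "L2sq (\<lambda>t. f t - h t) \<le> (LINT t|U01. 2 * (f t - g t)\<^sup>2 + 2 * (g t - h t)\<^sup>2)"
  proof (rule integral_mono)
    show "integrable U01 (\<lambda>t. (f t - h t)\<^sup>2)"
      by (intro L2_unit_sq L2_unit_diff assms)
    show "integrable U01 (\<lambda>t. 2 * (f t - g t)\<^sup>2 + 2 * (g t - h t)\<^sup>2)"
      by (intro Bochner_Integration.integrable_add integrable_mult_right L2_unit_sq L2_unit_diff assms)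
    have "(a - c)\<^sup>2 \<le> 2 * (a - b)\<^sup>2 + 2 * (b - c)\<^sup>2" for a b c :: real
      using sum_squares_bound[of "a - b" "b - c"] power2_sum[of "a - b" "b - c"] by simp
    then show "(f t - h t)\<^sup>2 \<le> 2 * (f t - g t)\<^sup>2 + 2 * (g t - h t)\<^sup>2" for t .
  qed
  also have "\<dots> = 2 * L2sq (\<lambda>t. f t - g t) + 2 * L2sq (\<lambda>t. g t - h t)"
    using assms by (simp add: L2_unit_sq L2_unit_diff)
  finally show ?thesis .
qed

lemma L2_tendsto:
  assumes f: "\<And>n. L2_unit (f n)" "L2_unit g" and lim: "(\<lambda>n. L2sq (\<lambda>t. f n t - g t)) \<longlonglongrightarrow> 0"
  shows "L2_unit h \<Longrightarrow> (\<lambda>n. L2ip (f n) h) \<longlonglongrightarrow> L2ip g h"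
    and "(\<lambda>n. L2sq (f n)) \<longlonglongrightarrow> L2sq g"
proof -
  have ip: "(\<lambda>n. L2ip (f n) h) \<longlonglongrightarrow> L2ip g h" if h: "L2_unit h" for h
  proof -
    have d: "L2ip (f n) h - L2ip g h = L2ip (\<lambda>t. f n t - g t) h" for n
      using L2_unit_mult[OF f(1) h] L2_unit_mult[OF f(2) h]
      by (simp add: left_diff_distrib)
    have cs: "(L2ip (f n) h - L2ip g h)\<^sup>2 \<le> L2sq (\<lambda>t. f n t - g t) * L2sq h" for n
      unfolding d by (intro L2_cauchy_schwarz L2_unit_diff f h)
    have "(\<lambda>n. (L2ip (f n) h - L2ip g h)\<^sup>2) \<longlonglongrightarrow> 0"
      by (rule Lim_null_comparison[OF _ tendsto_mult_left_zero[OF lim, of "L2sq h"]]) (use cs in auto)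
    from tendsto_real_sqrt[OF this] have "(\<lambda>n. L2ip (f n) h - L2ip g h) \<longlonglongrightarrow> 0"
      by (simp add: tendsto_rabs_zero_iff)
    then show ?thesis by (rule LIM_zero_cancel)
  qed
  then show "L2_unit h \<Longrightarrow> (\<lambda>n. L2ip (f n) h) \<longlonglongrightarrow> L2ip g h" .
  have "L2sq (f n) = L2sq (\<lambda>t. f n t - g t) + 2 * L2ip (f n) g - L2sq g" for n
    using L2sq_diff[OF f(1) f(2), of n] by simp
  moreover have "(\<lambda>n. L2sq (\<lambda>t. f n t - g t) + 2 * L2ip (f n) g - L2sq g) \<longlonglongrightarrow> 0 + 2 * L2ip g g - L2sq g"
    by (intro tendsto_intros lim ip f)
  ultimately show "(\<lambda>n. L2sq (f n)) \<longlonglongrightarrow> L2sq g"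
    by (simp add: power2_eq_square)
qed

section \<open>Algebra of step functions\<close>

definition step_scale :: "real \<Rightarrow> step \<Rightarrow> step" where
  "step_scale k \<phi> = map (\<lambda>(c, a, b). (k * c, a, b)) \<phi>"

lemma valid_step_simps [simp]:
  "valid_step []" "valid_step ((c, a, b) # \<phi>) \<longleftrightarrow> 0 \<le> a \<and> a \<le> b \<and> b \<le> 1 \<and> valid_step \<phi>"
  "valid_step (\<phi> @ \<psi>) \<longleftrightarrow> valid_step \<phi> \<and> valid_step \<psi>"
  "valid_step (step_scale k \<phi>) \<longleftrightarrow> valid_step \<phi>"
  unfolding valid_step_def step_scale_def by (simp_all add: ball_Un case_prod_beta)

lemma step_fun_simps [simp]:
  "step_fun [] t = 0" "step_fun ((c, a, b) # \<phi>) t = c * indicator {a<..b} t + step_fun \<phi> t"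
  "step_fun (\<phi> @ \<psi>) t = step_fun \<phi> t + step_fun \<psi> t"
  by (auto simp: step_fun_def)

lemma step_fun_scale [simp]: "step_fun (step_scale k \<phi>) t = k * step_fun \<phi> t"
  by (induction \<phi>) (auto simp: step_fun_def step_scale_def algebra_simps)

lemma step_integral_simps [simp]:
  "step_integral [] y = 0" "step_integral ((c, a, b) # \<phi>) y = c * (y b - y a) + step_integral \<phi> y"
  "step_integral (\<phi> @ \<psi>) y = step_integral \<phi> y + step_integral \<psi> y"
  by (auto simp: step_integral_def)

lemma step_integral_scale [simp]: "step_integral (step_scale k \<phi>) y = k * step_integral \<phi> y"
  by (induction \<phi>) (auto simp: step_integral_def step_scale_def algebra_simps)

text \<open>The list encoding is not unique, so concatenation with a negated copy already represents
  the difference, without a common refinement of the intervals.\<close>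

definition step_diff :: "step \<Rightarrow> step \<Rightarrow> step" where
  "step_diff \<phi> \<psi> = \<phi> @ step_scale (-1) \<psi>"

lemma step_diff_simps [simp]:
  "valid_step (step_diff \<phi> \<psi>) \<longleftrightarrow> valid_step \<phi> \<and> valid_step \<psi>"
  "step_fun (step_diff \<phi> \<psi>) t = step_fun \<phi> t - step_fun \<psi> t"
  "step_integral (step_diff \<phi> \<psi>) y = step_integral \<phi> y - step_integral \<psi> y"
  by (simp_all add: step_diff_def)

lemma borel_measurable_unit_interval:
  "f \<in> borel_measurable borel \<Longrightarrow> f \<in> borel_measurable U01"
  by (intro measurable_restrict_space1 measurable_completion) simp

lemma L2_unit_step_fun [simp]: "L2_unit (step_fun \<phi>)"
proof (induction \<phi>)
  case Nil
  show ?case by (simp add: step_fun_def[abs_def] L2_unit_def)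
next
  case (Cons p \<phi>)
  obtain c a b where p: "p = (c, a, b)" by (cases p)
  have "L2_unit (\<lambda>t. c * indicator {a<..b} t + step_fun \<phi> t)"
    by (intro L2_unit_add Cons L2_unit_bounded[of _ "\<bar>c\<bar>"] borel_measurable_unit_interval)
       (auto simp: indicator_def)
  moreover have "step_fun (p # \<phi>) = (\<lambda>t. c * indicator {a<..b} t + step_fun \<phi> t)"
    by (auto simp: p)
  ultimately show ?case by simp
qed

section \<open>Density of the step functions among the square-integrable functions\<close>

definition step_approx :: "(real \<Rightarrow> real) \<Rightarrow> bool" where
  "step_approx f \<longleftrightarrow> L2_unit f \<and> (\<forall>e>0. \<exists>\<phi>. valid_step \<phi> \<and> L2sq (\<lambda>t. step_fun \<phi> t - f t) < e)"

lemma step_approxI: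
  assumes "L2_unit f" "\<And>e. 0 < e \<Longrightarrow> \<exists>g. step_approx g \<and> L2sq (\<lambda>t. g t - f t) < e"
  shows "step_approx f"
  unfolding step_approx_def
proof (intro conjI allI impI assms(1))
  fix e :: real assume e: "0 < e"
  obtain g where g: "step_approx g" "L2sq (\<lambda>t. g t - f t) < e / 4"
    using assms(2)[of "e / 4"] e by auto
  then obtain \<phi> where \<phi>: "valid_step \<phi>" "L2sq (\<lambda>t. step_fun \<phi> t - g t) < e / 4"
    using e unfolding step_approx_def by (metis divide_pos_pos zero_less_numeral)
  have L2: "L2_unit g" using g by (simp add: step_approx_def)
  have "L2sq (\<lambda>t. step_fun \<phi> t - f t) \<le> 2 * L2sq (\<lambda>t. step_fun \<phi> t - g t) + 2 * L2sq (\<lambda>t. g t - f t)"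
    by (rule L2sq_triangle[OF L2_unit_step_fun L2 assms(1)])
  also have "\<dots> < e" using g \<phi> by simp
  finally show "\<exists>\<phi>. valid_step \<phi> \<and> L2sq (\<lambda>t. step_fun \<phi> t - f t) < e" using \<phi> by blast
qed

lemma step_approx_step_fun: "valid_step \<phi> \<Longrightarrow> step_approx (step_fun \<phi>)"
  unfolding step_approx_def by (auto intro!: exI[of _ \<phi>])

lemma step_approx_cong:
  assumes f: "step_approx f" and g: "g \<in> borel_measurable U01"
    and eq: "AE t in U01. f t = g t"
  shows "step_approx g"
proof (rule step_approxI)
  have fm: "f \<in> borel_measurable U01"
    using f by (simp add: step_approx_def L2_unit_def)
  have "integrable U01 (\<lambda>t. (g t)\<^sup>2)"
    using f by (subst integrable_cong_AE[where g="\<lambda>t. (f t)\<^sup>2"])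
      (use g fm eq in \<open>auto simp: step_approx_def L2_unit_def\<close>)
  then show "L2_unit g" using g by (simp add: L2_unit_def)
  have "L2sq (\<lambda>t. f t - g t) = (LINT t|U01. 0)"
    by (rule integral_cong_AE) (use fm g eq in auto)
  then show "\<exists>h. step_approx h \<and> L2sq (\<lambda>t. h t - g t) < e" if "0 < e" for e
    using that f by (intro exI[of _ f]) simp
qed

lemma step_approx_linear:
  assumes "step_approx f" "step_approx g"
  shows "step_approx (\<lambda>t. f t + c * g t)"
proof (rule step_approxI)
  have L2: "L2_unit f" "L2_unit g" using assms by (auto simp: step_approx_def)
  show "L2_unit (\<lambda>t. f t + c * g t)" using L2 by (intro L2_unit_add L2_unit_scale)
  fix e :: real assume e: "0 < e"
  define d where "d = e / (4 * (1 + c\<^sup>2))"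
  have c: "0 < 1 + c\<^sup>2" by (rule add_pos_nonneg) auto
  have d: "0 < d" using e c by (simp add: d_def)
  have d_eq: "2 * (1 + c\<^sup>2) * d = e / 2" using c unfolding d_def by (simp add: field_simps del: distrib_left_numeral)
  obtain \<phi> \<psi> where \<phi>: "valid_step \<phi>" "L2sq (\<lambda>t. step_fun \<phi> t - f t) < d"
    and \<psi>: "valid_step \<psi>" "L2sq (\<lambda>t. step_fun \<psi> t - g t) < d"
    using assms d unfolding step_approx_def by meson
  have "L2sq (\<lambda>t. (step_fun \<phi> t + c * step_fun \<psi> t) - (f t + c * g t)) \<le>
      2 * L2sq (\<lambda>t. (step_fun \<phi> t + c * step_fun \<psi> t) - (f t + c * step_fun \<psi> t)) +
      2 * L2sq (\<lambda>t. (f t + c * step_fun \<psi> t) - (f t + c * g t))"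
    by (intro L2sq_triangle L2_unit_add L2_unit_scale L2 L2_unit_step_fun)
  also have "\<dots> = 2 * L2sq (\<lambda>t. step_fun \<phi> t - f t) + 2 * c\<^sup>2 * L2sq (\<lambda>t. step_fun \<psi> t - g t)"
    using L2sq_scale[of c "\<lambda>t. step_fun \<psi> t - g t"] by (simp add: right_diff_distrib)
  also have "\<dots> \<le> 2 * d + 2 * c\<^sup>2 * d"
    using \<phi> \<psi> by (intro add_mono mult_left_mono) auto
  also have "\<dots> = e / 2" unfolding d_eq[symmetric] by (simp add: algebra_simps)
  also have "\<dots> < e" using e by simp
  finally show "\<exists>h. step_approx h \<and> L2sq (\<lambda>t. h t - (f t + c * g t)) < e"
    using \<phi> \<psi> by (intro exI[of _ "step_fun (\<phi> @ step_scale c \<psi>)"] conjI step_approx_step_fun) auto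
qed

lemma step_approx_lim:
  assumes s: "\<And>n. step_approx (s n)" and lim: "\<And>t. t \<in> {0<..<1} \<Longrightarrow> (\<lambda>n. s n t) \<longlonglongrightarrow> f t"
    and f: "f \<in> borel_measurable U01"
    and B: "L2_unit B" "\<And>n t. t \<in> {0<..<1} \<Longrightarrow> \<bar>s n t\<bar> \<le> B t"
  shows "step_approx f"
proof (rule step_approxI)
  have fB: "\<bar>f t\<bar> \<le> B t" if "t \<in> {0<..<1}" for t
    by (rule tendsto_upperbound[OF tendsto_rabs[OF lim[OF that]]]) (use B(2)[OF that] in auto)
  have bd: "\<bar>f t\<bar>\<^sup>2 \<le> (B t)\<^sup>2" if "t \<in> {0<..<1}" for t
    using fB[OF that] by (intro power_mono) auto
  have "integrable U01 (\<lambda>t. (f t)\<^sup>2)"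
    by (rule Bochner_Integration.integrable_bound[OF L2_unit_sq[OF B(1)]])
       (use f bd in \<open>auto intro!: AE_I2\<close>)
  then show L2: "L2_unit f" using f by (simp add: L2_unit_def)
  have "(\<lambda>n. L2sq (\<lambda>t. s n t - f t)) \<longlonglongrightarrow> (LINT t|U01. 0)"
  proof (rule integral_dominated_convergence)
    show "integrable U01 (\<lambda>t. 4 * (B t)\<^sup>2)"
      using L2_unit_sq[OF B(1)] by simp
    show "(\<lambda>t. (s n t - f t)\<^sup>2) \<in> borel_measurable U01" for n
      using L2_unit_diff[OF _ L2, of "s n"] s[of n]
      by (auto simp: step_approx_def dest!: L2_unit_sq)
    have "(\<lambda>n. (s n t - f t)\<^sup>2) \<longlonglongrightarrow> (f t - f t)\<^sup>2" if "t \<in> {0<..<1}" for t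
      by (intro tendsto_intros lim that)
    then show "AE t in U01. (\<lambda>n. (s n t - f t)\<^sup>2) \<longlonglongrightarrow> 0"
      by (auto intro!: AE_I2)
    have "\<bar>s n t - f t\<bar>\<^sup>2 \<le> (2 * B t)\<^sup>2" if "t \<in> {0<..<1}" for t n
      using fB[OF that] B(2)[OF that, of n] by (intro power_mono) auto
    then show "AE t in U01. norm ((s n t - f t)\<^sup>2) \<le> 4 * (B t)\<^sup>2" for n
      by (auto intro!: AE_I2 simp: power_mult_distrib)
  qed simp
  then have lim0: "(\<lambda>n. L2sq (\<lambda>t. s n t - f t)) \<longlonglongrightarrow> 0" by simp
  show "\<exists>g. step_approx g \<and> L2sq (\<lambda>t. g t - f t) < e" if e: "0 < e" for e
  proof -
    obtain n where "L2sq (\<lambda>t. s n t - f t) < e"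
      using eventually_happens'[OF sequentially_bot order_tendstoD(2)[OF lim0 e]] by blast
    then show ?thesis using s by blast
  qed
qed

text \<open>Dynkin's argument: half-lines are stable under intersection and their traces on the unit
  interval are single steps; complements are handled by linearity and disjoint unions by dominated
  convergence.\<close>

lemma step_approx_indicator_borel:
  assumes "A \<in> sets borel" shows "step_approx (indicator A)"
proof -
  have one: "step_approx (\<lambda>_. 1)"
    by (rule step_approx_cong[OF step_approx_step_fun[of "[(1, 0, 1)]"]]) (auto intro!: AE_I2)
  have "Int_stable (range (\<lambda>a::real. {..a}))" by (auto simp: Int_stable_def)
  moreover have "range (\<lambda>a::real. {..a}) \<subseteq> Pow UNIV" by simp
  moreover have "A \<in> sigma_sets UNIV (range (\<lambda>a::real. {..a}))"
    using assms unfolding borel_eq_atMost by simp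
  ultimately show ?thesis
  proof (induction rule: sigma_sets_induct_disjoint)
    case (basic A)
    then obtain a where a: "A = {..a}" by auto
    \<comment> \<open>Clamping \<open>a\<close> to the unit interval gives a valid step that agrees
      with the half-line at every point of the open interval.\<close>
    show ?case unfolding a
      by (rule step_approx_cong[OF step_approx_step_fun[of "[(1, 0, min (max a 0) 1)]"]])
         (auto intro!: AE_I2 borel_measurable_unit_interval simp: indicator_def)
  next
    case empty
    show ?case
      by (rule step_approx_cong[OF step_approx_step_fun[of "[]"]]) (auto intro!: AE_I2)
  next
    case (compl A)
    have "step_approx (\<lambda>t. 1 + (-1) * indicator A t)"
      by (intro step_approx_linear one compl)
    moreover have "(\<lambda>t. 1 + (-1) * indicator A t) = (indicator (UNIV - A) :: real \<Rightarrow> real)"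
      by (auto simp: indicator_def)
    ultimately show ?case by simp
  next
    case (union A)
    have A: "A i \<in> sets borel" for i
      using union(2) unfolding borel_eq_atMost by (auto simp: image_subset_iff)
    have s: "step_approx (\<lambda>t. \<Sum>i<n. indicator (A i) t)" for n
    proof (induction n)
      case 0
      show ?case by (rule step_approx_cong[OF step_approx_step_fun[of "[]"]]) (auto intro!: AE_I2)
    next
      case (Suc n)
      then show ?case using step_approx_linear[OF Suc union(3)[of n], of 1] by simp
    qed
    have ind: "(\<Sum>i<n. indicator (A i) t) = (indicator (\<Union>i<n. A i) t :: real)" for n t
      using union(1) by (subst indicator_UN_disjoint) (auto simp: disjoint_family_on_def)
    show ?case
    proof (rule step_approx_lim[where s="\<lambda>n t. \<Sum>i<n. indicator (A i) t" and B="\<lambda>_. 1"])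
      show "(\<lambda>n. \<Sum>i<n. indicator (A i) t) \<longlonglongrightarrow> (indicator (\<Union>i. A i) t :: real)" for t
        unfolding ind by (rule LIMSEQ_indicator_UN)
      show "\<bar>\<Sum>i<n. indicator (A i) t\<bar> \<le> (1::real)" for n t
        unfolding ind by (simp add: indicator_def)
      show "(indicator (\<Union>i. A i) :: real \<Rightarrow> real) \<in> borel_measurable U01"
        using A by (intro borel_measurable_unit_interval borel_measurable_indicator) auto
    qed (use s one in \<open>auto simp: step_approx_def\<close>)
  qed
qed

text \<open>Signals are Lebesgue measurable, so sets of the completed \<sigma>-algebra occur. Such a
  set differs from a Borel set by a null set, which is invisible to \<open>L2sq\<close>.\<close>

lemma step_approx_indicator:
  assumes "A \<in> sets U01" shows "step_approx (indicator A)"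
proof -
  have "A \<in> sets lebesgue" using assms by (auto simp: sets_restrict_space)
  then obtain S N N' where A: "A = S \<union> N" "N \<subseteq> N'" "N' \<in> null_sets lborel" "S \<in> sets lborel"
    by (rule sets_completionE)
  have "AE t in lebesgue. t \<notin> N'"
    using A(3) by (intro AE_completion AE_not_in)
  then have "AE t in U01. (indicator S t :: real) = indicator A t"
    by (subst AE_restrict_space_iff) (use A in \<open>auto elim!: eventually_mono simp: indicator_def\<close>)
  then show ?thesis
    by (rule step_approx_cong[OF step_approx_indicator_borel, rotated 2])
       (use A assms in auto)
qed

text \<open>Simple functions dominated by \<open>2 * \<bar>f t\<bar>\<close> converge pointwise to
  \<open>f\<close>, and each is a finite combination of indicators of measurable sets.\<close>

lemma step_fun_dense:
  assumes f: "L2_unit f" shows "step_approx f"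
proof -
  have fm: "f \<in> borel_measurable U01" using f by (rule L2_unit_measurable)
  obtain s where s: "\<And>i. simple_function U01 (s i)"
      "\<And>x. x \<in> space U01 \<Longrightarrow> (\<lambda>i. s i x) \<longlonglongrightarrow> f x"
      "\<And>i x. x \<in> space U01 \<Longrightarrow> dist (s i x) 0 \<le> 2 * dist (f x) 0"
    using borel_measurable_implies_sequence_metric[OF fm, of 0] by blast
  have "step_approx (s i)" for i
  proof -
    let ?Y = "s i ` space U01"
    define B where "B y = s i -` {y} \<inter> space U01" for y
    have B: "B y \<in> sets U01" for y
      unfolding B_def using s(1) by (rule simple_functionD)
    have "step_approx (\<lambda>t. \<Sum>y\<in>Y. y * indicator (B y) t)"
      if "finite Y" for Y
      using that
    proof (induction Y)
      case empty
      show ?case by (rule step_approx_cong[OF step_approx_step_fun[of "[]"]]) (auto intro!: AE_I2)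
    next
      case (insert y Y)
      show ?case
        unfolding sum.insert[OF insert(1,2)] add.commute[of "y * _"]
        by (rule step_approx_linear[OF insert(3) step_approx_indicator[OF B]])
    qed
    moreover have "finite ?Y" using s(1) by (rule simple_functionD)
    ultimately have "step_approx (\<lambda>t. \<Sum>y\<in>?Y. y * indicator (B y) t)"
      by blast
    moreover have "(\<Sum>y\<in>?Y. y * indicator (B y) t) = s i t" if "t \<in> space U01" for t
      unfolding simple_function_indicator_representation_banach[OF s(1) that] B_def
      by (simp only: real_scaleR_def mult.commute)
    ultimately show ?thesis
      using s(1)[of i]
      by (intro step_approx_cong[of "\<lambda>t. \<Sum>y\<in>?Y. y * indicator (B y) t" "s i"])
         (auto intro!: AE_I2 borel_measurable_simple_function simp del: space_restrict_space)
  qed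
  then show ?thesis
  proof (rule step_approx_lim[where s=s])
    show "L2_unit (\<lambda>t. 2 * \<bar>f t\<bar>)"
      using f by (intro L2_unit_scale) (auto simp: L2_unit_def)
  qed (use s fm in \<open>auto simp: dist_real_def\<close>)
qed

text \<open>The geometric rate makes the distances summable. Because of it the Wiener integrals of
  the approximants converge almost surely and not merely in mean square.\<close>

lemma step_approximation_fast:
  assumes "L2_unit f"
  obtains \<phi> where "\<And>n. valid_step (\<phi> n)" "\<And>n. L2sq (\<lambda>t. step_fun (\<phi> n) t - f t) < (1/4) ^ n"
proof -
  have "\<exists>\<phi>. valid_step \<phi> \<and> L2sq (\<lambda>t. step_fun \<phi> t - f t) < (1/4) ^ n" for n
    using step_fun_dense[OF assms] unfolding step_approx_def by simp
  then show ?thesis using that by metis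
qed

lemma L2sq_fast_tendsto:
  assumes "\<And>n. L2sq (\<lambda>t. step_fun (\<phi> n) t - f t) < (1/4) ^ n"
  shows "(\<lambda>n. L2sq (\<lambda>t. step_fun (\<phi> n) t - f t)) \<longlonglongrightarrow> 0"
proof -
  have "(\<lambda>n. (1/4::real) ^ n) \<longlonglongrightarrow> 0" by (rule LIMSEQ_power_zero) simp
  then show ?thesis
    by (rule tendsto_sandwich[OF _ _ tendsto_const, rotated 2])
       (use assms L2sq_nonneg in \<open>auto intro!: always_eventually less_imp_le\<close>)
qed

subsection \<open>Wiener integrals\<close>

definition drift :: "(real \<Rightarrow> real) \<Rightarrow> real \<Rightarrow> real" where
  "drift f t = (LINT s|lebesgue_on {0<..<t}. f s)"

lemma L2_unit_indicator: "A \<in> sets borel \<Longrightarrow> L2_unit (indicator A)"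
  by (rule L2_unit_bounded[of _ 1]) (auto intro!: borel_measurable_unit_interval simp: indicator_def)

text \<open>As an inner product the drift at \<open>t\<close> depends continuously on
  \<open>f\<close> in mean square. The right end point may be included because a point is a null
  set; this matches the half-open intervals of step functions.\<close>

lemma drift_eq:
  assumes t: "0 \<le> t" "t \<le> 1" and f: "L2_unit f"
  shows "drift f t = L2ip (indicator {0<..t}) f"
proof -
  define F where "F s = indicator {0<..<1} s * f s" for s
  have F: "F \<in> borel_measurable lebesgue"
    using L2_unit_measurable[OF f]
    by (simp add: F_def[abs_def] borel_measurable_restrict_space_iff mult.commute)
  have "AE s in lebesgue. s \<noteq> t"
    by (intro AE_completion AE_lborel_singleton)
  then have eq: "AE s in lebesgue. indicator {0<..<t} s * F s = indicator {0<..t} s * F s"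
    by eventually_elim (auto simp: indicator_def)
  have "drift f t = (LINT s|lebesgue. indicator {0<..<t} s * f s)"
    unfolding drift_def by (subst integral_restrict_space) auto
  also have "\<dots> = (LINT s|lebesgue. indicator {0<..<t} s * F s)"
    by (rule Bochner_Integration.integral_cong) (use t in \<open>auto simp: F_def indicator_def\<close>)
  also have "\<dots> = (LINT s|lebesgue. indicator {0<..t} s * F s)"
    by (rule integral_cong_AE[OF _ _ eq]) (intro borel_measurable_times F borel_measurable_indicator; simp)+
  also have "\<dots> = (LINT s|lebesgue. indicator {0<..<1} s * (indicator {0<..t} s * f s))"
    by (rule Bochner_Integration.integral_cong) (auto simp: F_def indicator_def)
  also have "\<dots> = L2ip (indicator {0<..t}) f"
    by (subst integral_restrict_space) auto
  finally show ?thesis .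
qed

lemma drift_increment:
  assumes "0 \<le> a" "a \<le> b" "b \<le> 1" and f: "L2_unit f"
  shows "drift f b - drift f a = L2ip (indicator {a<..b}) f"
proof -
  have "drift f b - drift f a = (LINT s|U01. indicator {0<..b} s * f s - indicator {0<..a} s * f s)"
    using assms by (subst Bochner_Integration.integral_diff)
      (auto simp: drift_eq intro!: L2_unit_mult L2_unit_indicator)
  also have "\<dots> = L2ip (indicator {a<..b}) f"
    by (rule Bochner_Integration.integral_cong) (use assms in \<open>auto simp: indicator_def\<close>)
  finally show ?thesis .
qed

lemma step_integral_drift:
  assumes "valid_step \<phi>" "L2_unit f"
  shows "step_integral \<phi> (drift f) = L2ip (step_fun \<phi>) f"
  using assms(1)
proof (induction \<phi>)
  case (Cons p \<phi>)
  obtain c a b where p: "p = (c, a, b)" by (cases p)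
  have v: "0 \<le> a" "a \<le> b" "b \<le> 1" "valid_step \<phi>" using Cons.prems by (auto simp: p)
  have "L2ip (step_fun (p # \<phi>)) f =
      (LINT s|U01. c * (indicator {a<..b} s * f s) + step_fun \<phi> s * f s)"
    by (rule Bochner_Integration.integral_cong) (auto simp: p algebra_simps)
  also have "\<dots> = c * L2ip (indicator {a<..b}) f + L2ip (step_fun \<phi>) f"
    using assms(2)
    by (subst Bochner_Integration.integral_add)
       (auto intro!: integrable_mult_right L2_unit_mult L2_unit_indicator)
  finally show ?case
    using v Cons.IH drift_increment[OF v(1-3) assms(2)] by (simp add: p)
qed (simp add: step_fun_def step_integral_def)

section \<open>Grids of the unit interval\<close>

definition grid :: "(nat \<Rightarrow> real) \<Rightarrow> nat \<Rightarrow> bool" where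
  "grid \<tau> n \<longleftrightarrow> \<tau> 0 = 0 \<and> \<tau> n = 1 \<and> (\<forall>i<n. \<tau> i < \<tau> (Suc i))"

definition step_fits :: "step \<Rightarrow> real set \<Rightarrow> bool" where
  "step_fits \<phi> F \<longleftrightarrow> (\<forall>(c, a, b) \<in> set \<phi>. a \<in> F \<and> b \<in> F)"

lemma finite_step_endpoints: "\<exists>F. finite F \<and> F \<subseteq> {0..1} \<and> step_fits \<phi> F" if "valid_step \<phi>"
proof (intro exI conjI)
  let ?F = "(\<lambda>(c, a, b). a) ` set \<phi> \<union> (\<lambda>(c, a, b). b) ` set \<phi>"
  show "finite ?F" by simp
  show "?F \<subseteq> {0..1}" using that unfolding valid_step_def by fastforce
  show "step_fits \<phi> ?F" unfolding step_fits_def by force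
qed

lemma step_fits_mono: "step_fits \<phi> F \<Longrightarrow> F \<subseteq> G \<Longrightarrow> step_fits \<phi> G"
  unfolding step_fits_def by fast

lemma grid_exists:
  assumes F: "finite F" "F \<subseteq> {0..1::real}"
  obtains \<tau> n where "grid \<tau> n" "F \<subseteq> \<tau> ` {..n}"
proof -
  define l where "l = sorted_list_of_set (insert 0 (insert 1 F))"
  have set: "set l = insert 0 (insert 1 F)" using F unfolding l_def by (subst set_sorted_list_of_set) auto
  have sorted: "sorted_wrt (<) l" by (simp add: l_def)
  have ne: "l \<noteq> []" using set by auto
  define n where "n = length l - 1"
  have len: "length l = Suc n" using ne by (simp add: n_def)
  have mono: "l ! i \<le> l ! j" if "i \<le> j" "j \<le> n" for i j
    using sorted_wrt_nth_less[OF sorted, of i j] that len by (cases "i = j") auto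
  have range: "l ! i \<in> {0..1}" if "i \<le> n" for i
    using nth_mem[of i l] that len set F by auto
  obtain i where "i \<le> n" "l ! i = 0" using set len by (metis in_set_conv_nth insertI1 less_Suc_eq_le)
  then have "l ! 0 = 0" using mono[of 0 i] range[of 0] by simp
  moreover obtain j where "j \<le> n" "l ! j = 1" using set len
    by (metis in_set_conv_nth insertI1 insertI2 less_Suc_eq_le)
  then have "l ! n = 1" using mono[of j n] range[of n] by simp
  ultimately have "grid (\<lambda>i. l ! i) n"
    using sorted_wrt_nth_less[OF sorted] len by (auto simp: grid_def)
  moreover have "F \<subseteq> (\<lambda>i. l ! i) ` {..n}"
  proof
    fix t assume "t \<in> F"
    then have "t \<in> set l" by (simp add: set)
    then show "t \<in> (\<lambda>i. l ! i) ` {..n}" by (auto simp: in_set_conv_nth len less_Suc_eq_le)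
  qed
  ultimately show ?thesis by (rule that)
qed

lemma grid_less:
  assumes "grid \<tau> n" "i < j" "j \<le> n" shows "\<tau> i < \<tau> j"
  using assms(2,3)
proof (induction j)
  case (Suc j)
  have "\<tau> j < \<tau> (Suc j)" using assms(1) Suc.prems by (simp add: grid_def)
  then show ?case using Suc by (cases "i = j") auto
qed simp

lemma grid_less_iff: "grid \<tau> n \<Longrightarrow> i \<le> n \<Longrightarrow> j \<le> n \<Longrightarrow> \<tau> i < \<tau> j \<longleftrightarrow> i < j"
  by (metis grid_less less_asym' linorder_neqE_nat order_less_irrefl)

lemma grid_le_iff: "grid \<tau> n \<Longrightarrow> i \<le> n \<Longrightarrow> j \<le> n \<Longrightarrow> \<tau> i \<le> \<tau> j \<longleftrightarrow> i \<le> j"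
  using grid_less_iff[of \<tau> n j i] by (simp add: linorder_not_less[symmetric])

lemma grid_bounds: "grid \<tau> n \<Longrightarrow> i \<le> n \<Longrightarrow> 0 \<le> \<tau> i \<and> \<tau> i \<le> 1"
  using grid_le_iff[of \<tau> n 0 i] grid_le_iff[of \<tau> n i n] by (auto simp: grid_def)

text \<open>Overlapping intervals become disjoint cells, so that the independence of increments can
  be used. The value on a cell is read at its right end point because the intervals exclude the left
  end and include the right one.\<close>

lemma step_integral_grid:
  assumes g: "grid \<tau> n" and "valid_step \<phi>" "step_fits \<phi> (\<tau> ` {..n})"
  shows "step_integral \<phi> y = (\<Sum>i<n. step_fun \<phi> (\<tau> (Suc i)) * (y (\<tau> (Suc i)) - y (\<tau> i)))"
  using assms(2,3)
proof (induction \<phi>)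
  case (Cons p \<phi>)
  obtain c a b where p: "p = (c, a, b)" by (cases p)
  obtain j k where jk: "a = \<tau> j" "j \<le> n" "b = \<tau> k" "k \<le> n" and v: "a \<le> b"
    using Cons.prems unfolding step_fits_def by (auto simp: p)
  have le: "j \<le> k" using v grid_le_iff[OF g] jk by simp
  have ind: "indicator {a<..b} (\<tau> (Suc i)) = (if i \<in> {j..<k} then 1 else 0 :: real)" if "i < n" for i
    using that jk grid_less_iff[OF g, of j "Suc i"] grid_le_iff[OF g, of "Suc i" k] by (auto simp: indicator_def)
  have "(\<Sum>i<n. c * indicator {a<..b} (\<tau> (Suc i)) * (y (\<tau> (Suc i)) - y (\<tau> i))) =
     (\<Sum>i<n. if i \<in> {j..<k} then c * (y (\<tau> (Suc i)) - y (\<tau> i)) else 0)"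
    by (rule sum.cong) (auto simp: ind)
  also have "\<dots> = (\<Sum>i\<in>{j..<k}. c * (y (\<tau> (Suc i)) - y (\<tau> i)))"
    using jk by (subst sum.inter_restrict[symmetric]) (auto intro!: sum.cong)
  also have "\<dots> = c * (y b - y a)"
    using sum_Suc_diff'[OF le, of "\<lambda>i. y (\<tau> i)"] by (simp add: jk flip: sum_distrib_left)
  finally show ?case
    using Cons by (simp add: p distrib_right sum.distrib step_fits_def)
qed simp

lemma step_fun_grid:
  assumes g: "grid \<tau> n" and i: "i < n" and t: "t \<in> {\<tau> i<..\<tau> (Suc i)}" and "step_fits \<phi> (\<tau> ` {..n})"
  shows "step_fun \<phi> t = step_fun \<phi> (\<tau> (Suc i))"
  using assms(4)
proof (induction \<phi>)
  case (Cons p \<phi>)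
  obtain c a b where p: "p = (c, a, b)" by (cases p)
  obtain j k where jk: "a = \<tau> j" "j \<le> n" "b = \<tau> k" "k \<le> n"
    using Cons.prems unfolding step_fits_def by (auto simp: p)
  have "\<tau> j < t \<longleftrightarrow> \<tau> j < \<tau> (Suc i)"
  proof
    assume "\<tau> j < \<tau> (Suc i)"
    then have "j \<le> i" using grid_less_iff[OF g, of j "Suc i"] jk i by simp
    then have "\<tau> j \<le> \<tau> i" using grid_le_iff[OF g, of j i] jk i by simp
    then show "\<tau> j < t" using t by simp
  qed (use t in simp)
  moreover have "t \<le> \<tau> k \<longleftrightarrow> \<tau> (Suc i) \<le> \<tau> k"
  proof
    assume "t \<le> \<tau> k"
    then have "\<tau> i < \<tau> k" using t by simp
    then have "Suc i \<le> k" using grid_less_iff[OF g, of i k] jk i by simp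
    then show "\<tau> (Suc i) \<le> \<tau> k" using grid_le_iff[OF g, of "Suc i" k] jk i by simp
  qed (use t in simp)
  ultimately show ?case using Cons by (simp add: p jk indicator_def step_fits_def)
qed simp

lemma drift_step_fun_grid:
  assumes g: "grid \<tau> n" and i: "i < n" and "step_fits \<phi> (\<tau> ` {..n})"
  shows "drift (step_fun \<phi>) (\<tau> (Suc i)) - drift (step_fun \<phi>) (\<tau> i) = step_fun \<phi> (\<tau> (Suc i)) * (\<tau> (Suc i) - \<tau> i)"
proof -
  have b: "0 \<le> \<tau> i" "\<tau> i \<le> \<tau> (Suc i)" "\<tau> (Suc i) \<le> 1"
    using grid_bounds[OF g, of i] grid_bounds[OF g, of "Suc i"] grid_le_iff[OF g, of i "Suc i"] i by auto
  have "drift (step_fun \<phi>) (\<tau> (Suc i)) - drift (step_fun \<phi>) (\<tau> i) = L2ip (indicator {\<tau> i<..\<tau> (Suc i)}) (step_fun \<phi>)"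
    by (rule drift_increment[OF b L2_unit_step_fun])
  also have "\<dots> = (LINT t|U01. step_fun \<phi> (\<tau> (Suc i)) * indicator {\<tau> i<..\<tau> (Suc i)} t)"
  proof (rule Bochner_Integration.integral_cong[OF refl])
    show "indicator {\<tau> i<..\<tau> (Suc i)} t * step_fun \<phi> t =
        step_fun \<phi> (\<tau> (Suc i)) * indicator {\<tau> i<..\<tau> (Suc i)} t" for t
      by (cases "t \<in> {\<tau> i<..\<tau> (Suc i)}") (simp_all add: step_fun_grid[OF g i _ assms(3), of t])
  qed
  also have "\<dots> = step_fun \<phi> (\<tau> (Suc i)) * (LINT t|U01. indicator {\<tau> i<..\<tau> (Suc i)} t)"
    by simp
  \<comment> \<open>The length of the cell is the increment of the drift of the constant function
    one.\<close>
  also have "(LINT t|U01. indicator {\<tau> i<..\<tau> (Suc i)} t) = \<tau> (Suc i) - \<tau> i"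
  proof -
    have "(LINT t|U01. indicator {\<tau> i<..\<tau> (Suc i)} t) =
       (LINT t|U01. indicator {\<tau> i<..\<tau> (Suc i)} t * (1::real))" by simp
    also have "\<dots> = drift (\<lambda>_. 1) (\<tau> (Suc i)) - drift (\<lambda>_. 1) (\<tau> i)"
      by (rule drift_increment[OF b, symmetric]) (auto simp: L2_unit_def)
    also have "\<dots> = \<tau> (Suc i) - \<tau> i"
      using b by (simp add: drift_def measure_restrict_space)
    finally show ?thesis .
  qed
  finally show ?thesis by simp
qed

text \<open>By \<open>step_integral_drift\<close> the squared norm is the step integral of
  \<open>\<phi>\<close> against its own drift, to which the grid formula applies.\<close>

lemma L2sq_step_grid:
  assumes g: "grid \<tau> n" and \<phi>: "valid_step \<phi>" "step_fits \<phi> (\<tau> ` {..n})"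
  shows "L2sq (step_fun \<phi>) = (\<Sum>i<n. (step_fun \<phi> (\<tau> (Suc i)))\<^sup>2 * (\<tau> (Suc i) - \<tau> i))"
proof -
  have "L2sq (step_fun \<phi>) = step_integral \<phi> (drift (step_fun \<phi>))"
    using step_integral_drift[OF \<phi>(1) L2_unit_step_fun, of \<phi>] by (simp add: power2_eq_square)
  also have "\<dots> = (\<Sum>i<n. (step_fun \<phi> (\<tau> (Suc i)))\<^sup>2 * (\<tau> (Suc i) - \<tau> i))"
    unfolding step_integral_grid[OF g \<phi>]
    by (rule sum.cong) (auto simp: drift_step_fun_grid[OF g _ \<phi>(2)] power2_eq_square)
  finally show ?thesis .
qed

section \<open>Normal laws through characteristic functions\<close>

lemma iexp_add: "iexp (a + b) = iexp a * iexp b"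
  by (simp add: distrib_left exp_add)

text \<open>The coefficient \<open>c\<close> may vanish, and then \<open>c * X\<close> has no
  density; the characteristic function covers this case as well. It occurs on cells where a step
  function is zero.\<close>

lemma (in prob_space) char_centered_normal:
  assumes X: "distributed M lborel X (normal_density 0 \<sigma>)" and \<sigma>: "0 < \<sigma>"
  shows "char (distr M borel (\<lambda>\<omega>. c * X \<omega>)) t = complex_of_real (exp (- (t * c * \<sigma>)\<^sup>2 / 2))"
proof -
  have [measurable]: "X \<in> borel_measurable M" using distributed_measurable[OF X] by simp
  have "distributed M lborel (\<lambda>\<omega>. X \<omega> / \<sigma>) std_normal_density"
    using normal_standard_normal_convert[OF \<sigma>, of X 0] X by simp
  then have "distr M lborel (\<lambda>\<omega>. X \<omega> / \<sigma>) = std_normal_distribution"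
    by (rule distributed_distr_eq_density)
  moreover have "distr M borel (\<lambda>\<omega>. X \<omega> / \<sigma>) = distr M lborel (\<lambda>\<omega>. X \<omega> / \<sigma>)"
    by (rule distr_cong) auto
  ultimately have std: "distr M borel (\<lambda>\<omega>. X \<omega> / \<sigma>) = std_normal_distribution" by simp
  have "char (distr M borel (\<lambda>\<omega>. c * X \<omega>)) t = (CLINT \<omega>|M. iexp (t * (c * X \<omega>)))"
    unfolding char_def by (rule integral_distr) auto
  also have "\<dots> = (CLINT \<omega>|M. iexp ((t * c * \<sigma>) * (X \<omega> / \<sigma>)))"
    using \<sigma> by (simp add: mult.assoc)
  also have "\<dots> = char (distr M borel (\<lambda>\<omega>. X \<omega> / \<sigma>)) (t * c * \<sigma>)"
    unfolding char_def by (rule integral_distr[symmetric]) auto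
  finally show ?thesis unfolding std char_std_normal_distribution .
qed

lemma (in prob_space) distr_std_normal_of_char:
  assumes X [measurable]: "X \<in> borel_measurable M" and v: "0 < v"
    and char: "\<And>t. char (distr M borel X) t = iexp (t * m) * complex_of_real (exp (- (t\<^sup>2 * v) / 2))"
  shows "distr M borel (\<lambda>\<omega>. (X \<omega> - m) / sqrt v) = std_normal_distribution"
proof (rule Levy_uniqueness)
  show "char (distr M borel (\<lambda>\<omega>. (X \<omega> - m) / sqrt v)) = char std_normal_distribution"
  proof
    fix t
    let ?s = "t / sqrt v"
    have "char (distr M borel (\<lambda>\<omega>. (X \<omega> - m) / sqrt v)) t = (CLINT \<omega>|M. iexp (t * ((X \<omega> - m) / sqrt v)))"
      unfolding char_def by (rule integral_distr) auto
    also have "\<dots> = (CLINT \<omega>|M. iexp (- (?s * m)) * iexp (?s * X \<omega>))"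
      unfolding iexp_add[symmetric]
      by (simp add: right_diff_distrib diff_divide_distrib)
    also have "\<dots> = iexp (- (?s * m)) * (CLINT \<omega>|M. iexp (?s * X \<omega>))"
      by (rule integral_mult_right_zero)
    also have "(CLINT \<omega>|M. iexp (?s * X \<omega>)) = char (distr M borel X) ?s"
      unfolding char_def by (rule integral_distr[symmetric]) auto
    also have "iexp (- (?s * m)) * \<dots> = (iexp (- (?s * m)) * iexp (?s * m)) * complex_of_real (exp (- (?s\<^sup>2 * v) / 2))"
      unfolding char by (simp add: mult.assoc)
    also have "iexp (- (?s * m)) * iexp (?s * m) = 1"
      unfolding iexp_add[symmetric] by simp
    also have "?s\<^sup>2 * v = t\<^sup>2"
      using v by (simp add: power_divide)
    finally show "char (distr M borel (\<lambda>\<omega>. (X \<omega> - m) / sqrt v)) t = char std_normal_distribution t"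
      by (simp add: char_std_normal_distribution)
  qed
qed (auto simp: real_dist_normal_dist)

text \<open>\<open>iexp\<close> is Lipschitz with constant one, so the difference is controlled by
  the mean of \<bar>X n - Y\<bar> and, by Cauchy-Schwarz, by the mean square. The bounds are
  nonnegative integrals because \<open>Y\<close> is not known to be integrable.\<close>

lemma (in prob_space) char_tendsto_of_mean_square:
  assumes X [measurable]: "\<And>n. X n \<in> borel_measurable M" and Y [measurable]: "Y \<in> borel_measurable M"
    and lim: "(\<lambda>n. \<integral>\<^sup>+\<omega>. ennreal ((X n \<omega> - Y \<omega>)\<^sup>2) \<partial>M) \<longlonglongrightarrow> 0"
  shows "(\<lambda>n. char (distr M borel (X n)) t) \<longlonglongrightarrow> char (distr M borel Y) t"
proof -
  let ?d = "\<lambda>n. char (distr M borel (X n)) t - char (distr M borel Y) t"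
  have iexp_lipschitz: "norm (iexp a - iexp b) \<le> \<bar>a - b\<bar>" for a b
  proof -
    have "iexp a - iexp b = iexp b * (iexp (a - b) - 1)"
      unfolding right_diff_distrib iexp_add[symmetric] by simp
    then have "norm (iexp a - iexp b) = norm (iexp (a - b) - 1)"
      by (simp add: norm_mult)
    also have "\<dots> \<le> \<bar>a - b\<bar>" using iexp_approx1[of "a - b" 0] by simp
    finally show ?thesis .
  qed
  have bound: "ennreal ((norm (?d n))\<^sup>2) \<le> ennreal (t\<^sup>2) * (\<integral>\<^sup>+\<omega>. ennreal ((X n \<omega> - Y \<omega>)\<^sup>2) \<partial>M)" for n
  proof -
    have int: "integrable M (\<lambda>\<omega>. iexp (t * X n \<omega>))" "integrable M (\<lambda>\<omega>. iexp (t * Y \<omega>))"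
      by (rule integrable_const_bound[of _ 1]; simp)+
    have "?d n = (CLINT \<omega>|M. iexp (t * X n \<omega>)) - (CLINT \<omega>|M. iexp (t * Y \<omega>))"
      unfolding char_def by (subst (1 2) integral_distr) auto
    also have "\<dots> = (CLINT \<omega>|M. iexp (t * X n \<omega>) - iexp (t * Y \<omega>))"
      using int by (rule Bochner_Integration.integral_diff[symmetric])
    finally have "ennreal (norm (?d n)) \<le> (\<integral>\<^sup>+\<omega>. norm (iexp (t * X n \<omega>) - iexp (t * Y \<omega>)) \<partial>M)"
      using int by (simp only:) (rule integral_norm_bound_ennreal, auto)
    also have "\<dots> \<le> (\<integral>\<^sup>+\<omega>. ennreal \<bar>t * (X n \<omega> - Y \<omega>)\<bar> * 1 \<partial>M)"
      using iexp_lipschitz[of "t * X n _" "t * Y _"]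
      by (intro nn_integral_mono) (auto simp: right_diff_distrib intro!: ennreal_leI)
    finally have "ennreal (norm (?d n)) ^ 2 \<le> (\<integral>\<^sup>+\<omega>. ennreal \<bar>t * (X n \<omega> - Y \<omega>)\<bar> * 1 \<partial>M) ^ 2"
      by (rule power_mono) simp
    also have "\<dots> \<le> (\<integral>\<^sup>+\<omega>. ennreal \<bar>t * (X n \<omega> - Y \<omega>)\<bar> ^ 2 \<partial>M) * (\<integral>\<^sup>+\<omega>. 1 ^ 2 \<partial>M)"
      by (rule Cauchy_Schwarz_nn_integral) measurable
    also have "\<dots> = (\<integral>\<^sup>+\<omega>. ennreal (t\<^sup>2) * ennreal ((X n \<omega> - Y \<omega>)\<^sup>2) \<partial>M)"
      by (simp add: emeasure_space_1 ennreal_power power_mult_distrib ennreal_mult)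
    also have "\<dots> = ennreal (t\<^sup>2) * (\<integral>\<^sup>+\<omega>. ennreal ((X n \<omega> - Y \<omega>)\<^sup>2) \<partial>M)"
      by (rule nn_integral_cmult) measurable
    finally show ?thesis by (simp add: ennreal_power)
  qed
  have lim': "(\<lambda>n. ennreal (t\<^sup>2) * (\<integral>\<^sup>+\<omega>. ennreal ((X n \<omega> - Y \<omega>)\<^sup>2) \<partial>M)) \<longlonglongrightarrow> 0"
    using ennreal_tendsto_cmult[OF _ lim, of "ennreal (t\<^sup>2)"] by simp
  have "(\<lambda>n. ennreal ((norm (?d n))\<^sup>2)) \<longlonglongrightarrow> ennreal 0"
    unfolding ennreal_0
    by (rule tendsto_sandwich[OF _ _ tendsto_const lim']) (use bound in \<open>auto intro: always_eventually\<close>)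
  then have "(\<lambda>n. (norm (?d n))\<^sup>2) \<longlonglongrightarrow> 0"
    by (subst (asm) tendsto_ennreal_iff) auto
  from tendsto_real_sqrt[OF this] have "?d \<longlonglongrightarrow> 0" by (simp add: tendsto_norm_zero_iff)
  then show ?thesis by (rule LIM_zero_cancel)
qed

section \<open>Wiener integrals of step functions\<close>

context wiener_process
begin

abbreviation W :: "step \<Rightarrow> 'a \<Rightarrow> real" where
  "W \<phi> \<omega> \<equiv> step_integral \<phi> (\<lambda>t. w t \<omega>)"

lemma W_measurable [measurable]: "valid_step \<phi> \<Longrightarrow> W \<phi> \<in> borel_measurable M"
proof (induction \<phi>)
  case (Cons p \<phi>)
  obtain c a b where p: "p = (c, a, b)" by (cases p)
  then have "w a \<in> borel_measurable M" "w b \<in> borel_measurable M"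
    using Cons.prems by (auto intro!: measurable_w)
  then show ?case using Cons by (simp add: p)
qed simp

text \<open>The strict growth of a grid matters here: it gives every increment a positive variance,
  as \<open>gaussian_increments\<close> demands.\<close>

lemma grid_increments:
  assumes g: "grid \<tau> n"
  shows "indep_vars (\<lambda>_. borel) (\<lambda>i \<omega>. w (\<tau> (Suc i)) \<omega> - w (\<tau> i) \<omega>) {..<n}"
    and "i < n \<Longrightarrow> distributed M lborel (\<lambda>\<omega>. w (\<tau> (Suc i)) \<omega> - w (\<tau> i) \<omega>) (normal_density 0 (sqrt (\<tau> (Suc i) - \<tau> i)))"
proof -
  show "indep_vars (\<lambda>_. borel) (\<lambda>i \<omega>. w (\<tau> (Suc i)) \<omega> - w (\<tau> i) \<omega>) {..<n}"
    using g by (intro indep_increments) (auto simp: grid_def less_imp_le)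
  show "distributed M lborel (\<lambda>\<omega>. w (\<tau> (Suc i)) \<omega> - w (\<tau> i) \<omega>) (normal_density 0 (sqrt (\<tau> (Suc i) - \<tau> i)))" if "i < n"
    using grid_bounds[OF g, of i] grid_bounds[OF g, of "Suc i"] that g
    by (intro gaussian_increments) (auto simp: grid_def)
qed

lemma step_grid_exists:
  assumes \<phi>: "valid_step \<phi>" and J: "finite J" "J \<subseteq> {0..1}"
  obtains \<tau> n where "grid \<tau> n" "step_fits \<phi> (\<tau> ` {..n})" "J \<subseteq> \<tau> ` {..n}"
proof -
  obtain F where F: "finite F" "F \<subseteq> {0..1}" "step_fits \<phi> F"
    using finite_step_endpoints[OF \<phi>] by blast
  obtain \<tau> n where g: "grid \<tau> n" "F \<union> J \<subseteq> \<tau> ` {..n}"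
    using grid_exists[of "F \<union> J"] F J by auto
  then have "step_fits \<phi> (\<tau> ` {..n})" using F(3) by (auto intro: step_fits_mono)
  with g show ?thesis by (intro that) auto
qed

text \<open>On a grid fitted to \<open>\<phi>\<close> the integral is a combination of independent
  normal increments, whose variances add up to the squared norm.\<close>

lemma char_W:
  assumes \<phi>: "valid_step \<phi>"
  shows "char (distr M borel (W \<phi>)) t = complex_of_real (exp (- (t\<^sup>2 * L2sq (step_fun \<phi>)) / 2))"
proof -
  obtain \<tau> n where g: "grid \<tau> n" and fits: "step_fits \<phi> (\<tau> ` {..n})"
    using step_grid_exists[OF \<phi>, of "{}"] by auto
  define X where "X i \<omega> = w (\<tau> (Suc i)) \<omega> - w (\<tau> i) \<omega>" for i \<omega>
  let ?c = "\<lambda>i. step_fun \<phi> (\<tau> (Suc i))" and ?\<sigma> = "\<lambda>i. sqrt (\<tau> (Suc i) - \<tau> i)"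
  have X: "indep_vars (\<lambda>_. borel) X {..<n}"
    using grid_increments(1)[OF g] by (simp add: X_def[abs_def])
  have "indep_vars (\<lambda>_. borel) (\<lambda>i \<omega>. ?c i * X i \<omega>) {..<n}"
    by (rule indep_vars_compose2[OF X]) simp
  then have "char (distr M borel (\<lambda>\<omega>. \<Sum>i<n. ?c i * X i \<omega>)) t =
      (\<Prod>i<n. char (distr M borel (\<lambda>\<omega>. ?c i * X i \<omega>)) t)"
    by (rule char_distr_sum)
  also have "\<dots> = (\<Prod>i<n. complex_of_real (exp (- (t * ?c i * ?\<sigma> i)\<^sup>2 / 2)))"
  proof (rule prod.cong[OF refl])
    fix i assume i: "i \<in> {..<n}"
    have "distributed M lborel (X i) (normal_density 0 (?\<sigma> i))"
      using grid_increments(2)[OF g] i by (simp add: X_def[abs_def])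
    moreover have "0 < ?\<sigma> i" using g i by (simp add: grid_def)
    ultimately show "char (distr M borel (\<lambda>\<omega>. ?c i * X i \<omega>)) t = complex_of_real (exp (- (t * ?c i * ?\<sigma> i)\<^sup>2 / 2))"
      by (rule char_centered_normal)
  qed
  also have "\<dots> = complex_of_real (exp (\<Sum>i<n. - (t * ?c i * ?\<sigma> i)\<^sup>2 / 2))"
    by (simp add: exp_sum)
  also have "(\<Sum>i<n. - (t * ?c i * ?\<sigma> i)\<^sup>2 / 2) = (\<Sum>i<n. - (t\<^sup>2 * ((?c i)\<^sup>2 * (\<tau> (Suc i) - \<tau> i))) / 2)"
    using g by (intro sum.cong refl) (auto simp: power_mult_distrib grid_def less_imp_le mult.assoc)
  also have "\<dots> = - (t\<^sup>2 * L2sq (step_fun \<phi>)) / 2"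
    unfolding L2sq_step_grid[OF g \<phi> fits] by (simp add: sum_negf sum_distrib_left sum_divide_distrib)
  also have "(\<lambda>\<omega>. \<Sum>i<n. ?c i * X i \<omega>) = W \<phi>"
    using step_integral_grid[OF g \<phi> fits] by (auto simp: X_def)
  finally show ?thesis .
qed

text \<open>Ito isometry for step integrands, obtained from the normal law of the integral instead
  of from covariances. A zero norm, which admits no normalisation, makes all coefficients on the
  grid vanish.\<close>

lemma W_second_moment:
  assumes \<phi>: "valid_step \<phi>"
  shows "(\<integral>\<^sup>+\<omega>. ennreal ((W \<phi> \<omega>)\<^sup>2) \<partial>M) = ennreal (L2sq (step_fun \<phi>))"
proof (cases "0 < L2sq (step_fun \<phi>)")
  case True
  let ?v = "L2sq (step_fun \<phi>)"
  have "distr M borel (\<lambda>\<omega>. (W \<phi> \<omega> - 0) / sqrt ?v) = std_normal_distribution"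
    by (rule distr_std_normal_of_char[OF W_measurable[OF \<phi>] True]) (simp add: char_W[OF \<phi>])
  then have std: "distr M borel (\<lambda>\<omega>. W \<phi> \<omega> / sqrt ?v) = std_normal_distribution" by simp
  have "(\<integral>\<^sup>+\<omega>. ennreal ((W \<phi> \<omega>)\<^sup>2) \<partial>M) = (\<integral>\<^sup>+\<omega>. ennreal ?v * ennreal ((W \<phi> \<omega> / sqrt ?v)\<^sup>2) \<partial>M)"
    using True by (intro nn_integral_cong) (simp add: power_divide flip: ennreal_mult')
  also have "\<dots> = ennreal ?v * (\<integral>\<^sup>+\<omega>. ennreal ((W \<phi> \<omega> / sqrt ?v)\<^sup>2) \<partial>M)"
    using \<phi> by (intro nn_integral_cmult) measurable
  also have "(\<integral>\<^sup>+\<omega>. ennreal ((W \<phi> \<omega> / sqrt ?v)\<^sup>2) \<partial>M) = (\<integral>\<^sup>+z. ennreal (z\<^sup>2) \<partial>std_normal_distribution)"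
    unfolding std[symmetric] using \<phi> by (intro nn_integral_distr[symmetric]) measurable
  also have "\<dots> = ennreal (LINT z|std_normal_distribution. z\<^sup>2)"
    using integrable_std_normal_distribution_moment[of 2] by (intro nn_integral_eq_integral) auto
  also have "(LINT z|std_normal_distribution. z\<^sup>2) = 1"
    using std_normal_distribution_even_moments[of 1] by (simp add: fact_numeral)
  finally show ?thesis by simp
next
  case False
  then have 0: "L2sq (step_fun \<phi>) = 0" using L2sq_nonneg[of "step_fun \<phi>"] by linarith
  obtain \<tau> n where g: "grid \<tau> n" and fits: "step_fits \<phi> (\<tau> ` {..n})"
    using step_grid_exists[OF \<phi>, of "{}"] by auto
  have "\<forall>i\<in>{..<n}. (step_fun \<phi> (\<tau> (Suc i)))\<^sup>2 * (\<tau> (Suc i) - \<tau> i) = 0"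
    using 0 g unfolding L2sq_step_grid[OF g \<phi> fits]
    by (subst (asm) sum_nonneg_eq_0_iff) (auto simp: grid_def less_imp_le)
  then have "step_fun \<phi> (\<tau> (Suc i)) = 0" if "i < n" for i
    using g that by (force simp: grid_def)
  then have "W \<phi> \<omega> = 0" for \<omega>
    unfolding step_integral_grid[OF g \<phi> fits] by simp
  then show ?thesis by (simp add: 0)
qed

end

section \<open>Stochastic integrals against the observed path\<close>

lemma step_integral_path_measurable:
  "valid_step \<phi> \<Longrightarrow> step_integral \<phi> \<in> borel_measurable path_space"
proof (induction \<phi>)
  case (Cons p \<phi>)
  obtain c a b where p: "p = (c, a, b)" by (cases p)
  have "(\<lambda>y. y t) \<in> borel_measurable path_space" if "0 \<le> t" "t \<le> 1" for t
    unfolding path_space_def using that by (intro measurable_component_singleton) simp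
  then have "(\<lambda>y. y a) \<in> borel_measurable path_space" "(\<lambda>y. y b) \<in> borel_measurable path_space"
    using Cons.prems by (auto simp: p)
  moreover have "step_integral (p # \<phi>) = (\<lambda>y. c * (y b - y a) + step_integral \<phi> y)"
    by (auto simp: p)
  ultimately show ?case using Cons by (simp add: p)
qed (simp add: step_integral_def[abs_def])

lemma step_integral_restrict_affine:
  "valid_step \<phi> \<Longrightarrow> step_integral \<phi> (\<lambda>t\<in>{0..1}. A t + k * y t) = step_integral \<phi> A + k * step_integral \<phi> y"
  by (induction \<phi>) (auto simp: algebra_simps)

context wiener_process
begin

abbreviation law :: "(real \<Rightarrow> real \<Rightarrow> real) \<Rightarrow> real \<Rightarrow> real \<Rightarrow> (real \<Rightarrow> real) measure" where
  "law \<equiv> obs_law M w"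

lemma observed_path_eq: "observed_path w S e \<theta> \<omega> = (\<lambda>t\<in>{0..1}. drift (\<lambda>s. S s \<theta>) t + e * w t \<omega>)"
  by (simp add: observed_path_def drift_def)

lemma observed_path_measurable [measurable]: "observed_path w S e \<theta> \<in> measurable M path_space"
  unfolding observed_path_def[abs_def] path_space_def
  by (intro measurable_restrict borel_measurable_add borel_measurable_const borel_measurable_times measurable_w) auto

lemma prob_space_obs_law: "prob_space (law S e \<theta>)"
  unfolding obs_law_def by (rule prob_space_distr) measurable

lemma sets_obs_law [simp, measurable_cong]: "sets (law S e \<theta>) = sets path_space"
  by (simp add: obs_law_def)

lemma step_integral_observed:
  assumes "valid_step \<phi>" "L2_unit (\<lambda>t. S t \<theta>)"
  shows "step_integral \<phi> (observed_path w S e \<theta> \<omega>) = L2ip (step_fun \<phi>) (\<lambda>t. S t \<theta>) + e * W \<phi> \<omega>"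
  unfolding observed_path_eq step_integral_restrict_affine[OF assms(1)] step_integral_drift[OF assms] ..

lemma char_step_integral:
  assumes \<phi>: "valid_step \<phi>" and S: "L2_unit (\<lambda>t. S t \<theta>)"
  shows "char (distr (law S e \<theta>) borel (step_integral \<phi>)) t =
    iexp (t * L2ip (step_fun \<phi>) (\<lambda>t. S t \<theta>)) * complex_of_real (exp (- (t\<^sup>2 * (e\<^sup>2 * L2sq (step_fun \<phi>))) / 2))"
proof -
  let ?m = "L2ip (step_fun \<phi>) (\<lambda>t. S t \<theta>)"
  note [measurable] = step_integral_path_measurable[OF \<phi>] W_measurable[OF \<phi>]
  have "char (distr (law S e \<theta>) borel (step_integral \<phi>)) t =
      (CLINT y|law S e \<theta>. iexp (t * step_integral \<phi> y))"
    unfolding char_def by (rule integral_distr) auto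
  also have "\<dots> = (CLINT \<omega>|M. iexp (t * step_integral \<phi> (observed_path w S e \<theta> \<omega>)))"
    unfolding obs_law_def by (rule integral_distr) auto
  also have "\<dots> = (CLINT \<omega>|M. iexp (t * ?m) * iexp (t * e * W \<phi> \<omega>))"
    unfolding step_integral_observed[where S=S and \<theta>=\<theta> and e=e, OF \<phi> S] distrib_left[of t] iexp_add mult.assoc[of t e] ..
  also have "\<dots> = iexp (t * ?m) * (CLINT \<omega>|M. iexp (t * e * W \<phi> \<omega>))"
    by (rule integral_mult_right_zero)
  also have "(CLINT \<omega>|M. iexp (t * e * W \<phi> \<omega>)) = char (distr M borel (W \<phi>)) (t * e)"
    unfolding char_def by (rule integral_distr[symmetric]) auto
  finally show ?thesis by (simp add: char_W[OF \<phi>] power_mult_distrib mult.assoc)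
qed

text \<open>Means and variances of the step integrals converge, and mean-square convergence carries
  characteristic functions to the limit. Hence the law is the same for every version
  \<open>J\<close>, whatever sequence defines it.\<close>

lemma stoch_integral_std_normal:
  assumes e: "0 < e" and f: "L2_unit f" "0 < L2sq f" and S: "L2_unit (\<lambda>t. S t \<theta>)"
    and J: "stoch_integral (law S e \<theta>) f J"
  shows "distr (law S e \<theta>) borel (\<lambda>y. (J y - L2ip f (\<lambda>t. S t \<theta>)) / (e * sqrt (L2sq f))) = std_normal_distribution"
proof -
  interpret P: prob_space "law S e \<theta>" by (rule prob_space_obs_law)
  let ?m = "L2ip f (\<lambda>t. S t \<theta>)"
  obtain \<phi> where \<phi>: "\<And>n. valid_step (\<phi> n)"
    and lim: "(\<lambda>n. L2sq (\<lambda>t. step_fun (\<phi> n) t - f t)) \<longlonglongrightarrow> 0"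
    and ms: "(\<lambda>n. \<integral>\<^sup>+ y. ennreal ((step_integral (\<phi> n) y - J y)\<^sup>2) \<partial>law S e \<theta>) \<longlonglongrightarrow> 0"
    and J [measurable]: "J \<in> borel_measurable path_space"
    using J by (auto simp: stoch_integral_def)
  note [measurable] = step_integral_path_measurable[OF \<phi>]
  have "char (distr (law S e \<theta>) borel J) t =
      iexp (t * ?m) * complex_of_real (exp (- (t\<^sup>2 * (e\<^sup>2 * L2sq f)) / 2))" for t
  proof (rule LIMSEQ_unique)
    show "(\<lambda>n. char (distr (law S e \<theta>) borel (step_integral (\<phi> n))) t)
        \<longlonglongrightarrow> char (distr (law S e \<theta>) borel J) t"
      by (rule P.char_tendsto_of_mean_square[OF _ _ ms]) measurable
    show "(\<lambda>n. char (distr (law S e \<theta>) borel (step_integral (\<phi> n))) t)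
        \<longlonglongrightarrow> iexp (t * ?m) * complex_of_real (exp (- (t\<^sup>2 * (e\<^sup>2 * L2sq f)) / 2))"
      unfolding char_step_integral[where S=S and \<theta>=\<theta>, OF \<phi> S]
      by (intro tendsto_intros L2_tendsto[OF _ f(1) lim] L2_unit_step_fun S) auto
  qed
  then have "distr (law S e \<theta>) borel (\<lambda>y. (J y - ?m) / sqrt (e\<^sup>2 * L2sq f)) = std_normal_distribution"
    using e f by (intro P.distr_std_normal_of_char) auto
  then show ?thesis using e by (simp add: real_sqrt_mult)
qed

text \<open>The sum of the mean absolute increments of the sequence is finite, so the increments are
  almost surely absolutely summable.\<close>

lemma W_fast_convergent:
  assumes \<phi>: "\<And>n. valid_step (\<phi> n)" and f: "L2_unit f"
    and fast: "\<And>n. L2sq (\<lambda>t. step_fun (\<phi> n) t - f t) < (1/4) ^ n"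
  shows "AE \<omega> in M. convergent (\<lambda>n. W (\<phi> n) \<omega>)"
proof -
  note [measurable] = W_measurable[OF \<phi>]
  define \<Delta> where "\<Delta> n \<omega> = W (\<phi> (Suc n)) \<omega> - W (\<phi> n) \<omega>" for n \<omega>
  have [measurable]: "\<Delta> n \<in> borel_measurable M" for n unfolding \<Delta>_def by measurable
  have "(\<integral>\<^sup>+\<omega>. ennreal \<bar>\<Delta> n \<omega>\<bar> \<partial>M) \<le> ennreal (5 * (1/2) ^ n)" for n
  proof -
    let ?\<psi> = "step_diff (\<phi> (Suc n)) (\<phi> n)"
    have \<psi>: "valid_step ?\<psi>" using \<phi> by simp
    \<comment> \<open>Replaces Cauchy-Schwarz: with \<open>k = 2 ^ n\<close> the second moment, at
      most \<open>4 * (1/4) ^ n\<close>, and the term \<open>1 / k\<close> both contribute at the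
      order \<open>(1/2) ^ n\<close>.\<close>
    have le: "\<bar>a\<bar> \<le> k * a\<^sup>2 + 1 / k" if "0 < k" for a k :: real
    proof (cases "1 \<le> k * \<bar>a\<bar>")
      case True
      then have "\<bar>a\<bar> * 1 \<le> \<bar>a\<bar> * (k * \<bar>a\<bar>)" by (rule mult_left_mono) simp
      also have "\<dots> = k * a\<^sup>2" by (simp add: power2_eq_square)
      finally show ?thesis using that by (simp add: add_increasing2)
    next
      case False
      then have "\<bar>a\<bar> \<le> 1 / k" using that by (simp add: field_simps)
      then show ?thesis using that by (simp add: add_increasing)
    qed
    have "(\<integral>\<^sup>+\<omega>. ennreal \<bar>\<Delta> n \<omega>\<bar> \<partial>M) \<le> (\<integral>\<^sup>+\<omega>. ennreal (2 ^ n) * ennreal ((W ?\<psi> \<omega>)\<^sup>2) + ennreal ((1/2) ^ n) \<partial>M)"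
    proof (rule nn_integral_mono)
      fix \<omega>
      have "\<bar>\<Delta> n \<omega>\<bar> \<le> 2 ^ n * (W ?\<psi> \<omega>)\<^sup>2 + (1/2) ^ n"
        using le[of "2 ^ n" "\<Delta> n \<omega>"] by (simp add: \<Delta>_def power_one_over)
      then show "ennreal \<bar>\<Delta> n \<omega>\<bar> \<le> ennreal (2 ^ n) * ennreal ((W ?\<psi> \<omega>)\<^sup>2) + ennreal ((1/2) ^ n)"
        by (simp add: ennreal_leI del: ennreal_power ennreal_numeral flip: ennreal_mult ennreal_plus)
    qed
    also have "\<dots> = ennreal (2 ^ n) * ennreal (L2sq (step_fun ?\<psi>)) + ennreal ((1/2) ^ n)"
      using W_measurable[OF \<psi>]
      by (subst nn_integral_add)
         (auto simp: nn_integral_cmult W_second_moment[OF \<psi>] emeasure_space_1 simp del: step_diff_simps)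
    also have "\<dots> = ennreal (2 ^ n * L2sq (step_fun ?\<psi>) + (1/2) ^ n)"
      by (simp add: L2sq_nonneg del: step_diff_simps ennreal_power ennreal_numeral flip: ennreal_mult ennreal_plus)
    also have "\<dots> \<le> ennreal (5 * (1/2) ^ n)"
    proof (rule ennreal_leI)
      have "L2sq (step_fun ?\<psi>) \<le> 2 * L2sq (\<lambda>t. step_fun (\<phi> (Suc n)) t - f t) + 2 * L2sq (\<lambda>t. f t - step_fun (\<phi> n) t)"
        using L2sq_triangle[OF L2_unit_step_fun f L2_unit_step_fun] by simp
      also have "\<dots> \<le> 2 * (1/4) ^ Suc n + 2 * (1/4) ^ n"
        using fast[of n] fast[of "Suc n"] by (simp add: power2_commute[of "f _"])
      also have "\<dots> \<le> 4 * (1/4) ^ n" by simp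
      finally have "2 ^ n * L2sq (step_fun ?\<psi>) \<le> 2 ^ n * (4 * (1/4) ^ n)"
        by (rule mult_left_mono) simp
      also have "\<dots> = 4 * (1/2) ^ n"
        by (simp add: power_mult_distrib[symmetric] del: power_mult_distrib)
      finally show "2 ^ n * L2sq (step_fun ?\<psi>) + (1/2) ^ n \<le> 5 * (1/2) ^ n" by simp
    qed
    finally show ?thesis .
  qed
  then have "(\<Sum>n. \<integral>\<^sup>+\<omega>. ennreal \<bar>\<Delta> n \<omega>\<bar> \<partial>M) \<le> (\<Sum>n. ennreal (5 * (1/2) ^ n))"
    by (intro suminf_le) auto
  also have "\<dots> < \<infinity>"
    by (subst suminf_ennreal2) (auto intro!: summable_mult summable_geometric)
  finally have "(\<integral>\<^sup>+\<omega>. (\<Sum>n. ennreal \<bar>\<Delta> n \<omega>\<bar>) \<partial>M) \<noteq> \<infinity>"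
    by (subst nn_integral_suminf) auto
  then have "AE \<omega> in M. (\<Sum>n. ennreal \<bar>\<Delta> n \<omega>\<bar>) \<noteq> \<infinity>"
    by (intro nn_integral_PInf_AE) auto
  then show ?thesis
  proof eventually_elim
    case (elim \<omega>)
    then have "summable (\<lambda>n. \<bar>\<Delta> n \<omega>\<bar>)"
      by (intro summable_suminf_not_top) auto
    then have "summable (\<lambda>n. \<Delta> n \<omega>)" by (rule summable_rabs_cancel)
    then have "convergent (\<lambda>n. \<Sum>i<n. \<Delta> i \<omega>)" by (simp add: summable_iff_convergent)
    then have "convergent (\<lambda>n. W (\<phi> n) \<omega> - W (\<phi> 0) \<omega>)"
      unfolding \<Delta>_def sum_lessThan_telescope[of "\<lambda>n. W (\<phi> n) \<omega>"] .
    then show ?case by (simp add: convergent_diff_const_right_iff)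
  qed
qed

text \<open>\<open>J\<close> is built from the sequence \<open>\<phi>\<close> alone, with no
  reference to the parameter or the noise level, so one functional is a version of the integral
  under all these laws at once. The arbitrary value of \<open>lim\<close> on paths without
  convergence concerns a null set.\<close>

lemma stoch_integral_fast:
  fixes J :: "(real \<Rightarrow> real) \<Rightarrow> real"
  assumes \<phi>: "\<And>n. valid_step (\<phi> n)" and f: "L2_unit f"
    and fast: "\<And>n. L2sq (\<lambda>t. step_fun (\<phi> n) t - f t) < (1/4) ^ n"
    and S: "L2_unit (\<lambda>t. S t \<theta>)"
  defines "J \<equiv> \<lambda>y. lim (\<lambda>n. step_integral (\<phi> n) y)"
  shows "AE \<omega> in M. (\<lambda>n. step_integral (\<phi> n) (observed_path w S e \<theta> \<omega>)) \<longlonglongrightarrow> J (observed_path w S e \<theta> \<omega>)"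
    and "stoch_integral (law S e \<theta>) f J"
proof -
  let ?Y = "observed_path w S e \<theta>" and ?I = "\<lambda>n \<omega>. step_integral (\<phi> n) (observed_path w S e \<theta> \<omega>)"
  note [measurable] = W_measurable[OF \<phi>] step_integral_path_measurable[OF \<phi>]
  have J [measurable]: "J \<in> borel_measurable path_space" unfolding J_def by measurable
  note lim = L2sq_fast_tendsto[of \<phi>, OF fast]
  have ip: "(\<lambda>n. L2ip (step_fun (\<phi> n)) (\<lambda>t. S t \<theta>)) \<longlonglongrightarrow> L2ip f (\<lambda>t. S t \<theta>)"
    by (rule L2_tendsto(1)[OF _ f lim S]) simp
  show AE_lim: "AE \<omega> in M. (\<lambda>n. ?I n \<omega>) \<longlonglongrightarrow> J (?Y \<omega>)"
    using W_fast_convergent[OF \<phi> f fast]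
  proof eventually_elim
    case (elim \<omega>)
    then obtain v where "(\<lambda>n. W (\<phi> n) \<omega>) \<longlonglongrightarrow> v" by (auto simp: convergent_def)
    then have "(\<lambda>n. ?I n \<omega>) \<longlonglongrightarrow> L2ip f (\<lambda>t. S t \<theta>) + e * v"
      unfolding step_integral_observed[where S=S and \<theta>=\<theta>, OF \<phi> S] by (intro tendsto_intros ip)
    then show ?case unfolding J_def by (simp add: limI)
  qed
  \<comment> \<open>The difference of two step integrals has a drift part, bounded by
    Cauchy-Schwarz, and a noise part, given by the isometry. \<open>C\<close> collects their factors
    in front of the squared distance of the integrands.\<close>
  define C where "C = 2 * L2sq (\<lambda>t. S t \<theta>) + 2 * e\<^sup>2"
  have C: "0 \<le> C" by (auto simp: C_def L2sq_nonneg intro!: add_nonneg_nonneg)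
  have bound: "(\<integral>\<^sup>+\<omega>. ennreal ((?I n \<omega> - ?I m \<omega>)\<^sup>2) \<partial>M) \<le> ennreal (4 * C * (1/4) ^ n)" if "n \<le> m" for n m
  proof -
    let ?\<psi> = "step_diff (\<phi> n) (\<phi> m)"
    let ?q = "L2sq (step_fun ?\<psi>)" and ?ip = "L2ip (step_fun ?\<psi>) (\<lambda>t. S t \<theta>)"
    have \<psi>: "valid_step ?\<psi>" using \<phi> by simp
    have "?q \<le> 2 * L2sq (\<lambda>t. step_fun (\<phi> n) t - f t) + 2 * L2sq (\<lambda>t. f t - step_fun (\<phi> m) t)"
      using L2sq_triangle[OF L2_unit_step_fun f L2_unit_step_fun] by simp
    also have "\<dots> \<le> 2 * (1/4) ^ n + 2 * (1/4) ^ m"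
      using fast[of n] fast[of m] by (simp add: power2_commute[of "f _"])
    also have "\<dots> \<le> 4 * (1/4) ^ n" using power_decreasing[OF that, of "1/4::real"] by simp
    finally have q: "?q \<le> 4 * (1/4) ^ n" .
    have ip: "?ip\<^sup>2 \<le> ?q * L2sq (\<lambda>t. S t \<theta>)"
      by (rule L2_cauchy_schwarz[OF L2_unit_step_fun S])
    have "(\<integral>\<^sup>+\<omega>. ennreal ((?I n \<omega> - ?I m \<omega>)\<^sup>2) \<partial>M) \<le> (\<integral>\<^sup>+\<omega>. ennreal (2 * ?ip\<^sup>2) + ennreal (2 * e\<^sup>2) * ennreal ((W ?\<psi> \<omega>)\<^sup>2) \<partial>M)"
    proof (rule nn_integral_mono)
      fix \<omega>
      have I: "?I n \<omega> - ?I m \<omega> = ?ip + e * W ?\<psi> \<omega>"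
        using step_integral_observed[where S=S and \<theta>=\<theta> and e=e and \<omega>=\<omega>, OF \<psi> S] by simp
      have "(a + b)\<^sup>2 \<le> 2 * a\<^sup>2 + 2 * b\<^sup>2" for a b :: real
        using sum_squares_bound[of a b] power2_sum[of a b] by simp
      from this[of ?ip "e * W ?\<psi> \<omega>"]
      have "(?I n \<omega> - ?I m \<omega>)\<^sup>2 \<le> 2 * ?ip\<^sup>2 + 2 * e\<^sup>2 * (W ?\<psi> \<omega>)\<^sup>2"
        unfolding I power_mult_distrib mult.assoc .
      then show "ennreal ((?I n \<omega> - ?I m \<omega>)\<^sup>2) \<le> ennreal (2 * ?ip\<^sup>2) + ennreal (2 * e\<^sup>2) * ennreal ((W ?\<psi> \<omega>)\<^sup>2)"
        by (simp add: ennreal_leI del: step_diff_simps flip: ennreal_mult ennreal_plus)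
    qed
    also have "\<dots> = ennreal (2 * ?ip\<^sup>2) + ennreal (2 * e\<^sup>2) * ennreal ?q"
      using \<psi> W_measurable[OF \<psi>]
      by (subst nn_integral_add)
         (auto simp: nn_integral_cmult W_second_moment[OF \<psi>] emeasure_space_1 simp del: step_diff_simps)
    also have "\<dots> = ennreal (2 * ?ip\<^sup>2 + 2 * e\<^sup>2 * ?q)"
      by (simp add: L2sq_nonneg del: step_diff_simps flip: ennreal_mult ennreal_plus)
    also have "\<dots> \<le> ennreal (4 * C * (1/4) ^ n)"
    proof (rule ennreal_leI)
      have "2 * ?ip\<^sup>2 + 2 * e\<^sup>2 * ?q \<le> 2 * (?q * L2sq (\<lambda>t. S t \<theta>)) + 2 * e\<^sup>2 * ?q"
        using ip by linarith
      also have "\<dots> = C * ?q" unfolding C_def by (simp only: ring_distribs mult_ac)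
      also have "\<dots> \<le> C * (4 * (1/4) ^ n)" by (rule mult_left_mono[OF q C])
      finally show "2 * ?ip\<^sup>2 + 2 * e\<^sup>2 * ?q \<le> 4 * C * (1/4) ^ n" by (simp only: mult_ac)
    qed
    finally show ?thesis .
  qed
  have ms: "(\<integral>\<^sup>+y. ennreal ((step_integral (\<phi> n) y - J y)\<^sup>2) \<partial>law S e \<theta>) \<le> ennreal (4 * C * (1/4) ^ n)" for n
  proof -
    have "(\<integral>\<^sup>+y. ennreal ((step_integral (\<phi> n) y - J y)\<^sup>2) \<partial>law S e \<theta>) =
        (\<integral>\<^sup>+\<omega>. ennreal ((?I n \<omega> - J (?Y \<omega>))\<^sup>2) \<partial>M)"
      unfolding obs_law_def by (rule nn_integral_distr) measurable
    \<comment> \<open>Fatou's lemma in \<open>m\<close> turns the Cauchy estimate into an estimate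
      for the limit.\<close>
    also have "\<dots> = (\<integral>\<^sup>+\<omega>. liminf (\<lambda>m. ennreal ((?I n \<omega> - ?I m \<omega>)\<^sup>2)) \<partial>M)"
    proof (rule nn_integral_cong_AE)
      show "AE \<omega> in M. ennreal ((?I n \<omega> - J (?Y \<omega>))\<^sup>2) = liminf (\<lambda>m. ennreal ((?I n \<omega> - ?I m \<omega>)\<^sup>2))"
        using AE_lim
      proof eventually_elim
        case (elim \<omega>)
        have "(\<lambda>m. ennreal ((?I n \<omega> - ?I m \<omega>)\<^sup>2)) \<longlonglongrightarrow> ennreal ((?I n \<omega> - J (?Y \<omega>))\<^sup>2)"
          by (intro tendsto_ennrealI tendsto_power tendsto_diff tendsto_const elim)
        then show ?case by (rule lim_imp_Liminf[OF sequentially_bot, symmetric])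
      qed
    qed
    also have "\<dots> \<le> liminf (\<lambda>m. \<integral>\<^sup>+\<omega>. ennreal ((?I n \<omega> - ?I m \<omega>)\<^sup>2) \<partial>M)"
      by (rule nn_integral_liminf) measurable
    also have "\<dots> \<le> limsup (\<lambda>m. \<integral>\<^sup>+\<omega>. ennreal ((?I n \<omega> - ?I m \<omega>)\<^sup>2) \<partial>M)"
      by (rule Liminf_le_Limsup) simp
    also have "\<dots> \<le> ennreal (4 * C * (1/4) ^ n)"
      by (rule Limsup_bounded) (use bound in \<open>auto simp: eventually_sequentially\<close>)
    finally show ?thesis .
  qed
  have "(\<lambda>n. ennreal (4 * C * (1/4) ^ n)) \<longlonglongrightarrow> ennreal (4 * C * 0)"
    by (intro tendsto_ennrealI tendsto_mult tendsto_const LIMSEQ_power_zero) simp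
  then have lim0: "(\<lambda>n. ennreal (4 * C * (1/4) ^ n)) \<longlonglongrightarrow> 0" by simp
  have "(\<lambda>n. \<integral>\<^sup>+y. ennreal ((step_integral (\<phi> n) y - J y)\<^sup>2) \<partial>law S e \<theta>) \<longlonglongrightarrow> 0"
    by (rule tendsto_sandwich[OF _ _ tendsto_const lim0]) (use ms in auto)
  then show "stoch_integral (law S e \<theta>) f J"
    unfolding stoch_integral_def using J lim \<phi> by blast
qed

end

subsection \<open>The likelihood ratio on path space\<close>

lemma normal_density_tilt:
  assumes "0 < \<sigma>"
  shows "normal_density 0 \<sigma> x * exp (c * x - c\<^sup>2 * \<sigma>\<^sup>2 / 2) = normal_density (c * \<sigma>\<^sup>2) \<sigma> x"
proof -
  have "- (x - 0)\<^sup>2 / (2 * \<sigma>\<^sup>2) + (c * x - c\<^sup>2 * \<sigma>\<^sup>2 / 2) = - (x - c * \<sigma>\<^sup>2)\<^sup>2 / (2 * \<sigma>\<^sup>2)"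
    using assms by (simp add: field_simps power2_eq_square)
  then show ?thesis unfolding normal_density_def by (simp add: mult.assoc flip: exp_add)
qed

text \<open>The two measures are compared on measurable rectangles, where the integral
  factorises.\<close>

lemma PiM_density:
  fixes N :: "'i \<Rightarrow> real measure" and f :: "'i \<Rightarrow> real \<Rightarrow> real"
  assumes I: "finite I" and N: "\<And>i. prob_space (N i)" "\<And>i. sets (N i) = sets borel"
    and f: "\<And>i. f i \<in> borel_measurable borel" "\<And>i x. 0 \<le> f i x"
    and D: "\<And>i. prob_space (density (N i) (f i))"
  shows "PiM I (\<lambda>i. density (N i) (f i)) = density (PiM I N) (\<lambda>x. ennreal (\<Prod>i\<in>I. f i (x i)))"
proof (rule sym, rule product_sigma_finite.PiM_eqI)
  interpret N: product_prob_space N by (simp add: product_prob_spaceI N)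
  show "product_sigma_finite (\<lambda>i. density (N i) (f i))"
    using D by (simp add: product_sigma_finite_def prob_space_imp_sigma_finite)
  show "sets (density (PiM I N) (\<lambda>x. ennreal (\<Prod>i\<in>I. f i (x i)))) = sets (PiM I (\<lambda>i. density (N i) (f i)))"
    by (simp cong: sets_PiM_cong)
  have [measurable]: "f i \<in> borel_measurable (N i)" for i
    using f(1)[of i] N(2)[of i] by (simp cong: measurable_cong_sets)
  fix A assume A: "\<And>i. i \<in> I \<Longrightarrow> A i \<in> sets (density (N i) (f i))"
  then have A' [measurable]: "\<And>i. i \<in> I \<Longrightarrow> A i \<in> sets (N i)" by simp
  have "emeasure (density (PiM I N) (\<lambda>x. ennreal (\<Prod>i\<in>I. f i (x i)))) (Pi\<^sub>E I A) =
      (\<integral>\<^sup>+x. ennreal (\<Prod>i\<in>I. f i (x i)) * indicator (Pi\<^sub>E I A) x \<partial>PiM I N)"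
    using I A' by (intro emeasure_density) (auto intro!: sets_PiM_I_finite)
  also have "\<dots> = (\<integral>\<^sup>+x. (\<Prod>i\<in>I. ennreal (f i (x i)) * indicator (A i) (x i)) \<partial>PiM I N)"
  proof (rule nn_integral_cong)
    fix x assume "x \<in> space (PiM I N)"
    then have "indicator (Pi\<^sub>E I A) x = (\<Prod>i\<in>I. indicator (A i) (x i) :: ennreal)"
      using I by (auto simp: indicator_def space_PiM PiE_iff)
    then show "ennreal (\<Prod>i\<in>I. f i (x i)) * indicator (Pi\<^sub>E I A) x = (\<Prod>i\<in>I. ennreal (f i (x i)) * indicator (A i) (x i))"
      by (simp add: prod.distrib prod_ennreal f)
  qed
  also have "\<dots> = (\<Prod>i\<in>I. \<integral>\<^sup>+x. ennreal (f i x) * indicator (A i) x \<partial>N i)"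
    by (rule N.product_nn_integral_prod[OF I]) measurable
  also have "\<dots> = (\<Prod>i\<in>I. emeasure (density (N i) (f i)) (A i))"
    by (rule prod.cong[OF refl], rule emeasure_density[symmetric]) measurable
  finally show "emeasure (density (PiM I N) (\<lambda>x. ennreal (\<Prod>i\<in>I. f i (x i)))) (Pi\<^sub>E I A) =
      (\<Prod>i\<in>I. emeasure (density (N i) (f i)) (A i))" .
qed (rule I)

lemma (in prob_space) distr_normal_shift:
  assumes X: "distributed M lborel X (normal_density 0 \<sigma>)" and \<sigma>: "0 < \<sigma>"
  shows "distr M borel (\<lambda>\<omega>. X \<omega> + c * \<sigma>\<^sup>2) = density (distr M borel X) (\<lambda>x. ennreal (exp (c * x - c\<^sup>2 * \<sigma>\<^sup>2 / 2)))"
proof -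
  have lb: "distr M borel Y = distr M lborel Y" for Y :: "'a \<Rightarrow> real"
    by (rule distr_cong) auto
  have "distributed M lborel (\<lambda>\<omega>. c * \<sigma>\<^sup>2 + 1 * X \<omega>) (normal_density (c * \<sigma>\<^sup>2 + 1 * 0) (\<bar>1\<bar> * \<sigma>))"
    by (rule normal_density_affine[OF X \<sigma>]) simp
  then have "distributed M lborel (\<lambda>\<omega>. X \<omega> + c * \<sigma>\<^sup>2) (normal_density (c * \<sigma>\<^sup>2) \<sigma>)"
    by (simp add: add.commute)
  then have "distr M borel (\<lambda>\<omega>. X \<omega> + c * \<sigma>\<^sup>2) = density lborel (normal_density (c * \<sigma>\<^sup>2) \<sigma>)"
    unfolding lb by (rule distributed_distr_eq_density)
  also have "\<dots> = density (density lborel (normal_density 0 \<sigma>)) (\<lambda>x. ennreal (exp (c * x - c\<^sup>2 * \<sigma>\<^sup>2 / 2)))"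
    by (subst density_density_eq) (auto simp: normal_density_tilt[OF \<sigma>, symmetric] ennreal_mult)
  also have "density lborel (normal_density 0 \<sigma>) = distr M borel X"
    unfolding lb by (rule distributed_distr_eq_density[OF X, symmetric])
  finally show ?thesis .
qed

context wiener_process
begin

lemma grid_telescope:
  fixes y :: "real \<Rightarrow> real"
  assumes g: "grid \<tau> n" and t: "t \<in> \<tau> ` {..n}"
  shows "(\<Sum>i<n. if \<tau> (Suc i) \<le> t then y (\<tau> (Suc i)) - y (\<tau> i) else 0) = y t - y 0"
proof -
  obtain k where k: "t = \<tau> k" "k \<le> n" using t by auto
  have "(\<Sum>i<n. if \<tau> (Suc i) \<le> t then y (\<tau> (Suc i)) - y (\<tau> i) else 0) =
     (\<Sum>i<n. if i \<in> {..<k} then y (\<tau> (Suc i)) - y (\<tau> i) else 0)"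
    using k grid_le_iff[OF g, of "Suc _" k] by (intro sum.cong refl) (auto simp: Suc_le_eq)
  also have "\<dots> = (\<Sum>i<k. y (\<tau> (Suc i)) - y (\<tau> i))"
    using k by (subst sum.inter_restrict[symmetric]) (auto intro!: sum.cong)
  also have "\<dots> = y t - y 0"
    using g sum_lessThan_telescope[of "\<lambda>i. y (\<tau> i)" k] by (simp add: k grid_def)
  finally show ?thesis .
qed

text \<open>
  For step functions the Girsanov formula reduces, via independence of the increments over a common
  grid, to the tilting of one-dimensional normal densities.
\<close>

lemma girsanov_step:
  assumes \<phi>: "valid_step \<phi>" and J: "finite J" "J \<subseteq> {0..1}"
  shows "(\<integral>\<^sup>+\<omega>. ennreal (exp (W \<phi> \<omega> - L2sq (step_fun \<phi>) / 2)) * indicator {\<omega>\<in>space M. \<forall>t\<in>J. w t \<omega> \<le> b t} \<omega> \<partial>M) =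
    emeasure M {\<omega>\<in>space M. \<forall>t\<in>J. w t \<omega> + drift (step_fun \<phi>) t \<le> b t}"
proof -
  obtain \<tau> n where g: "grid \<tau> n" and fits: "step_fits \<phi> (\<tau> ` {..n})" and J\<tau>: "J \<subseteq> \<tau> ` {..n}"
    using step_grid_exists[OF \<phi> J] by blast
  have n: "{..<n} \<noteq> {}" using g by (cases n) (auto simp: grid_def)
  \<comment> \<open>Outside \<open>{..<n}\<close> variables and coefficients are set to zero, since
    \<open>PiM_density\<close> asks for a probability measure at every index.\<close>
  define X where "X i \<omega> = (if i < n then w (\<tau> (Suc i)) \<omega> - w (\<tau> i) \<omega> else 0)" for i \<omega>
  define c where "c i = (if i < n then step_fun \<phi> (\<tau> (Suc i)) else 0)" for i
  define \<sigma> where "\<sigma> i = sqrt (\<tau> (Suc i) - \<tau> i)" for i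
  define f where "f i x = exp (c i * x - (c i)\<^sup>2 * (\<sigma> i)\<^sup>2 / 2)" for i x
  \<comment> \<open>The shift is the increment of the drift over the cell, so for
    \<open>i < n\<close> the variables \<open>X' i\<close> are the increments of the path with
    drift.\<close>
  define X' where "X' i \<omega> = X i \<omega> + c i * (\<sigma> i)\<^sup>2" for i \<omega>
  let ?N = "\<lambda>i. distr M borel (X i)" and ?B = "PiM {..<n} (\<lambda>_. borel :: real measure)"
  have Xn: "distributed M lborel (X i) (normal_density 0 (\<sigma> i))" "0 < \<sigma> i" "(\<sigma> i)\<^sup>2 = \<tau> (Suc i) - \<tau> i" if "i < n" for i
    using grid_increments(2)[OF g that] that g
    by (auto simp: X_def[abs_def] \<sigma>_def grid_def less_imp_le)
  have Xm [measurable]: "X i \<in> borel_measurable M" for i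
    using distributed_measurable[OF Xn(1)[of i]] by (cases "i < n") (auto simp: X_def[abs_def])
  have X'm [measurable]: "X' i \<in> borel_measurable M" for i
    unfolding X'_def[abs_def] by measurable
  have indX: "indep_vars (\<lambda>_. borel) X {..<n}"
    using grid_increments(1)[OF g] by (subst indep_vars_cong[OF refl _ refl]) (auto simp: X_def fun_eq_iff)
  have indX': "indep_vars (\<lambda>_. borel) X' {..<n}"
    unfolding X'_def[abs_def] by (rule indep_vars_compose2[OF indX]) simp
  have X'_distr: "distr M borel (X' i) = density (?N i) (\<lambda>x. ennreal (f i x))" for i
  proof (cases "i < n")
    case True
    then show ?thesis unfolding X'_def[abs_def] f_def using Xn by (intro distr_normal_shift) auto
  next
    case False
    then have "X' i = X i" "f i = (\<lambda>_. 1)" by (auto simp: X'_def f_def c_def)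
    then show ?thesis by (simp add: density_1)
  qed
  have "distr M ?B (\<lambda>\<omega>. \<lambda>i\<in>{..<n}. X' i \<omega>) = PiM {..<n} (\<lambda>i. distr M borel (X' i))"
    using indep_vars_iff_distr_eq_PiM[OF n X'm] indX' by simp
  also have "\<dots> = density (PiM {..<n} ?N) (\<lambda>x. ennreal (\<Prod>i<n. f i (x i)))"
    unfolding X'_distr
  proof (rule PiM_density)
    show "prob_space (density (?N i) (\<lambda>x. ennreal (f i x)))" for i
      unfolding X'_distr[symmetric] by (rule prob_space_distr) measurable
    show "prob_space (?N i)" for i by (rule prob_space_distr) measurable
  qed (auto simp: f_def[abs_def])
  also have "PiM {..<n} ?N = distr M ?B (\<lambda>\<omega>. \<lambda>i\<in>{..<n}. X i \<omega>)"
    using indep_vars_iff_distr_eq_PiM[OF n Xm] indX by simp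
  finally have key: "distr M ?B (\<lambda>\<omega>. \<lambda>i\<in>{..<n}. X' i \<omega>) =
     density (distr M ?B (\<lambda>\<omega>. \<lambda>i\<in>{..<n}. X i \<omega>)) (\<lambda>x. ennreal (\<Prod>i<n. f i (x i)))" .
  \<comment> \<open>Path values are expressed as partial sums of increments, so that one event
    \<open>A\<close> describes both the original and the shifted path. This needs
    \<open>w 0 \<omega> = 0\<close>, which holds almost surely.\<close>
  define A where "A = {x\<in>space ?B. \<forall>t\<in>J. (\<Sum>i<n. if \<tau> (Suc i) \<le> t then x i else 0) \<le> b t}"
  have A [measurable]: "A \<in> sets ?B" unfolding A_def using J(1) by measurable
  have X_sum: "(\<Sum>i<n. if \<tau> (Suc i) \<le> t then X i \<omega> else 0) = w t \<omega>" if "w 0 \<omega> = 0" "t \<in> J" for t \<omega>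
    using grid_telescope[OF g, of t "\<lambda>t. w t \<omega>"] that J\<tau> by (auto simp: X_def cong: if_cong)
  have c_sum: "(\<Sum>i<n. if \<tau> (Suc i) \<le> t then c i * (\<sigma> i)\<^sup>2 else 0) = drift (step_fun \<phi>) t" if "t \<in> J" for t
  proof -
    have "c i * (\<sigma> i)\<^sup>2 = drift (step_fun \<phi>) (\<tau> (Suc i)) - drift (step_fun \<phi>) (\<tau> i)" if "i < n" for i
      using drift_step_fun_grid[OF g that fits] Xn(3)[OF that] that by (simp add: c_def)
    then have "(\<Sum>i<n. if \<tau> (Suc i) \<le> t then c i * (\<sigma> i)\<^sup>2 else 0) =
        (\<Sum>i<n. if \<tau> (Suc i) \<le> t then drift (step_fun \<phi>) (\<tau> (Suc i)) - drift (step_fun \<phi>) (\<tau> i) else 0)"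
      by (intro sum.cong) auto
    also have "\<dots> = drift (step_fun \<phi>) t - drift (step_fun \<phi>) 0"
      using J\<tau> that by (intro grid_telescope[OF g]) auto
    finally show ?thesis by (simp add: drift_def)
  qed
  have A_X: "(\<lambda>i\<in>{..<n}. X i \<omega>) \<in> A \<longleftrightarrow> (\<forall>t\<in>J. w t \<omega> \<le> b t)" if "w 0 \<omega> = 0" for \<omega>
    using X_sum[OF that] by (auto simp: A_def space_PiM cong: if_cong)
  have A_X': "(\<lambda>i\<in>{..<n}. X' i \<omega>) \<in> A \<longleftrightarrow> (\<forall>t\<in>J. w t \<omega> + drift (step_fun \<phi>) t \<le> b t)" if "w 0 \<omega> = 0" for \<omega>
  proof -
    have "(\<Sum>i<n. if \<tau> (Suc i) \<le> t then X' i \<omega> else 0) = w t \<omega> + drift (step_fun \<phi>) t" if "t \<in> J" for t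
    proof -
      have "(\<Sum>i<n. if \<tau> (Suc i) \<le> t then X' i \<omega> else 0) =
        (\<Sum>i<n. (if \<tau> (Suc i) \<le> t then X i \<omega> else 0) + (if \<tau> (Suc i) \<le> t then c i * (\<sigma> i)\<^sup>2 else 0))"
        by (rule sum.cong) (auto simp: X'_def)
      then show ?thesis
        using X_sum[OF \<open>w 0 \<omega> = 0\<close> that] c_sum[OF that] by (simp add: sum.distrib)
    qed
    then show ?thesis by (auto simp: A_def space_PiM cong: if_cong)
  qed
  have prod_f: "(\<Prod>i<n. f i (X i \<omega>)) = exp (W \<phi> \<omega> - L2sq (step_fun \<phi>) / 2)" for \<omega>
  proof -
    have "(\<Prod>i<n. f i (X i \<omega>)) = exp (\<Sum>i<n. c i * X i \<omega> - (c i)\<^sup>2 * (\<sigma> i)\<^sup>2 / 2)"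
      by (simp add: f_def exp_sum)
    also have "(\<Sum>i<n. c i * X i \<omega> - (c i)\<^sup>2 * (\<sigma> i)\<^sup>2 / 2) = W \<phi> \<omega> - L2sq (step_fun \<phi>) / 2"
      unfolding step_integral_grid[OF g \<phi> fits] L2sq_step_grid[OF g \<phi> fits] sum_divide_distrib sum_subtractf[symmetric]
      by (rule sum.cong) (auto simp: c_def X_def Xn(3))
    finally show ?thesis .
  qed
  have w0: "AE \<omega> in M. w 0 \<omega> = 0" by (rule start_zero)
  have wm [measurable]: "w t \<in> borel_measurable M" if "t \<in> J" for t
    using that J(2) by (auto intro!: measurable_w)
  have "(\<integral>\<^sup>+\<omega>. ennreal (exp (W \<phi> \<omega> - L2sq (step_fun \<phi>) / 2)) * indicator {\<omega>\<in>space M. \<forall>t\<in>J. w t \<omega> \<le> b t} \<omega> \<partial>M) =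
      (\<integral>\<^sup>+\<omega>. ennreal (\<Prod>i<n. f i ((\<lambda>i\<in>{..<n}. X i \<omega>) i)) * indicator A (\<lambda>i\<in>{..<n}. X i \<omega>) \<partial>M)"
  proof (rule nn_integral_cong_AE)
    show "AE \<omega> in M. ennreal (exp (W \<phi> \<omega> - L2sq (step_fun \<phi>) / 2)) * indicator {\<omega>\<in>space M. \<forall>t\<in>J. w t \<omega> \<le> b t} \<omega> =
       ennreal (\<Prod>i<n. f i ((\<lambda>i\<in>{..<n}. X i \<omega>) i)) * indicator A (\<lambda>i\<in>{..<n}. X i \<omega>)"
      using w0 AE_space
    proof eventually_elim
      case (elim \<omega>)
      then show ?case using A_X[of \<omega>] prod_f[of \<omega>] by (simp add: indicator_def)
    qed
  qed
  also have "\<dots> = (\<integral>\<^sup>+x. ennreal (\<Prod>i<n. f i (x i)) * indicator A x \<partial>distr M ?B (\<lambda>\<omega>. \<lambda>i\<in>{..<n}. X i \<omega>))"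
    unfolding f_def by (rule nn_integral_distr[symmetric]) measurable
  also have "\<dots> = emeasure (density (distr M ?B (\<lambda>\<omega>. \<lambda>i\<in>{..<n}. X i \<omega>)) (\<lambda>x. ennreal (\<Prod>i<n. f i (x i)))) A"
    unfolding f_def by (rule emeasure_density[symmetric]) measurable
  also have "\<dots> = emeasure M ((\<lambda>\<omega>. \<lambda>i\<in>{..<n}. X' i \<omega>) -` A \<inter> space M)"
    unfolding key[symmetric] by (rule emeasure_distr) measurable
  also have "\<dots> = emeasure M {\<omega>\<in>space M. \<forall>t\<in>J. w t \<omega> + drift (step_fun \<phi>) t \<le> b t}"
  proof (rule emeasure_eq_AE)
    show "AE \<omega> in M. \<omega> \<in> (\<lambda>\<omega>. \<lambda>i\<in>{..<n}. X' i \<omega>) -` A \<inter> space M \<longleftrightarrow>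
        \<omega> \<in> {\<omega>\<in>space M. \<forall>t\<in>J. w t \<omega> + drift (step_fun \<phi>) t \<le> b t}"
      using w0
    proof eventually_elim
      case (elim \<omega>)
      then show ?case using A_X'[of \<omega>] by auto
    qed
    show "{\<omega>\<in>space M. \<forall>t\<in>J. w t \<omega> + drift (step_fun \<phi>) t \<le> b t} \<in> sets M"
      using J(1) by measurable
  qed measurable
  finally show ?thesis .
qed

end

section \<open>The Girsanov formula for square-integrable shifts\<close>

context wiener_process
begin

text \<open>Keeps the path off the boundary of half-line cylinders, so that their indicators
  converge when the drift does. Time zero is excluded because the start is deterministic.\<close>

lemma AE_w_neq:
  assumes "0 < t" "t \<le> 1" shows "AE \<omega> in M. w t \<omega> \<noteq> c"
proof -
  let ?X = "\<lambda>\<omega>. w t \<omega> - w 0 \<omega>"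
  have X: "distributed M lborel ?X (normal_density 0 (sqrt (t - 0)))"
    using assms by (intro gaussian_increments) auto
  have "emeasure M (?X -` {c} \<inter> space M) = (\<integral>\<^sup>+x. ennreal (normal_density 0 (sqrt (t - 0)) x) * indicator {c} x \<partial>lborel)"
    by (rule distributed_emeasure[OF X]) simp
  also have "\<dots> = 0"
    by (subst nn_integral_0_iff_AE) (auto intro!: AE_mp[OF AE_lborel_singleton[of c] AE_I2])
  finally have "AE \<omega> in M. \<not> ?X \<omega> = c"
    using measurable_sets[OF distributed_measurable[OF X], of "{c}"]
    by (intro AE_I[where N="?X -` {c} \<inter> space M"]) auto
  then show ?thesis using start_zero by eventually_elim simp
qed

text \<open>No dominating function for the densities is at hand, so Fatou's lemma is applied to the
  cylinder and to its complement. The two upper bounds add up to one, the total mass of the limiting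
  density, and so both are equalities.\<close>

lemma girsanov_limit:
  assumes \<phi>: "\<And>n. valid_step (\<phi> n)" and f: "L2_unit f" "0 < L2sq f"
    and lim: "(\<lambda>n. L2sq (\<lambda>t. step_fun (\<phi> n) t - f t)) \<longlonglongrightarrow> 0"
    and V [measurable]: "V \<in> borel_measurable M" and WV: "AE \<omega> in M. (\<lambda>n. W (\<phi> n) \<omega>) \<longlonglongrightarrow> V \<omega>"
    and V_distr: "distr M borel (\<lambda>\<omega>. V \<omega> / sqrt (L2sq f)) = std_normal_distribution"
    and J: "finite J" "J \<subseteq> {0..1}"
  shows "(\<integral>\<^sup>+\<omega>. ennreal (exp (V \<omega> - L2sq f / 2)) * indicator {\<omega>\<in>space M. \<forall>t\<in>J. w t \<omega> \<le> b t} \<omega> \<partial>M) =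
    emeasure M {\<omega>\<in>space M. \<forall>t\<in>J. w t \<omega> + drift f t \<le> b t}"
proof -
  define A where "A = {\<omega>\<in>space M. \<forall>t\<in>J. w t \<omega> \<le> b t}"
  define B where "B h = {\<omega>\<in>space M. \<forall>t\<in>J. w t \<omega> + drift h t \<le> b t}" for h
  define D where "D n \<omega> = ennreal (exp (W (\<phi> n) \<omega> - L2sq (step_fun (\<phi> n)) / 2))" for n \<omega>
  define D' where "D' \<omega> = ennreal (exp (V \<omega> - L2sq f / 2))" for \<omega>
  note [measurable] = W_measurable[OF \<phi>]
  have wm [measurable]: "w t \<in> borel_measurable M" if "t \<in> J" for t
    using that J(2) by (auto intro!: measurable_w)
  have [measurable]: "A \<in> sets M" "B h \<in> sets M" for h
    unfolding A_def B_def using J(1) by measurable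
  have [measurable]: "D n \<in> borel_measurable M" "D' \<in> borel_measurable M" for n
    unfolding D_def[abs_def] D'_def[abs_def] by measurable
  have DA: "(\<integral>\<^sup>+\<omega>. D n \<omega> * indicator A \<omega> \<partial>M) = ennreal (prob (B (step_fun (\<phi> n))))" for n
    using girsanov_step[OF \<phi> J] by (simp add: D_def A_def B_def emeasure_eq_measure)
  \<comment> \<open>The formula with an empty set of times gives the total mass.\<close>
  have D1: "(\<integral>\<^sup>+\<omega>. D n \<omega> \<partial>M) = 1" for n
  proof -
    have "(\<integral>\<^sup>+\<omega>. D n \<omega> \<partial>M) = (\<integral>\<^sup>+\<omega>. D n \<omega> * indicator {\<omega>\<in>space M. \<forall>t\<in>{}. w t \<omega> \<le> b t} \<omega> \<partial>M)"
      by (rule nn_integral_cong) simp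
    also have "\<dots> = 1"
      using girsanov_step[OF \<phi>, of "{}" n b] by (simp add: D_def emeasure_space_1)
    finally show ?thesis .
  qed
  have split: "(\<integral>\<^sup>+\<omega>. h \<omega> * indicator A \<omega> \<partial>M) + (\<integral>\<^sup>+\<omega>. h \<omega> * indicator (space M - A) \<omega> \<partial>M) = (\<integral>\<^sup>+\<omega>. h \<omega> \<partial>M)"
    if [measurable]: "h \<in> borel_measurable M" for h :: "'a \<Rightarrow> ennreal"
    by (subst nn_integral_add[symmetric]) (auto intro!: nn_integral_cong simp: indicator_def)
  have DAc: "(\<integral>\<^sup>+\<omega>. D n \<omega> * indicator (space M - A) \<omega> \<partial>M) = ennreal (1 - prob (B (step_fun (\<phi> n))))" for n
  proof -
    have "ennreal (prob (B (step_fun (\<phi> n)))) + (\<integral>\<^sup>+\<omega>. D n \<omega> * indicator (space M - A) \<omega> \<partial>M) = 1"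
      using split[of "D n"] by (simp add: DA D1)
    then have "(\<integral>\<^sup>+\<omega>. D n \<omega> * indicator (space M - A) \<omega> \<partial>M) = 1 - ennreal (prob (B (step_fun (\<phi> n))))"
      by (metis ennreal_add_diff_cancel_left ennreal_neq_top)
    then show ?thesis by (simp add: ennreal_minus flip: ennreal_1)
  qed
  have L2: "(\<lambda>n. L2sq (step_fun (\<phi> n))) \<longlonglongrightarrow> L2sq f"
    by (rule L2_tendsto(2)[OF _ f(1) lim]) simp
  have drift: "(\<lambda>n. drift (step_fun (\<phi> n)) t) \<longlonglongrightarrow> drift f t" if "t \<in> J" for t
  proof -
    have "0 \<le> t" "t \<le> 1" using that J(2) by auto
    then show ?thesis
      using L2_tendsto(1)[OF _ f(1) lim L2_unit_indicator[of "{0<..t}"]] f(1)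
      by (simp add: drift_eq mult.commute)
  qed
  have D_lim: "AE \<omega> in M. (\<lambda>n. D n \<omega>) \<longlonglongrightarrow> D' \<omega>"
    using WV
  proof eventually_elim
    case (elim \<omega>)
    show ?case unfolding D_def D'_def
      by (intro tendsto_ennrealI tendsto_exp tendsto_diff elim tendsto_divide L2 tendsto_const) simp
  qed
  have "AE \<omega> in M. \<forall>t\<in>J - {0}. w t \<omega> \<noteq> b t - drift f t"
  proof (rule AE_finite_allI)
    fix t assume "t \<in> J - {0}"
    then have "0 < t" "t \<le> 1" using J(2) by (auto simp: subset_eq less_le)
    then show "AE \<omega> in M. w t \<omega> \<noteq> b t - drift f t" by (rule AE_w_neq)
  qed (use J in simp)
  with start_zero have B_lim: "AE \<omega> in M. (\<lambda>n. indicator (B (step_fun (\<phi> n))) \<omega>) \<longlonglongrightarrow> (indicator (B f) \<omega> :: real)"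
  proof eventually_elim
    case (elim \<omega>)
    have "\<forall>\<^sub>F n in sequentially. w t \<omega> + drift (step_fun (\<phi> n)) t \<le> b t \<longleftrightarrow> w t \<omega> + drift f t \<le> b t" if t: "t \<in> J" for t
    \<comment> \<open>At time zero the path has an atom, but the drift vanishes there for every
      \<open>n\<close>, so the inequality does not change at all.\<close>
    proof (cases "t = 0")
      case True
      then show ?thesis by (simp add: drift_def)
    next
      case False
      have lim: "(\<lambda>n. w t \<omega> + drift (step_fun (\<phi> n)) t) \<longlonglongrightarrow> w t \<omega> + drift f t"
        by (intro tendsto_intros drift t)
      have "w t \<omega> + drift f t < b t \<or> b t < w t \<omega> + drift f t"
        using elim t False by (auto simp: algebra_simps neq_iff)
      then show ?thesis
        using order_tendstoD(1)[OF lim, of "b t"] order_tendstoD(2)[OF lim, of "b t"]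
        by (auto elim!: eventually_mono)
    qed
    then have "\<forall>\<^sub>F n in sequentially. \<forall>t\<in>J. w t \<omega> + drift (step_fun (\<phi> n)) t \<le> b t \<longleftrightarrow> w t \<omega> + drift f t \<le> b t"
      using J(1) by (simp add: eventually_ball_finite)
    then have "\<forall>\<^sub>F n in sequentially. indicator (B (step_fun (\<phi> n))) \<omega> = (indicator (B f) \<omega> :: real)"
      by eventually_elim (auto simp: B_def indicator_def)
    then show ?case by (rule tendsto_eventually)
  qed
  have "(\<lambda>n. LINT \<omega>|M. indicator (B (step_fun (\<phi> n))) \<omega>) \<longlonglongrightarrow> (LINT \<omega>|M. indicator (B f) \<omega> :: real)"
    by (rule integral_dominated_convergence[where w="\<lambda>_. 1"]) (use B_lim in \<open>auto simp: indicator_def\<close>)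
  then have prob_lim: "(\<lambda>n. prob (B (step_fun (\<phi> n)))) \<longlonglongrightarrow> prob (B f)" by simp
  have fatou: "(\<integral>\<^sup>+\<omega>. D' \<omega> * indicator C \<omega> \<partial>M) \<le> ennreal p"
    if C [measurable]: "C \<in> sets M" and I: "\<And>n. (\<integral>\<^sup>+\<omega>. D n \<omega> * indicator C \<omega> \<partial>M) = ennreal (q n)" and q: "q \<longlonglongrightarrow> p"
    for C q p
  proof -
    have "(\<integral>\<^sup>+\<omega>. D' \<omega> * indicator C \<omega> \<partial>M) = (\<integral>\<^sup>+\<omega>. liminf (\<lambda>n. D n \<omega> * indicator C \<omega>) \<partial>M)"
    proof (rule nn_integral_cong_AE)
      show "AE \<omega> in M. D' \<omega> * indicator C \<omega> = liminf (\<lambda>n. D n \<omega> * indicator C \<omega>)"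
        using D_lim
      proof eventually_elim
        case (elim \<omega>)
        then have "(\<lambda>n. D n \<omega> * indicator C \<omega>) \<longlonglongrightarrow> D' \<omega> * indicator C \<omega>"
          by (cases "\<omega> \<in> C") auto
        then show ?case by (rule lim_imp_Liminf[OF sequentially_bot, symmetric])
      qed
    qed
    also have "\<dots> \<le> liminf (\<lambda>n. \<integral>\<^sup>+\<omega>. D n \<omega> * indicator C \<omega> \<partial>M)"
      by (rule nn_integral_liminf) measurable
    also have "\<dots> = ennreal p"
      unfolding I by (rule lim_imp_Liminf[OF sequentially_bot tendsto_ennrealI[OF q]])
    finally show ?thesis .
  qed
  have le1: "(\<integral>\<^sup>+\<omega>. D' \<omega> * indicator A \<omega> \<partial>M) \<le> ennreal (prob (B f))"
    by (rule fatou[OF _ DA prob_lim]) measurable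
  have le2: "(\<integral>\<^sup>+\<omega>. D' \<omega> * indicator (space M - A) \<omega> \<partial>M) \<le> ennreal (1 - prob (B f))"
    by (rule fatou[OF _ DAc tendsto_diff[OF tendsto_const prob_lim]]) measurable
  \<comment> \<open>Here the normal law of \<open>V\<close> enters: \<open>M\<close> with
    \<open>V\<close> divided by the norm of \<open>f\<close> is itself a Gaussian shift experiment,
    and \<open>D'\<close> is its likelihood ratio.\<close>
  have total: "(\<integral>\<^sup>+\<omega>. D' \<omega> \<partial>M) = 1"
  proof -
    let ?r = "sqrt (L2sq f)"
    interpret gaussian_shift M "\<lambda>\<omega>. V \<omega> / ?r" ?r
      by standard (use V_distr f in auto)
    have "emeasure P\<^sub>1 (space P\<^sub>1) = 1" by (rule P1.emeasure_space_1)
    also have "emeasure P\<^sub>1 (space P\<^sub>1) = (\<integral>\<^sup>+\<omega>. ennreal (lr \<omega>) * indicator (space M) \<omega> \<partial>M)"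
      unfolding P\<^sub>1_def by (subst emeasure_density) auto
    also have "\<dots> = (\<integral>\<^sup>+\<omega>. D' \<omega> \<partial>M)"
      using f by (intro nn_integral_cong) (simp add: lr_def D'_def)
    finally show ?thesis by simp
  qed
  define p where "p = prob (B f)"
  obtain i1 where i1: "(\<integral>\<^sup>+\<omega>. D' \<omega> * indicator A \<omega> \<partial>M) = ennreal i1" "0 \<le> i1"
    using le1 by (cases "\<integral>\<^sup>+\<omega>. D' \<omega> * indicator A \<omega> \<partial>M") (auto simp: top_unique)
  obtain i2 where i2: "(\<integral>\<^sup>+\<omega>. D' \<omega> * indicator (space M - A) \<omega> \<partial>M) = ennreal i2" "0 \<le> i2"
    using le2 by (cases "\<integral>\<^sup>+\<omega>. D' \<omega> * indicator (space M - A) \<omega> \<partial>M") (auto simp: top_unique)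
  have "ennreal (i1 + i2) = ennreal 1"
    using split[of D'] i1 i2 total by simp
  then have "i1 + i2 = 1" using i1 i2 by (subst (asm) ennreal_inj) auto
  moreover have "i1 \<le> p" "i2 \<le> 1 - p"
    using le1 le2 i1 i2 by (auto simp: p_def)
  ultimately have "i1 = p" by simp
  then show ?thesis using i1 by (simp add: p_def D'_def A_def B_def emeasure_eq_measure)
qed

end

text \<open>Half-line cylinders are used because shifting them is continuous in probability.\<close>

definition lower_cylinder :: "real set \<Rightarrow> (real \<Rightarrow> real) \<Rightarrow> (real \<Rightarrow> real) set" where
  "lower_cylinder J b = {y \<in> space path_space. \<forall>t\<in>J. y t \<le> b t}"

text \<open>Lower cylinders are stable under intersection, with the smaller bound at common times,
  and they generate the product \<sigma>-algebra because half-lines generate the Borel sets.\<close>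

lemma path_space_eqI:
  assumes sets: "sets P = sets path_space" "sets Q = sets path_space" and P: "finite_measure P"
    and eq: "\<And>J b. finite J \<Longrightarrow> J \<subseteq> {0..1} \<Longrightarrow> emeasure P (lower_cylinder J b) = emeasure Q (lower_cylinder J b)"
  shows "P = Q"
proof (rule measure_eqI_generator_eq)
  let ?\<Omega> = "\<Pi>\<^sub>E t\<in>{0..1::real}. UNIV :: real set"
  let ?E = "{lower_cylinder J b | J b. finite J \<and> J \<subseteq> {0..1}}"
  have space: "space path_space = ?\<Omega>" by (simp add: path_space_def space_PiM)
  show sub: "?E \<subseteq> Pow ?\<Omega>" by (auto simp: lower_cylinder_def space)
  show "Int_stable ?E"
  proof (rule Int_stableI)
    fix X Y assume "X \<in> ?E" "Y \<in> ?E"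
    then obtain J b J' b' where X: "X = lower_cylinder J b" "finite J" "J \<subseteq> {0..1}"
      and Y: "Y = lower_cylinder J' b'" "finite J'" "J' \<subseteq> {0..1}" by blast
    let ?b = "\<lambda>t. if t \<in> J \<inter> J' then min (b t) (b' t) else if t \<in> J then b t else b' t"
    have "X \<inter> Y = lower_cylinder (J \<union> J') ?b"
      unfolding X Y lower_cylinder_def by (auto split: if_splits)
    then show "X \<inter> Y \<in> ?E" using X Y by blast
  qed
  show "emeasure P X = emeasure Q X" if "X \<in> ?E" for X
    using that eq by blast
  have "sets path_space = sets (sigma ?\<Omega> ?E)"
  proof -
    let ?F = "{{f\<in>?\<Omega>. \<forall>i\<in>j. f i \<in> A i} | A j. j \<in> {J. finite J \<and> J \<subseteq> {0..1}} \<and> A \<in> Pi j (\<lambda>_. range (\<lambda>a::real. {..a}))}"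
    have "sets (PiM {0..1} (\<lambda>_. sigma UNIV (range (\<lambda>a::real. {..a})))) = sets (sigma ?\<Omega> ?F)"
    proof (rule sets_PiM_sigma)
      have "(UNIV :: real set) = \<Union> (range (\<lambda>n::nat. {..real n}))"
        by (auto simp: real_arch_simple)
      then show "\<exists>S\<subseteq>range (\<lambda>a::real. {..a}). countable S \<and> UNIV = \<Union> S"
        by (intro exI[of _ "range (\<lambda>n::nat. {..real n})"]) auto
      show "\<Union> {J. finite J \<and> J \<subseteq> {0..1}} = {0..1::real}"
        by (auto intro!: exI[of _ "{x}" for x])
    qed auto
    moreover have "?F = ?E"
    proof (intro equalityI subsetI)
      fix X assume "X \<in> ?F"
      then obtain A j where X: "X = {f\<in>?\<Omega>. \<forall>i\<in>j. f i \<in> A i}" "finite j" "j \<subseteq> {0..1}"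
        and Pi: "A \<in> Pi j (\<lambda>_. range (\<lambda>a. {..a}))" by blast
      have A: "\<forall>i\<in>j. \<exists>a. A i = {..a}" using Pi by (auto simp: Pi_iff)
      from bchoice[OF A] obtain b where "\<forall>i\<in>j. A i = {..b i}" by blast
      then have "X = lower_cylinder j b" unfolding X lower_cylinder_def space by auto
      then show "X \<in> ?E" using X by blast
    next
      fix X assume "X \<in> ?E"
      then obtain J b where X: "X = lower_cylinder J b" "finite J" "J \<subseteq> {0..1}" by blast
      show "X \<in> ?F"
        unfolding X lower_cylinder_def space using X(2,3)
        by (intro CollectI exI[of _ "\<lambda>i. {..b i}"] exI[of _ J]) auto
    qed
    ultimately show ?thesis unfolding path_space_def borel_eq_atMost by simp
  qed
  then have "sets path_space = sigma_sets ?\<Omega> ?E" using sub by simp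
  then show "sets P = sigma_sets ?\<Omega> ?E" "sets Q = sigma_sets ?\<Omega> ?E" using sets by auto
  \<comment> \<open>An empty set of times gives the whole space, which provides the exhausting
    sequence of finite measure.\<close>
  have "lower_cylinder {} (\<lambda>_. 0) \<in> ?E" by blast
  then show "range (\<lambda>_::nat. lower_cylinder {} (\<lambda>_. 0)) \<subseteq> ?E" by blast
  show "(\<Union>i::nat. lower_cylinder {} (\<lambda>_. 0)) = ?\<Omega>" by (simp add: lower_cylinder_def space)
  show "emeasure P (lower_cylinder {} (\<lambda>_. 0)) \<noteq> \<infinity>"
    using finite_measure.emeasure_finite[OF P] by simp
qed

context wiener_process
begin

text \<open>Subtracting the first drift and dividing by \<open>e\<close> reduces the two
  observations to the Wiener path without and with the drift of \<open>f\<close>, the scaled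
  difference of the signals. \<open>Z\<close> is the stochastic integral of \<open>f\<close>,
  standardised under the first parameter.\<close>

lemma obs_law_gaussian_shift:
  assumes e: "0 < e" and S0: "L2_unit (\<lambda>t. S t \<theta>\<^sub>0)" and S1: "L2_unit (\<lambda>t. S t \<theta>\<^sub>1)"
  defines "r \<equiv> sqrt (L2sq (\<lambda>t. S t \<theta>\<^sub>1 - S t \<theta>\<^sub>0)) / e"
  assumes r: "0 < r"
  obtains Z where "gaussian_shift (law S e \<theta>\<^sub>0) Z r"
    and "gaussian_shift.P\<^sub>1 (law S e \<theta>\<^sub>0) Z r = law S e \<theta>\<^sub>1"
proof -
  define f where "f t = (1 / e) * (S t \<theta>\<^sub>1 - S t \<theta>\<^sub>0)" for t
  have f: "L2_unit f"
    unfolding f_def[abs_def] by (intro L2_unit_scale L2_unit_diff S0 S1)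
  have r_eq: "r = sqrt (L2sq f)"
    using e unfolding f_def[abs_def] L2sq_scale r_def by (simp add: real_sqrt_mult real_sqrt_divide)
  have fpos: "0 < L2sq f" using r unfolding r_eq by simp
  have r2: "r\<^sup>2 = L2sq f" using fpos unfolding r_eq by simp
  obtain \<phi> where \<phi>: "\<And>n. valid_step (\<phi> n)" and fast: "\<And>n. L2sq (\<lambda>t. step_fun (\<phi> n) t - f t) < (1/4) ^ n"
    using step_approximation_fast[OF f] by blast
  define J where "J y = lim (\<lambda>n. step_integral (\<phi> n) y)" for y
  let ?P = "law S e \<theta>\<^sub>0" and ?Y = "observed_path w S e \<theta>\<^sub>0" and ?m = "L2ip f (\<lambda>t. S t \<theta>\<^sub>0)"
  have J_lim: "AE \<omega> in M. (\<lambda>n. step_integral (\<phi> n) (?Y \<omega>)) \<longlonglongrightarrow> J (?Y \<omega>)"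
    and J: "stoch_integral ?P f J"
    using stoch_integral_fast[where S=S and \<theta>="\<theta>\<^sub>0" and e=e, OF \<phi> f fast S0]
    unfolding J_def[abs_def] by blast+
  have Jm [measurable]: "J \<in> borel_measurable path_space" using J by (simp add: stoch_integral_def)
  define Z where "Z y = (J y - ?m) / (e * sqrt (L2sq f))" for y
  have Z_std: "distr ?P borel Z = std_normal_distribution"
    unfolding Z_def[abs_def] by (rule stoch_integral_std_normal[OF e f fpos S0 J])
  have Zm [measurable]: "Z \<in> borel_measurable path_space" unfolding Z_def[abs_def] by measurable
  interpret G: gaussian_shift ?P Z r
    by (intro gaussian_shift.intro gaussian_shift_axioms.intro prob_space_obs_law Z_std r) measurable
  note lim = L2sq_fast_tendsto[of \<phi>, OF fast]
  define V where "V \<omega> = (J (?Y \<omega>) - ?m) / e" for \<omega>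
  have Vm [measurable]: "V \<in> borel_measurable M" unfolding V_def[abs_def] by measurable
  have rZ: "r * Z (?Y \<omega>) = V \<omega>" for \<omega>
    using fpos e by (simp add: V_def Z_def r_eq)
  have V_std: "distr M borel (\<lambda>\<omega>. V \<omega> / sqrt (L2sq f)) = std_normal_distribution"
  proof -
    have "distr ?P borel Z = distr M borel (Z \<circ> ?Y)"
      unfolding obs_law_def by (rule distr_distr) measurable
    moreover have "Z \<circ> ?Y = (\<lambda>\<omega>. V \<omega> / sqrt (L2sq f))"
      using fpos e by (auto simp: V_def Z_def)
    ultimately show ?thesis using Z_std by simp
  qed
  have WV: "AE \<omega> in M. (\<lambda>n. W (\<phi> n) \<omega>) \<longlonglongrightarrow> V \<omega>"
    using J_lim
  proof eventually_elim
    case (elim \<omega>)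
    have "(\<lambda>n. (step_integral (\<phi> n) (?Y \<omega>) - L2ip (step_fun (\<phi> n)) (\<lambda>t. S t \<theta>\<^sub>0)) / e) \<longlonglongrightarrow> V \<omega>"
      unfolding V_def using e
      by (intro tendsto_divide tendsto_diff elim tendsto_const L2_tendsto(1)[OF _ f lim S0] L2_unit_step_fun) simp
    then show ?case
      using e unfolding step_integral_observed[where S=S and \<theta>="\<theta>\<^sub>0", OF \<phi> S0] by simp
  qed
  have drift: "drift (\<lambda>s. S s \<theta>\<^sub>1) t = drift (\<lambda>s. S s \<theta>\<^sub>0) t + e * drift f t" if "t \<in> {0..1}" for t
  proof -
    have "L2ip (indicator {0<..t}) f = (1 / e) * (LINT s|U01. indicator {0<..t} s * S s \<theta>\<^sub>1 - indicator {0<..t} s * S s \<theta>\<^sub>0)"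
      unfolding f_def integral_mult_right_zero[symmetric]
      by (rule Bochner_Integration.integral_cong) (auto simp: algebra_simps diff_divide_distrib)
    also have "(LINT s|U01. indicator {0<..t} s * S s \<theta>\<^sub>1 - indicator {0<..t} s * S s \<theta>\<^sub>0) =
       L2ip (indicator {0<..t}) (\<lambda>s. S s \<theta>\<^sub>1) - L2ip (indicator {0<..t}) (\<lambda>s. S s \<theta>\<^sub>0)"
      by (rule Bochner_Integration.integral_diff) (auto intro!: L2_unit_mult L2_unit_indicator S0 S1)
    finally show ?thesis using that e f S0 S1 by (simp add: drift_eq)
  qed
  have cyl_sets: "lower_cylinder I b \<in> sets path_space" if "finite I" "I \<subseteq> {0..1}" for I b
  proof -
    have [measurable]: "(\<lambda>y. y t) \<in> borel_measurable path_space" if "t \<in> I" for t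
      unfolding path_space_def using that \<open>I \<subseteq> {0..1}\<close> by (intro measurable_component_singleton) auto
    show ?thesis unfolding lower_cylinder_def using that by measurable
  qed
  have "G.P\<^sub>1 = law S e \<theta>\<^sub>1"
  proof (rule path_space_eqI)
    show "sets G.P\<^sub>1 = sets path_space" "sets (law S e \<theta>\<^sub>1) = sets path_space" by simp_all
    show "finite_measure G.P\<^sub>1" by unfold_locales
    fix I :: "real set" and b assume I: "finite I" "I \<subseteq> {0..1}"
    \<comment> \<open>\<open>?b\<close> is the bound \<open>b\<close> solved for \<open>w\<close>
      under the first parameter; under the second one the same bound applies to
      \<open>w t \<omega> + drift f t\<close>.\<close>
    let ?b = "\<lambda>t. (b t - drift (\<lambda>s. S s \<theta>\<^sub>0) t) / e"
    note [measurable] = cyl_sets[OF I, of b]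
    have Y_cyl: "observed_path w S e \<theta> \<omega> \<in> lower_cylinder I b \<longleftrightarrow>
       (\<forall>t\<in>I. drift (\<lambda>s. S s \<theta>) t + e * w t \<omega> \<le> b t)" for \<theta> \<omega>
      using I(2) by (auto simp: lower_cylinder_def observed_path_eq path_space_def space_PiM subset_eq)
    have "emeasure G.P\<^sub>1 (lower_cylinder I b) =
        (\<integral>\<^sup>+y. ennreal (exp (r * Z y - r\<^sup>2 / 2)) * indicator (lower_cylinder I b) y \<partial>?P)"
      unfolding G.P\<^sub>1_def G.lr_def by (rule emeasure_density) measurable
    also have "\<dots> = (\<integral>\<^sup>+\<omega>. ennreal (exp (r * Z (?Y \<omega>) - r\<^sup>2 / 2)) * indicator (lower_cylinder I b) (?Y \<omega>) \<partial>M)"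
      unfolding obs_law_def by (rule nn_integral_distr) measurable
    also have "\<dots> = (\<integral>\<^sup>+\<omega>. ennreal (exp (V \<omega> - L2sq f / 2)) * indicator {\<omega>\<in>space M. \<forall>t\<in>I. w t \<omega> \<le> ?b t} \<omega> \<partial>M)"
      using e unfolding rZ r2
      by (intro nn_integral_cong) (auto simp: indicator_def Y_cyl field_simps)
    also have "\<dots> = emeasure M {\<omega>\<in>space M. \<forall>t\<in>I. w t \<omega> + drift f t \<le> ?b t}"
      by (rule girsanov_limit[OF \<phi> f fpos lim Vm WV V_std I])
    also have "{\<omega>\<in>space M. \<forall>t\<in>I. w t \<omega> + drift f t \<le> ?b t} = observed_path w S e \<theta>\<^sub>1 -` lower_cylinder I b \<inter> space M"
    proof -
      have "w t \<omega> + drift f t \<le> ?b t \<longleftrightarrow> drift (\<lambda>s. S s \<theta>\<^sub>1) t + e * w t \<omega> \<le> b t" if "t \<in> I" for t \<omega>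
      proof -
        have "t \<in> {0..1}" using that I by auto
        then show ?thesis using e by (simp add: drift pos_le_divide_eq algebra_simps)
      qed
      then show ?thesis by (auto simp: Y_cyl)
    qed
    also have "emeasure M \<dots> = emeasure (law S e \<theta>\<^sub>1) (lower_cylinder I b)"
      unfolding obs_law_def by (rule emeasure_distr[symmetric]) measurable
    finally show "emeasure G.P\<^sub>1 (lower_cylinder I b) = emeasure (law S e \<theta>\<^sub>1) (lower_cylinder I b)" .
  qed
  then show ?thesis using that G.gaussian_shift_axioms by blast
qed

end

subsection \<open>Asymptotics of the tests\<close>

abbreviation test_of_level :: "'b measure \<Rightarrow> ('b \<Rightarrow> real) \<Rightarrow> real \<Rightarrow> bool" where
  "test_of_level N K a \<equiv> K \<in> borel_measurable N \<and> (\<forall>y\<in>space N. 0 \<le> K y \<and> K y \<le> 1) \<and> (LINT y|N. K y) = a"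

text \<open>Averaging two bounds instead of adding them leaves the slack \<open>s\<close> with
  coefficient one, the form that \<open>tendsto_0_of_slack_bound\<close> expects.\<close>

lemma slack_bound_average:
  fixes a b c d k s A B :: real
  assumes "d \<le> a + b" "a \<le> k * A / c + s" "b \<le> k * B / c + s"
  shows "d / 2 \<le> k / 2 * (A + B) / c + s"
proof -
  have "k / 2 * (A + B) / c = (k * A / c + k * B / c) / 2"
    by (simp add: add_divide_distrib distrib_left)
  moreover have "d / 2 \<le> (X + Y) / 2 + s" if "a \<le> X + s" "b \<le> Y + s" for X Y
    using assms(1) that by (simp add: field_simps)
  ultimately show ?thesis using assms by simp
qed

text \<open>Each test is compared with the optimal test of the exact experiment, and the triangle
  inequality removes the latter. The optimal test depends on a variable \<open>Z\<close> that is
  only known to exist for each \<open>e\<close>, so it stays inside the proof.\<close>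

lemma near_optimal_tests_close:
  fixes P Q :: "'e \<Rightarrow> 'b measure" and K L :: "'e \<Rightarrow> 'b \<Rightarrow> real" and x r :: "'e \<Rightarrow> real"
  assumes shift: "\<forall>\<^sub>F e in F. \<exists>Z. gaussian_shift (P e) Z (r e) \<and> gaussian_shift.P\<^sub>1 (P e) Z (r e) = Q e"
    and K: "\<forall>\<^sub>F e in F. test_of_level (P e) (K e) (1 - \<Phi> (x e))"
    and L: "\<forall>\<^sub>F e in F. test_of_level (P e) (L e) (1 - \<Phi> (x e))"
    and r: "filterlim r at_top F" and x: "\<forall>\<^sub>F e in F. - C \<le> x e"
    and \<beta>K: "((\<lambda>e. (LINT y|Q e. 1 - K e y) / \<Phi> (x e - r e)) \<longlongrightarrow> 1) F"
    and \<beta>L: "((\<lambda>e. (LINT y|Q e. 1 - L e y) / \<Phi> (x e - r e)) \<longlongrightarrow> 1) F"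
  shows "((\<lambda>e. (LINT y|Q e. \<bar>K e y - L e y\<bar>) / \<Phi> (x e - r e)) \<longlongrightarrow> 0) F"
    and "0 < \<delta> \<Longrightarrow> \<forall>\<^sub>F e in F. x e \<le> (1 - \<delta>) * r e \<Longrightarrow>
      ((\<lambda>e. (LINT y|P e. \<bar>K e y - L e y\<bar>) / (1 - \<Phi> (x e))) \<longlongrightarrow> 0) F"
proof -
  let ?A = "\<lambda>K e. (LINT y|Q e. 1 - K e y) / \<Phi> (x e - r e) - 1"
  have A: "((\<lambda>e. ?A K e + ?A L e) \<longlongrightarrow> 0) F"
    using tendsto_add[OF tendsto_diff[OF \<beta>K tendsto_const[of 1]] tendsto_diff[OF \<beta>L tendsto_const[of 1]]]
    by simp
  have half: "(h \<longlongrightarrow> 0) F" if "((\<lambda>e. h e / 2) \<longlongrightarrow> 0) F" for h :: "'e \<Rightarrow> real"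
    using tendsto_mult[OF tendsto_const[of 2] that] by simp
  have r1: "\<forall>\<^sub>F e in F. 1 \<le> r e" using r by (simp add: filterlim_at_top)
  have triangle: "(LINT y|N. \<bar>k y - l y\<bar>) \<le> (LINT y|N. \<bar>k y - m y\<bar>) + (LINT y|N. \<bar>l y - m y\<bar>)"
    if "prob_space N" and [measurable]: "k \<in> borel_measurable N" "l \<in> borel_measurable N" "m \<in> borel_measurable N"
      and b: "\<And>y. y \<in> space N \<Longrightarrow> 0 \<le> k y \<and> k y \<le> 1 \<and> 0 \<le> l y \<and> l y \<le> 1 \<and> 0 \<le> m y \<and> m y \<le> 1"
    for N :: "'b measure" and k l m :: "'b \<Rightarrow> real"
  proof -
    interpret prob_space N by fact
    have int: "integrable N (\<lambda>y. \<bar>k y - l y\<bar>)" "integrable N (\<lambda>y. \<bar>k y - m y\<bar>)" "integrable N (\<lambda>y. \<bar>l y - m y\<bar>)"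
      by (rule integrable_const_bound[of _ 1]; use b in \<open>force intro!: AE_I2\<close>)+
    have "(LINT y|N. \<bar>k y - l y\<bar>) \<le> (LINT y|N. \<bar>k y - m y\<bar> + \<bar>l y - m y\<bar>)"
      by (rule integral_mono) (use int in auto)
    then show ?thesis using int by simp
  qed
  have "((\<lambda>e. (LINT y|Q e. \<bar>K e y - L e y\<bar>) / \<Phi> (x e - r e) / 2) \<longlongrightarrow> 0) F"
  proof (rule tendsto_0_of_slack_bound[OF A])
    show "\<forall>\<^sub>F e in F. 0 \<le> (LINT y|Q e. \<bar>K e y - L e y\<bar>) / \<Phi> (x e - r e) / 2"
      by (auto intro!: always_eventually divide_nonneg_pos integral_nonneg_AE std_normal_cdf_pos)
    fix \<eta> :: real assume \<eta>: "0 < \<eta>" "\<eta> \<le> 1"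
    show "\<forall>\<^sub>F e in F. (LINT y|Q e. \<bar>K e y - L e y\<bar>) / \<Phi> (x e - r e) / 2 \<le>
       1 / 2 * (?A K e + ?A L e) / (1 - exp (- \<eta>)) +
       exp_gap (exp 2 * (3 + \<bar>C\<bar>) * \<eta>)"
      using shift K L r1 x
    proof eventually_elim
      case (elim e)
      then obtain Z where "gaussian_shift (P e) Z (r e)" and Q: "gaussian_shift.P\<^sub>1 (P e) Z (r e) = Q e" by blast
      interpret gaussian_shift "P e" Z "r e" by fact
      let ?k = "\<lambda>y. if x e < Z y then 1 else 0 :: real"
      have [measurable]: "K e \<in> borel_measurable (P e)" "L e \<in> borel_measurable (P e)" using elim by auto
      have "space P\<^sub>1 = space (P e)" by (simp add: P\<^sub>1_def)
      then have "(LINT y|P\<^sub>1. \<bar>K e y - L e y\<bar>) \<le> (LINT y|P\<^sub>1. \<bar>K e y - ?k y\<bar>) + (LINT y|P\<^sub>1. \<bar>L e y - ?k y\<bar>)"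
        by (intro triangle prob_space_P1) (use elim in auto)
      then have "(LINT y|P\<^sub>1. \<bar>K e y - L e y\<bar>) / \<Phi> (x e - r e) \<le>
        (LINT y|P\<^sub>1. \<bar>K e y - ?k y\<bar>) / \<Phi> (x e - r e) + (LINT y|P\<^sub>1. \<bar>L e y - ?k y\<bar>) / \<Phi> (x e - r e)"
        using std_normal_cdf_pos[of "x e - r e"]
        by (simp add: divide_right_mono flip: add_divide_distrib)
      moreover have "(LINT y|P\<^sub>1. \<bar>K e y - ?k y\<bar>) / \<Phi> (x e - r e) \<le> ?A K e / (1 - exp (- \<eta>)) +
          exp_gap (exp 2 * (3 + \<bar>C\<bar>) * \<eta>)"
        unfolding Q[symmetric] by (rule relative_dist_optimal_test_alt) (use elim \<eta> in auto)
      moreover have "(LINT y|P\<^sub>1. \<bar>L e y - ?k y\<bar>) / \<Phi> (x e - r e) \<le> ?A L e / (1 - exp (- \<eta>)) +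
          exp_gap (exp 2 * (3 + \<bar>C\<bar>) * \<eta>)"
        unfolding Q[symmetric] by (rule relative_dist_optimal_test_alt) (use elim \<eta> in auto)
      ultimately show ?case
        unfolding Q by (rule slack_bound_average[where k=1, unfolded mult_1_left])
    qed
  qed
  then show "((\<lambda>e. (LINT y|Q e. \<bar>K e y - L e y\<bar>) / \<Phi> (x e - r e)) \<longlongrightarrow> 0) F" by (rule half)

  assume \<delta>: "0 < \<delta>" and x\<delta>: "\<forall>\<^sub>F e in F. x e \<le> (1 - \<delta>) * r e"
  have "((\<lambda>e. (LINT y|P e. \<bar>K e y - L e y\<bar>) / (1 - \<Phi> (x e)) / 2) \<longlongrightarrow> 0) F"
  proof (rule tendsto_0_of_slack_bound[OF A])
    show "\<forall>\<^sub>F e in F. 0 \<le> (LINT y|P e. \<bar>K e y - L e y\<bar>) / (1 - \<Phi> (x e)) / 2"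
      by (auto intro!: always_eventually divide_nonneg_pos integral_nonneg_AE std_normal_cdf_less_1)
    fix \<eta> :: real assume \<eta>: "0 < \<eta>" "\<eta> \<le> 1"
    show "\<forall>\<^sub>F e in F. (LINT y|P e. \<bar>K e y - L e y\<bar>) / (1 - \<Phi> (x e)) / 2 \<le>
       exp 2 / \<delta> * (?A K e + ?A L e) / (1 - exp (- \<eta>)) + exp_gap (exp 2 * 3 * \<eta>)"
      using shift K L r1 x\<delta>
    proof eventually_elim
      case (elim e)
      then obtain Z where "gaussian_shift (P e) Z (r e)" and Q: "gaussian_shift.P\<^sub>1 (P e) Z (r e) = Q e" by blast
      interpret gaussian_shift "P e" Z "r e" by fact
      let ?k = "\<lambda>y. if x e < Z y then 1 else 0 :: real"
      have [measurable]: "K e \<in> borel_measurable (P e)" "L e \<in> borel_measurable (P e)" using elim by auto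
      have "(LINT y|P e. \<bar>K e y - L e y\<bar>) \<le> (LINT y|P e. \<bar>K e y - ?k y\<bar>) + (LINT y|P e. \<bar>L e y - ?k y\<bar>)"
        by (intro triangle prob_space_axioms) (use elim in auto)
      then have "(LINT y|P e. \<bar>K e y - L e y\<bar>) / (1 - \<Phi> (x e)) \<le>
        (LINT y|P e. \<bar>K e y - ?k y\<bar>) / (1 - \<Phi> (x e)) + (LINT y|P e. \<bar>L e y - ?k y\<bar>) / (1 - \<Phi> (x e))"
        using std_normal_cdf_less_1[of "x e"]
        by (simp add: divide_right_mono flip: add_divide_distrib)
      moreover have "(LINT y|P e. \<bar>K e y - ?k y\<bar>) / (1 - \<Phi> (x e)) \<le> 2 * exp 2 / \<delta> * ?A K e / (1 - exp (- \<eta>)) +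
          exp_gap (exp 2 * 3 * \<eta>)"
        unfolding Q[symmetric] by (rule relative_dist_optimal_test_null) (use elim \<eta> \<delta> in auto)
      moreover have "(LINT y|P e. \<bar>L e y - ?k y\<bar>) / (1 - \<Phi> (x e)) \<le> 2 * exp 2 / \<delta> * ?A L e / (1 - exp (- \<eta>)) +
          exp_gap (exp 2 * 3 * \<eta>)"
        unfolding Q[symmetric] by (rule relative_dist_optimal_test_null) (use elim \<eta> \<delta> in auto)
      ultimately have "(LINT y|P e. \<bar>K e y - L e y\<bar>) / (1 - \<Phi> (x e)) / 2 \<le> 2 * exp 2 / \<delta> / 2 * (?A K e + ?A L e) / (1 - exp (- \<eta>)) +
          exp_gap (exp 2 * 3 * \<eta>)"
        by (rule slack_bound_average)
      then show ?case by simp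
    qed
  qed
  then show "((\<lambda>e. (LINT y|P e. \<bar>K e y - L e y\<bar>) / (1 - \<Phi> (x e))) \<longlongrightarrow> 0) F" by (rule half)
qed

section \<open>Error ratios and the errors of the efficient test\<close>

lemma asymp_eq_iff_ratio:
  assumes "\<And>e. 0 < g e"
  shows "asymp_eq f g \<longleftrightarrow> ((\<lambda>e. f e / g e) \<longlongrightarrow> 1) (at_right 0)"
proof
  assume "asymp_eq f g"
  then obtain s where s: "s \<in> o[at_right 0](\<lambda>_. 1)" and eq: "\<forall>\<^sub>F e in at_right 0. f e = g e * (1 + s e)"
    unfolding asymp_eq_def by blast
  have "(s \<longlongrightarrow> 0) (at_right 0)" using smalloD_tendsto[OF s] by simp
  then have lim: "((\<lambda>e. 1 + s e) \<longlongrightarrow> 1) (at_right 0)"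
    using tendsto_add[OF tendsto_const[of 1]] by fastforce
  show "((\<lambda>e. f e / g e) \<longlongrightarrow> 1) (at_right 0)"
  proof (rule Lim_transform_eventually[OF lim])
    show "\<forall>\<^sub>F e in at_right 0. 1 + s e = f e / g e"
      using eq by eventually_elim (simp add: less_imp_neq[OF assms, symmetric])
  qed
next
  assume "((\<lambda>e. f e / g e) \<longlongrightarrow> 1) (at_right 0)"
  then have "((\<lambda>e. f e / g e - 1) \<longlongrightarrow> 1 - 1) (at_right 0)"
    by (rule tendsto_diff[OF _ tendsto_const])
  then have "(\<lambda>e. f e / g e - 1) \<in> o[at_right 0](\<lambda>_. 1)"
    by (intro smalloI_tendsto) auto
  then show "asymp_eq f g"
    unfolding asymp_eq_def
    by (intro bexI[of _ "\<lambda>e. f e / g e - 1"] always_eventually allI)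
       (simp_all add: less_imp_neq[OF assms, symmetric])
qed

lemma asymp_ge_of_ratio:
  assumes g: "\<And>e. 0 < g e" and h: "((\<lambda>e. h e / g e) \<longlongrightarrow> 1) (at_right 0)"
    and le: "\<forall>\<^sub>F e in at_right 0. h e \<le> f e"
  shows "asymp_ge f g"
proof -
  obtain s where s: "s \<in> o[at_right 0](\<lambda>_. 1)" and eq: "\<forall>\<^sub>F e in at_right 0. h e = g e * (1 + s e)"
    using h asymp_eq_iff_ratio[of g h] g unfolding asymp_eq_def by blast
  have "\<forall>\<^sub>F e in at_right 0. f e \<ge> g e * (1 + s e)"
    using eq le by eventually_elim simp
  then show ?thesis unfolding asymp_ge_def using s by blast
qed

lemma (in prob_space) integral_std_normal_threshold:
  assumes [measurable]: "Y \<in> borel_measurable M" and Y: "distr M borel Y = std_normal_distribution"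
  shows "(LINT y|M. (if z < Y y then 1 else 0)) = 1 - \<Phi> z"
    and "(LINT y|M. 1 - (if z < Y y then 1 else 0)) = \<Phi> z"
proof -
  have "prob {y\<in>space M. Y y \<le> z} = measure (distr M borel Y) {..z}"
    by (subst measure_distr) (auto intro!: arg_cong2[where f=measure])
  then have p: "prob {y\<in>space M. Y y \<le> z} = \<Phi> z" by (simp add: Y cdf_def)
  have "(LINT y|M. 1 - (if z < Y y then 1 else 0 :: real)) = (LINT y|M. indicator {y\<in>space M. Y y \<le> z} y)"
    by (rule Bochner_Integration.integral_cong) (auto simp: indicator_def)
  then show 2: "(LINT y|M. 1 - (if z < Y y then 1 else 0)) = \<Phi> z" by (simp add: p)
  have "integrable M (\<lambda>y. if z < Y y then 1 else 0 :: real)"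
    by (rule integrable_const_bound[of _ 1]) auto
  then have "(LINT y|M. 1 - (if z < Y y then 1 else 0 :: real)) = 1 - (LINT y|M. (if z < Y y then 1 else 0))"
    by (simp add: prob_space)
  then show "(LINT y|M. (if z < Y y then 1 else 0)) = 1 - \<Phi> z" using 2 by simp
qed

context wiener_process
begin

lemma efficient_statistic_exists:
  assumes f: "L2_unit S\<^sub>\<theta>" and S: "\<And>\<theta>. \<theta> \<in> \<Theta> \<Longrightarrow> L2_unit (\<lambda>t. S t \<theta>)"
  shows "\<exists>T. efficient_statistic (law S e) \<Theta> S\<^sub>\<theta> T"
proof -
  obtain \<phi> where \<phi>: "\<And>n. valid_step (\<phi> n)" "\<And>n. L2sq (\<lambda>t. step_fun (\<phi> n) t - S\<^sub>\<theta> t) < (1/4) ^ n"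
    using step_approximation_fast[OF f] by blast
  define J where "J = (\<lambda>y. lim (\<lambda>n. step_integral (\<phi> n) y))"
  have "stoch_integral (law S e \<theta>) S\<^sub>\<theta> J" if "\<theta> \<in> \<Theta>" for \<theta>
    unfolding J_def
    by (rule stoch_integral_fast(2)[where S=S and \<theta>=\<theta> and e=e, OF \<phi>(1) f \<phi>(2) S[OF that]])
  then show ?thesis unfolding efficient_statistic_def by blast
qed

text \<open>The errors are exact at every noise level, because the statistic is normal with mean
  \<open>m\<close> and standard deviation \<open>e\<close>.\<close>

lemma efficient_statistic_errors:
  assumes e: "0 < e" and f: "L2_unit S\<^sub>\<theta>" "0 < fisher_info S\<^sub>\<theta>" and S: "L2_unit (\<lambda>t. S t \<theta>)" and \<theta>: "\<theta> \<in> \<Theta>"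
    and T: "efficient_statistic (law S e) \<Theta> S\<^sub>\<theta> T"
  defines "m \<equiv> L2ip S\<^sub>\<theta> (\<lambda>t. S t \<theta>) / sqrt (fisher_info S\<^sub>\<theta>)"
  shows "T \<in> borel_measurable path_space"
    and "type1_error (law S e \<theta>) (threshold_test T h) = 1 - \<Phi> ((h - m) / e)"
    and "type2_error (law S e \<theta>) (threshold_test T h) = \<Phi> ((h - m) / e)"
proof -
  let ?I = "fisher_info S\<^sub>\<theta>"
  interpret P: prob_space "law S e \<theta>" by (rule prob_space_obs_law)
  obtain J where J: "stoch_integral (law S e \<theta>) S\<^sub>\<theta> J" and T_eq: "T = (\<lambda>y. J y / sqrt ?I)"
    using T \<theta> unfolding efficient_statistic_def by blast
  have [measurable]: "J \<in> borel_measurable path_space" using J by (simp add: stoch_integral_def)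
  show T_meas [measurable]: "T \<in> borel_measurable path_space" unfolding T_eq by measurable
  have "(\<lambda>y. (J y - L2ip S\<^sub>\<theta> (\<lambda>t. S t \<theta>)) / (e * sqrt (L2sq S\<^sub>\<theta>))) = (\<lambda>y. (T y - m) / e)"
    using e f(2) unfolding T_eq m_def fisher_info_def by (auto simp: field_simps)
  then have std: "distr (law S e \<theta>) borel (\<lambda>y. (T y - m) / e) = std_normal_distribution"
    using stoch_integral_std_normal[where S=S and \<theta>=\<theta>, OF e f(1) _ S J] f(2)
    by (simp add: fisher_info_def)
  have thr: "threshold_test T h y = (if (h - m) / e < (T y - m) / e then 1 else 0)" for y
    using e by (simp add: threshold_test_def divide_less_cancel)
  show "type1_error (law S e \<theta>) (threshold_test T h) = 1 - \<Phi> ((h - m) / e)"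
    "type2_error (law S e \<theta>) (threshold_test T h) = \<Phi> ((h - m) / e)"
    unfolding type1_error_def type2_error_def thr
    by (rule P.integral_std_normal_threshold[OF _ std]; measurable)+
qed

end

lemma bigo_powr_over_square_tendsto:
  fixes u :: "real \<Rightarrow> real"
  assumes h: "h \<in> O[at \<theta>\<^sub>0](\<lambda>\<theta>. \<bar>\<theta> - \<theta>\<^sub>0\<bar> powr p)"
    and u: "filterlim (\<lambda>e. \<theta>\<^sub>0 + u e) (at \<theta>\<^sub>0) F" "\<forall>\<^sub>F e in F. 0 < u e"
    and lim: "((\<lambda>e. u e powr p / e\<^sup>2) \<longlongrightarrow> 0) F"
  shows "((\<lambda>e. h (\<theta>\<^sub>0 + u e) / e\<^sup>2) \<longlongrightarrow> 0) F"
proof -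
  obtain c where c: "\<forall>\<^sub>F \<theta> in at \<theta>\<^sub>0. norm (h \<theta>) \<le> c * norm (\<bar>\<theta> - \<theta>\<^sub>0\<bar> powr p)"
    using h by (rule landau_o.bigE)
  have "\<forall>\<^sub>F e in F. norm (h (\<theta>\<^sub>0 + u e)) \<le> c * norm (\<bar>(\<theta>\<^sub>0 + u e) - \<theta>\<^sub>0\<bar> powr p)"
    using eventually_compose_filterlim[OF c u(1)] .
  with u(2) have "\<forall>\<^sub>F e in F. norm (h (\<theta>\<^sub>0 + u e) / e\<^sup>2) \<le> c * (u e powr p / e\<^sup>2)"
  proof eventually_elim
    case (elim e)
    then have "\<bar>h (\<theta>\<^sub>0 + u e)\<bar> / e\<^sup>2 \<le> c * u e powr p / e\<^sup>2"
      by (intro divide_right_mono) auto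
    then show ?case by simp
  qed
  then show ?thesis
    using tendsto_mult_right_zero[OF lim, of c] by (rule Lim_null_comparison)
qed

lemma tendsto_0_of_powr:
  fixes u :: "'e \<Rightarrow> real"
  assumes p: "0 < p" and u: "\<forall>\<^sub>F e in F. 0 < u e" and lim: "((\<lambda>e. u e powr p) \<longlongrightarrow> 0) F"
  shows "(u \<longlongrightarrow> 0) F"
proof -
  have "((\<lambda>e. (u e powr p) powr (1 / p)) \<longlongrightarrow> 0) F"
    using p by (intro tendsto_zero_powrI[OF lim tendsto_const]) auto
  then show ?thesis
    by (rule Lim_transform_eventually) (use u p in \<open>auto elim!: eventually_mono simp: powr_powr\<close>)
qed

theorem theorem2p3:
  fixes M :: "'a measure" and w :: "real \<Rightarrow> 'a \<Rightarrow> real"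
    and S :: "real \<Rightarrow> real \<Rightarrow> real" and S\<^sub>\<theta> :: "real \<Rightarrow> real"
    and \<Theta> :: "real set" and \<theta>\<^sub>0 lam c :: real
    and u x :: "real \<Rightarrow> real"
    and K :: "real \<Rightarrow> (real \<Rightarrow> real) \<Rightarrow> real"
  assumes wiener: "wiener_process M w"
    and Theta: "open \<Theta>" "\<theta>\<^sub>0 \<in> \<Theta>"
    and signal: "\<And>\<theta>. \<theta> \<in> \<Theta> \<Longrightarrow> L2_unit (\<lambda>t. S t \<theta>)"
    and lambda: "0 < lam" "lam \<le> 1"
    and A1: "cond_A1 S S\<^sub>\<theta> \<theta>\<^sub>0"
    and A2: "cond_A2 lam S S\<^sub>\<theta> \<theta>\<^sub>0"
    and u_pos: "\<And>\<epsilon>. \<epsilon> > 0 \<Longrightarrow> u \<epsilon> > 0"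
    and u_large: "filterlim (\<lambda>\<epsilon>. u \<epsilon> / \<epsilon>) at_top (at_right 0)"
    and u_small: "((\<lambda>\<epsilon>. u \<epsilon> powr (2 + lam) / \<epsilon>\<^sup>2) \<longlongrightarrow> 0) (at_right 0)"
    and tests: "\<And>\<epsilon>. \<epsilon> > 0 \<Longrightarrow> is_test (K \<epsilon>)"
    and c: "c < 1" "\<And>\<epsilon>. \<epsilon> > 0 \<Longrightarrow> type1_error (obs_law M w S \<epsilon> \<theta>\<^sub>0) (K \<epsilon>) < c"
    and x: "\<And>\<epsilon>. \<epsilon> > 0 \<Longrightarrow> type1_error (obs_law M w S \<epsilon> \<theta>\<^sub>0) (K \<epsilon>) = 1 - \<Phi> (x \<epsilon>)"
  shows "let P = obs_law M w S;
             \<alpha> = (\<lambda>\<epsilon>. type1_error (P \<epsilon> \<theta>\<^sub>0) (K \<epsilon>));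
             \<beta> = (\<lambda>K' \<epsilon>. type2_error (P \<epsilon> (\<theta>\<^sub>0 + u \<epsilon>)) (K' \<epsilon>));
             \<rho> = (\<lambda>\<epsilon>. u \<epsilon> / \<epsilon> * sqrt (fisher_info S\<^sub>\<theta>));
             bound = (\<lambda>\<epsilon>. \<Phi> (x \<epsilon> - \<rho> \<epsilon>))
         in
           asymp_ge (\<beta> K) bound
         \<and> (\<forall>\<epsilon>>0. \<exists>T. efficient_statistic (P \<epsilon>) \<Theta> S\<^sub>\<theta> T)
         \<and> (\<forall>T. (\<forall>\<epsilon>>0. efficient_statistic (P \<epsilon>) \<Theta> S\<^sub>\<theta> (T \<epsilon>)) \<longrightarrow>
               (\<forall>\<epsilon>>0. \<exists>h. type1_error (P \<epsilon> \<theta>\<^sub>0) (threshold_test (T \<epsilon>) h) = \<alpha> \<epsilon>)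
             \<and> (\<forall>h L. L = (\<lambda>\<epsilon>. threshold_test (T \<epsilon>) (h \<epsilon>)) \<longrightarrow>
                    (\<forall>\<epsilon>>0. type1_error (P \<epsilon> \<theta>\<^sub>0) (L \<epsilon>) = \<alpha> \<epsilon>) \<longrightarrow>
                    asymp_eq (\<beta> L) bound
                  \<and> (asymp_eq (\<beta> K) bound \<longrightarrow>
                        (level_not_too_small x \<rho> \<longrightarrow>
                          ((\<lambda>\<epsilon>. inverse (\<alpha> \<epsilon>) * (LINT y|P \<epsilon> \<theta>\<^sub>0. \<bar>K \<epsilon> y - L \<epsilon> y\<bar>)) \<longlongrightarrow> 0)
                            (at_right 0))
                      \<and> ((\<lambda>\<epsilon>. inverse (bound \<epsilon>) *
                             (LINT y|P \<epsilon> (\<theta>\<^sub>0 + u \<epsilon>). \<bar>K \<epsilon> y - L \<epsilon> y\<bar>)) \<longlongrightarrow> 0)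
                          (at_right 0))))"
proof -
  interpret wiener_process M w by (rule wiener)
  let ?F = "at_right (0::real)"
  define P where "P = obs_law M w S"
  define \<alpha> where "\<alpha> = (\<lambda>e. type1_error (P e \<theta>\<^sub>0) (K e))"
  define \<theta> where "\<theta> e = \<theta>\<^sub>0 + u e" for e
  define \<beta> where "\<beta> = (\<lambda>K' e. type2_error (P e (\<theta> e)) (K' e))"
  define I where "I = fisher_info S\<^sub>\<theta>"
  define \<rho> where "\<rho> = (\<lambda>e. u e / e * sqrt I)"
  define bound where "bound = (\<lambda>e. \<Phi> (x e - \<rho> e))"
  define \<Delta> where "\<Delta> e = (\<lambda>t. S t (\<theta> e) - S t \<theta>\<^sub>0)" for e
  \<comment> \<open>Three separations are in play: \<rho> from the claim, \<open>r\<close> from the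
    exact distance of the two signals, and \<open>d\<close>, the mean shift of the efficient
    statistic in units of its standard deviation.\<close>
  define r where "r e = sqrt (L2sq (\<Delta> e)) / e" for e
  define d where "d e = L2ip S\<^sub>\<theta> (\<Delta> e) / (e * sqrt I)" for e

  have pos: "\<forall>\<^sub>F e in ?F. 0 < e" by (rule eventually_at_right_less)
  have u_ev: "\<forall>\<^sub>F e in ?F. 0 < u e" using pos by eventually_elim (rule u_pos)
  have S\<theta>: "L2_unit S\<^sub>\<theta>" and I: "0 < I" and I_eq: "I = L2sq S\<^sub>\<theta>"
    using A1 by (auto simp: cond_A1_def I_def fisher_info_def)
  have S0: "L2_unit (\<lambda>t. S t \<theta>\<^sub>0)" by (rule signal[OF Theta(2)])

  \<comment> \<open>The alternatives approach \<open>\<theta>\<^sub>0\<close>, as A2 requires: the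
    power of \<open>u\<close> is the given vanishing quotient times the squared noise level.\<close>
  have "((\<lambda>e. u e powr (2 + lam) / e\<^sup>2 * e\<^sup>2) \<longlongrightarrow> 0 * 0\<^sup>2) ?F"
    by (rule tendsto_mult[OF u_small tendsto_power[OF tendsto_ident_at]])
  then have "((\<lambda>e. u e powr (2 + lam) / e\<^sup>2 * e\<^sup>2) \<longlongrightarrow> 0) ?F" by simp
  then have u_powr: "((\<lambda>e. u e powr (2 + lam)) \<longlongrightarrow> 0) ?F"
  proof (rule Lim_transform_eventually)
    show "\<forall>\<^sub>F e in ?F. u e powr (2 + lam) / e\<^sup>2 * e\<^sup>2 = u e powr (2 + lam)"
      using pos by eventually_elim simp
  qed
  have u0: "(u \<longlongrightarrow> 0) ?F"
    by (rule tendsto_0_of_powr[OF _ u_ev u_powr]) (use lambda in simp)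
  have \<theta>_lim: "(\<theta> \<longlongrightarrow> \<theta>\<^sub>0) ?F"
    using tendsto_add[OF tendsto_const[of "\<theta>\<^sub>0"] u0] by (simp add: \<theta>_def[abs_def])
  have \<theta>_at: "filterlim (\<lambda>e. \<theta>\<^sub>0 + u e) (at \<theta>\<^sub>0) ?F"
    using \<theta>_lim u_ev by (auto simp: filterlim_at \<theta>_def[abs_def] elim!: eventually_mono)
  have \<theta>_in: "\<forall>\<^sub>F e in ?F. \<theta> e \<in> \<Theta>"
    using topological_tendstoD[OF \<theta>_lim Theta] .

  let ?q1 = "\<lambda>\<theta>. L2sq (\<lambda>t. S t \<theta> - S t \<theta>\<^sub>0 - (\<theta> - \<theta>\<^sub>0) * S\<^sub>\<theta> t)"
  let ?q2 = "\<lambda>\<theta>. L2sq (\<lambda>t. S t \<theta> - S t \<theta>\<^sub>0) - (\<theta> - \<theta>\<^sub>0)\<^sup>2 * fisher_info S\<^sub>\<theta>"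
  have q1: "((\<lambda>e. ?q1 (\<theta>\<^sub>0 + u e) / e\<^sup>2) \<longlongrightarrow> 0) ?F"
    by (rule bigo_powr_over_square_tendsto[OF _ \<theta>_at u_ev u_small]) (use A2 in \<open>simp add: cond_A2_def\<close>)
  have q2: "((\<lambda>e. ?q2 (\<theta>\<^sub>0 + u e) / e\<^sup>2) \<longlongrightarrow> 0) ?F"
    by (rule bigo_powr_over_square_tendsto[OF _ \<theta>_at u_ev u_small]) (use A2 in \<open>simp add: cond_A2_def\<close>)

  have \<rho>_top: "filterlim \<rho> at_top ?F"
    unfolding \<rho>_def by (rule filterlim_at_top_mult_tendsto_pos[OF tendsto_const _ u_large]) (use I in simp)
  have \<rho>1: "\<forall>\<^sub>F e in ?F. 1 \<le> \<rho> e" using \<rho>_top by (simp add: filterlim_at_top)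
  \<comment> \<open>\<open>(r e)\<^sup>2 - (\<rho> e)\<^sup>2\<close> is the second remainder of A2
    over the squared noise level, and its modulus dominates that of the product because
    \<open>r e\<close> is nonnegative.\<close>
  have r_\<rho>: "((\<lambda>e. (r e - \<rho> e) * \<rho> e) \<longlongrightarrow> 0) ?F"
  proof (rule Lim_null_comparison[OF _ tendsto_rabs_zero[OF q2]])
    show "\<forall>\<^sub>F e in ?F. norm ((r e - \<rho> e) * \<rho> e) \<le> \<bar>?q2 (\<theta>\<^sub>0 + u e) / e\<^sup>2\<bar>"
      using pos \<rho>1
    proof eventually_elim
      case (elim e)
      have r0: "0 \<le> r e" using elim by (simp add: r_def L2sq_nonneg)
      have "(r e)\<^sup>2 - (\<rho> e)\<^sup>2 = ?q2 (\<theta>\<^sub>0 + u e) / e\<^sup>2"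
        using I unfolding r_def \<rho>_def \<Delta>_def \<theta>_def I_def
        by (simp add: power_divide power_mult_distrib L2sq_nonneg diff_divide_distrib)
      from this[symmetric] have "\<bar>?q2 (\<theta>\<^sub>0 + u e) / e\<^sup>2\<bar> = \<bar>(r e + \<rho> e) * (r e - \<rho> e)\<bar>"
        by (simp only: power2_eq_square square_diff_square_factored)
      then have "\<bar>?q2 (\<theta>\<^sub>0 + u e) / e\<^sup>2\<bar> = \<bar>r e - \<rho> e\<bar> * (r e + \<rho> e)"
        using r0 elim by (simp only: abs_mult mult.commute) simp
      moreover have "\<bar>r e - \<rho> e\<bar> * \<rho> e \<le> \<bar>r e - \<rho> e\<bar> * (r e + \<rho> e)"
        using r0 by (intro mult_left_mono) auto
      ultimately show ?case using elim by (simp add: abs_mult)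
    qed
  qed
  have r_ge: "\<forall>\<^sub>F e in ?F. \<rho> e - 1 \<le> r e"
    using \<rho>1 order_tendstoD(1)[OF r_\<rho>, of "-1", simplified]
  proof eventually_elim
    case (elim e)
    show ?case
    proof (rule ccontr)
      assume "\<not> \<rho> e - 1 \<le> r e"
      then have "(r e - \<rho> e) * \<rho> e \<le> (- 1) * \<rho> e" using elim by (intro mult_right_mono) auto
      then show False using elim by simp
    qed
  qed
  have "filterlim (\<lambda>e. - 1 + \<rho> e) at_top ?F"
    by (rule filterlim_tendsto_add_at_top[OF tendsto_const \<rho>_top])
  then have r_top: "filterlim r at_top ?F"
    by (rule filterlim_at_top_mono) (use r_ge in \<open>auto elim!: eventually_mono\<close>)
  have r1: "\<forall>\<^sub>F e in ?F. 1 \<le> r e" using r_top by (simp add: filterlim_at_top)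
  \<comment> \<open>Polarisation: the difference of the two remainders of A2 isolates the inner
    product of the signal difference with the derivative, which is the mean shift of the statistic
    up to normalisation.\<close>
  have d_\<rho>: "((\<lambda>e. (d e - \<rho> e) * \<rho> e) \<longlongrightarrow> 0) ?F"
  proof (rule Lim_transform_eventually)
    show "((\<lambda>e. (?q2 (\<theta>\<^sub>0 + u e) / e\<^sup>2 - ?q1 (\<theta>\<^sub>0 + u e) / e\<^sup>2) / 2) \<longlongrightarrow> 0) ?F"
      using tendsto_divide[OF tendsto_diff[OF q2 q1] tendsto_const[of 2]] by simp
    show "\<forall>\<^sub>F e in ?F. (?q2 (\<theta>\<^sub>0 + u e) / e\<^sup>2 - ?q1 (\<theta>\<^sub>0 + u e) / e\<^sup>2) / 2 = (d e - \<rho> e) * \<rho> e"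
      using pos \<theta>_in
    proof eventually_elim
      case (elim e)
      have \<Delta>: "L2_unit (\<Delta> e)" unfolding \<Delta>_def by (intro L2_unit_diff signal elim S0)
      let ?ip = "L2ip (\<Delta> e) S\<^sub>\<theta>"
      have "?q1 (\<theta>\<^sub>0 + u e) = L2sq (\<lambda>t. 1 * \<Delta> e t + (- u e) * S\<^sub>\<theta> t)"
        by (simp add: \<Delta>_def \<theta>_def)
      also have "\<dots> = L2sq (\<Delta> e) - 2 * u e * ?ip + (u e)\<^sup>2 * I"
        unfolding L2sq_linear[OF \<Delta> S\<theta>] by (simp add: I_eq)
      finally have q21: "?q2 (\<theta>\<^sub>0 + u e) - ?q1 (\<theta>\<^sub>0 + u e) = 2 * (u e * ?ip - (u e)\<^sup>2 * I)"
        by (simp add: \<Delta>_def \<theta>_def I_def)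
      have "(d e - \<rho> e) * \<rho> e = (u e * ?ip - (u e)\<^sup>2 * I) / e\<^sup>2"
      proof -
        have "(a / (e * s) - v / e * s) * (v / e * s) = (v * a - v\<^sup>2 * s\<^sup>2) / e\<^sup>2" if "0 < s" for a v s :: real
          using that elim by (simp add: field_simps power2_eq_square)
        from this[of "sqrt I" ?ip "u e"] show ?thesis
          using I by (simp add: d_def \<rho>_def mult.commute[of "S\<^sub>\<theta> _"])
      qed
      then show ?case unfolding diff_divide_distrib[symmetric] q21 by (simp del: right_diff_distrib_numeral)
    qed
  qed

  \<comment> \<open>The bound \<open>c\<close> on the levels enters as a lower bound
    \<open>- C\<close> for \<open>x\<close>.\<close>
  obtain C where C: "\<Phi> (- C) < 1 - c"
  proof -
    have "\<forall>\<^sub>F z in at_bot. \<Phi> z < 1 - c"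
      using order_tendstoD(2)[OF std_normal.cdf_lim_at_bot, of "1 - c"] c(1) by simp
    then obtain z where "\<Phi> z < 1 - c" using eventually_happens'[OF trivial_limit_at_bot_linorder] by blast
    then show ?thesis using that[of "- z"] by simp
  qed
  have x_bd: "\<forall>\<^sub>F e in ?F. - C \<le> x e"
    using pos
  proof eventually_elim
    case (elim e)
    have "\<Phi> (- C) < \<Phi> (x e)" using c(2)[OF elim] x[OF elim] C by simp
    then show ?case by (simp add: std_normal_cdf_less_iff)
  qed

  have bound_pos: "0 < bound e" for e by (simp add: bound_def std_normal_cdf_pos)
  have ratio_r: "((\<lambda>e. \<Phi> (x e - r e) / bound e) \<longlongrightarrow> 1) ?F"
    unfolding bound_def by (rule std_normal_cdf_ratio_tendsto[OF \<rho>_top x_bd r_\<rho>])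
  have ratio_d: "((\<lambda>e. \<Phi> (x e - d e) / bound e) \<longlongrightarrow> 1) ?F"
    unfolding bound_def by (rule std_normal_cdf_ratio_tendsto[OF \<rho>_top x_bd d_\<rho>])

  have space_P: "space (P e \<theta>') = space path_space" for e \<theta>'
    unfolding P_def by (rule sets_eq_imp_space_eq) simp
  have meas_P: "f \<in> borel_measurable (P e \<theta>') \<longleftrightarrow> f \<in> borel_measurable path_space"
    for f :: "(real \<Rightarrow> real) \<Rightarrow> real" and e \<theta>'
    unfolding P_def by (rule measurable_cong_sets[THEN arg_cong[where f="\<lambda>A. f \<in> A"]]) simp_all
  have shift: "\<forall>\<^sub>F e in ?F. \<exists>Z. gaussian_shift (P e \<theta>\<^sub>0) Z (r e) \<and> gaussian_shift.P\<^sub>1 (P e \<theta>\<^sub>0) Z (r e) = P e (\<theta> e)"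
    using pos \<theta>_in r1
  proof eventually_elim
    case (elim e)
    have "0 < r e" using elim by simp
    then have "0 < sqrt (L2sq (\<lambda>t. S t (\<theta> e) - S t \<theta>\<^sub>0)) / e" by (simp only: r_def \<Delta>_def)
    from obs_law_gaussian_shift[where S=S and \<theta>\<^sub>0="\<theta>\<^sub>0" and \<theta>\<^sub>1="\<theta> e", OF elim(1) S0 signal[OF elim(2)] this]
    show ?case unfolding P_def r_def \<Delta>_def by blast
  qed
  have K_test: "\<forall>\<^sub>F e in ?F. test_of_level (P e \<theta>\<^sub>0) (K e) (1 - \<Phi> (x e))"
    using pos
  proof eventually_elim
    case (elim e)
    then show ?case
      using tests[OF elim] x[OF elim] by (simp add: is_test_def meas_P space_P type1_error_def P_def[symmetric])
  qed

  have lower: "asymp_ge (\<beta> K) bound"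
  proof (rule asymp_ge_of_ratio[OF bound_pos ratio_r])
    show "\<forall>\<^sub>F e in ?F. \<Phi> (x e - r e) \<le> \<beta> K e"
      using shift K_test
    proof eventually_elim
      case (elim e)
      then obtain Z where Z: "gaussian_shift (P e \<theta>\<^sub>0) Z (r e)"
        and Q: "gaussian_shift.P\<^sub>1 (P e \<theta>\<^sub>0) Z (r e) = P e (\<theta> e)" by blast
      have "\<Phi> (x e - r e) \<le> (LINT y|P e (\<theta> e). 1 - K e y)"
        unfolding Q[symmetric] by (rule gaussian_shift.neyman_pearson[OF Z]) (use elim in auto)
      then show ?case by (simp add: \<beta>_def type2_error_def)
    qed
  qed

  have existence: "\<forall>e>0. \<exists>T. efficient_statistic (P e) \<Theta> S\<^sub>\<theta> T"
    unfolding P_def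
    by (intro allI impI efficient_statistic_exists[where S=S and \<Theta>=\<Theta>] S\<theta> signal)

  have main: "(\<forall>e>0. \<exists>h. type1_error (P e \<theta>\<^sub>0) (threshold_test (T e) h) = \<alpha> e)
      \<and> (\<forall>h L. L = (\<lambda>e. threshold_test (T e) (h e)) \<longrightarrow>
            (\<forall>e>0. type1_error (P e \<theta>\<^sub>0) (L e) = \<alpha> e) \<longrightarrow>
            asymp_eq (\<beta> L) bound
          \<and> (asymp_eq (\<beta> K) bound \<longrightarrow>
                (level_not_too_small x \<rho> \<longrightarrow>
                  ((\<lambda>e. inverse (\<alpha> e) * (LINT y|P e \<theta>\<^sub>0. \<bar>K e y - L e y\<bar>)) \<longlongrightarrow> 0) ?F)
              \<and> ((\<lambda>e. inverse (bound e) * (LINT y|P e (\<theta> e). \<bar>K e y - L e y\<bar>)) \<longlongrightarrow> 0) ?F))"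
    if T: "\<forall>e>0. efficient_statistic (P e) \<Theta> S\<^sub>\<theta> (T e)" for T
  proof (intro conjI allI impI)
    define m where "m \<theta>' = L2ip S\<^sub>\<theta> (\<lambda>t. S t \<theta>') / sqrt I" for \<theta>'
    have T_errors: "T e \<in> borel_measurable path_space"
        "type1_error (P e \<theta>') (threshold_test (T e) h) = 1 - \<Phi> ((h - m \<theta>') / e)"
        "type2_error (P e \<theta>') (threshold_test (T e) h) = \<Phi> ((h - m \<theta>') / e)"
      if "0 < e" "\<theta>' \<in> \<Theta>" for e \<theta>' h
    proof -
      have "efficient_statistic (obs_law M w S e) \<Theta> S\<^sub>\<theta> (T e)" using T that by (simp add: P_def)
      from efficient_statistic_errors[where S=S and \<theta>="\<theta>'", OF that(1) S\<theta> I[unfolded I_def] signal[OF that(2)] that(2) this]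
      show "T e \<in> borel_measurable path_space"
        "type1_error (P e \<theta>') (threshold_test (T e) h) = 1 - \<Phi> ((h - m \<theta>') / e)"
        "type2_error (P e \<theta>') (threshold_test (T e) h) = \<Phi> ((h - m \<theta>') / e)"
        by (simp_all add: P_def I_def m_def)
    qed
    have \<alpha>_eq: "\<alpha> e = 1 - \<Phi> (x e)" if "0 < e" for e
      using x[OF that] by (simp add: \<alpha>_def P_def)
    show "\<exists>h. type1_error (P e \<theta>\<^sub>0) (threshold_test (T e) h) = \<alpha> e" if "0 < e" for e
      by (rule exI[of _ "m \<theta>\<^sub>0 + e * x e"]) (use that in \<open>simp add: T_errors Theta \<alpha>_eq\<close>)

    fix h L assume L: "L = (\<lambda>e. threshold_test (T e) (h e))"
      and level: "\<forall>e>0. type1_error (P e \<theta>\<^sub>0) (L e) = \<alpha> e"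
    \<comment> \<open>The level fixes the threshold because \<Phi> is injective; the type II error
      of \<open>L\<close> then becomes \<open>\<Phi> (x e - d e)\<close> without any
      approximation.\<close>
    have h: "(h e - m \<theta>\<^sub>0) / e = x e" if "0 < e" for e
    proof -
      have "1 - \<Phi> ((h e - m \<theta>\<^sub>0) / e) = 1 - \<Phi> (x e)"
        using level that T_errors(2)[OF that Theta(2), of "h e"] by (simp add: L \<alpha>_eq)
      then show ?thesis by (simp add: std_normal_cdf_eq_iff)
    qed
    have \<beta>L: "\<forall>\<^sub>F e in ?F. \<Phi> (x e - d e) / bound e = \<beta> L e / bound e"
      using pos \<theta>_in
    proof eventually_elim
      case (elim e)
      have "L2ip S\<^sub>\<theta> (\<Delta> e) = L2ip S\<^sub>\<theta> (\<lambda>t. S t (\<theta> e)) - L2ip S\<^sub>\<theta> (\<lambda>t. S t \<theta>\<^sub>0)"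
        using L2_unit_mult[OF S\<theta> signal[OF elim(2)]] L2_unit_mult[OF S\<theta> S0]
        by (simp add: \<Delta>_def right_diff_distrib)
      then have "d e = (m (\<theta> e) - m \<theta>\<^sub>0) / e"
        by (simp add: d_def m_def diff_divide_distrib mult.commute)
      then have "(h e - m (\<theta> e)) / e = x e - d e"
        unfolding h[OF elim(1), symmetric] by (simp flip: diff_divide_distrib)
      then show ?case using T_errors(3)[OF elim] by (simp add: \<beta>_def L)
    qed
    have \<beta>L_lim: "((\<lambda>e. \<beta> L e / bound e) \<longlongrightarrow> 1) ?F"
      by (rule Lim_transform_eventually[OF ratio_d \<beta>L])
    then show "asymp_eq (\<beta> L) bound" by (simp add: asymp_eq_iff_ratio bound_pos)

    assume "asymp_eq (\<beta> K) bound"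
    then have \<beta>K_lim: "((\<lambda>e. \<beta> K e / bound e) \<longlongrightarrow> 1) ?F" by (simp add: asymp_eq_iff_ratio bound_pos)
    \<comment> \<open>\<open>near_optimal_tests_close\<close> is normalised by the exact optimum
      \<open>\<Phi> (x e - r e)\<close>; \<open>ratio_r\<close> passes to it from
      \<open>bound\<close>.\<close>
    have rescale: "((\<lambda>e. (LINT y|P e (\<theta> e). 1 - K' e y) / \<Phi> (x e - r e)) \<longlongrightarrow> 1) ?F"
      if "((\<lambda>e. \<beta> K' e / bound e) \<longlongrightarrow> 1) ?F" for K'
    proof -
      have "((\<lambda>e. (\<beta> K' e / bound e) / (\<Phi> (x e - r e) / bound e)) \<longlongrightarrow> 1 / 1) ?F"
        by (rule tendsto_divide[OF that ratio_r]) simp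
      then show ?thesis
        using bound_pos by (simp add: \<beta>_def type2_error_def less_imp_neq[symmetric])
    qed
    have L_test: "\<forall>\<^sub>F e in ?F. test_of_level (P e \<theta>\<^sub>0) (L e) (1 - \<Phi> (x e))"
      using pos
    proof eventually_elim
      case (elim e)
      have [measurable]: "T e \<in> borel_measurable path_space" by (rule T_errors(1)[OF elim Theta(2)])
      have "L e \<in> borel_measurable path_space"
        unfolding L threshold_test_def[abs_def] by measurable
      then show ?case
        using level elim by (auto simp: meas_P type1_error_def \<alpha>_eq) (auto simp: L threshold_test_def)
    qed
    note close = near_optimal_tests_close[OF shift K_test L_test r_top x_bd rescale[OF \<beta>K_lim] rescale[OF \<beta>L_lim]]
    have cancel: "E / \<Phi> z * (\<Phi> z / b) = inverse b * E" for E z b :: real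
      using std_normal_cdf_pos[of z] by (simp add: divide_inverse)
    show "((\<lambda>e. inverse (bound e) * (LINT y|P e (\<theta> e). \<bar>K e y - L e y\<bar>)) \<longlongrightarrow> 0) ?F"
      using tendsto_mult[OF close(1) ratio_r] unfolding cancel mult_zero_left .

    assume "level_not_too_small x \<rho>"
    then obtain \<delta> where \<delta>: "0 < \<delta>" "\<forall>\<^sub>F e in ?F. x e \<le> (1 - \<delta>) * \<rho> e"
      unfolding level_not_too_small_def by blast
    \<comment> \<open>The gap is given relative to \<rho> but needed relative to \<open>r\<close>.
      Capping at 1 keeps \<open>1 - ?\<delta>\<close> nonnegative, so that
      \<open>\<rho> e \<le> r e + 1\<close> may be inserted; half of the gap absorbs the extra 1
      once \<open>r e\<close> is at least \<open>2 / ?\<delta>\<close>.\<close>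
    let ?\<delta> = "min \<delta> 1"
    have "\<forall>\<^sub>F e in ?F. 2 / ?\<delta> \<le> r e" using r_top by (simp add: filterlim_at_top)
    with \<delta>(2) r_ge \<rho>1 have "\<forall>\<^sub>F e in ?F. x e \<le> (1 - ?\<delta> / 2) * r e"
    proof eventually_elim
      case (elim e)
      have "x e \<le> (1 - \<delta>) * \<rho> e" by (rule elim)
      also have "\<dots> \<le> (1 - ?\<delta>) * \<rho> e" using elim by (intro mult_right_mono) auto
      also have "\<dots> \<le> (1 - ?\<delta>) * (r e + 1)" using elim by (intro mult_left_mono) auto
      also have "\<dots> \<le> (1 - ?\<delta>) * r e + 1" using \<delta>(1) by (simp add: distrib_left)
      also have "\<dots> \<le> (1 - ?\<delta>) * r e + ?\<delta> / 2 * r e"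
      proof -
        have "2 \<le> r e * ?\<delta>" using elim(4) \<delta>(1) by (subst (asm) pos_divide_le_eq) auto
        then show ?thesis by (simp add: mult.commute)
      qed
      also have "\<dots> = (1 - ?\<delta> / 2) * r e" by (simp add: algebra_simps)
      finally show ?case .
    qed
    then have "((\<lambda>e. (LINT y|P e \<theta>\<^sub>0. \<bar>K e y - L e y\<bar>) / (1 - \<Phi> (x e))) \<longlongrightarrow> 0) ?F"
      using \<delta>(1) by (intro close(2)[of "?\<delta> / 2"]) auto
    then show "((\<lambda>e. inverse (\<alpha> e) * (LINT y|P e \<theta>\<^sub>0. \<bar>K e y - L e y\<bar>)) \<longlongrightarrow> 0) ?F"
    proof (rule Lim_transform_eventually)
      show "\<forall>\<^sub>F e in ?F. (LINT y|P e \<theta>\<^sub>0. \<bar>K e y - L e y\<bar>) / (1 - \<Phi> (x e)) =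
          inverse (\<alpha> e) * (LINT y|P e \<theta>\<^sub>0. \<bar>K e y - L e y\<bar>)"
        using pos by eventually_elim (simp add: \<alpha>_eq divide_inverse mult.commute)
    qed
  qed
  show ?thesis
    unfolding Let_def
    using lower existence main
    unfolding \<beta>_def bound_def \<alpha>_def \<rho>_def \<theta>_def I_def P_def by blast
qed

end
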